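(* Let $\mathbb{W}$ be a 2-category with finite (weighted) limits and a notion of discreteness, let $A\in\mathbb{W}$, and let $E(A)\in\mathbf{cat}(\mathit{Disc}(\mathbb{W}))$ be its associated category. For each of the following connectives: internal terminal value, internal initial value, internal products, internal closed products, internal coproducts, if $A$ has the connective in $\mathbb{W}$, then $E(A)$ has the corresponding connective in the usual sense of internal categories. Moreover, if the discrete objects are dense in $\mathbb{W}$, then the converse holds as well: if $E(A)$ has the connective, then so does $A$.
   Context: A notion of discreteness on a 2-category $\mathbb{W}$ is given by a 1-category $\mathbb{C}$ and a 2-fully faithful functor $F\colon\mathbb{C}\to\mathbb{W}$ (each $\hom_{\mathbb{C}}(X,Y)\to\hom_{\mathbb{W}}(FX,FY)$ is an isomorphism of categories, the domain being regarded as discrete) which is left adjoint, as a functor of underlying 1-categories, to a 1-functor $U\colon\mathbb{W}\to\mathbb{C}$ with invertible unit. One identifies $\mathbb{C}$ with the full image of $F$, denoted $\mathit{Disc}(\mathbb{W})$; write $|A|=F(U(A))$ and $\epsilon_A\colon|A|\to A$ for the counit. Discrete objects are dense if the 2-functor $A\mapsto\hom_{\mathbb{W}}(F(-),A)$, $\mathbb{W}\to\mathbf{Cat}^{\mathbb{C}^{op}}$, is fully faithful (isomorphisms on hom-categories). Connectives: in a 2-category with finite products, an object $A$ has an internal terminal (initial) value if $!\colon A\to1$ has a right (left) adjoint; internal products (coproducts) if the diagonal $\Delta_A\colon A\to A\times A$ has a right adjoint $\times_A$ (left adjoint $\sqcup_A$). $A$ has internal closed products if it has internal products and $\langle\times_A\circ(\mathit{id}\times\epsilon_A),\pi_{|A|}\rangle\colon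 A\times|A|\to A\times|A|$ has a right adjoint. For a $\mathbb{C}$-internal category, the connectives in the usual sense are the same adjoints taken in the 2-category $\mathbf{cat}(\mathbb{C})$ of $\mathbb{C}$-internal categories, with the standard discreteness: for an internal category $\mathbb{A}$, $|\mathbb{A}|$ is the discrete internal category on the object of objects $\mathbb{A}_0$ and $\epsilon$ is the canonical inclusion. Associated category: $E(A)$ is the $\mathbb{C}$-internal category whose externalisation is isomorphic, 2-naturally in $A$, to $\mathit{fam}_F(A)=\hom_{\mathbb{W}}(F(-),A)\colon\mathbb{C}^{op}\to\mathbf{Cat}$ (it exists under the stated hypotheses); this gives a 2-functor $E\colon\mathbb{W}\to\mathbf{cat}(\mathbb{C})$. The externalisation of an internal category $\mathbb{A}$ sends $X\in\mathbb{C}$ to the category with objects the morphisms $X\to\mathbb{A}_0$ and with morphisms $x\to y$ the morphisms $f\colon X\to\mathbb{A}_1$ with $\langle\mathit{dom},\mathit{cod}\rangle\circ f=\langle x,y\rangle$, reindexing being precomposition. *)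

theory Defs
  imports Main
begin

section \<open>Categories and functors\<close>

record ('o, 'a) cat =
  Ob :: "'o set"
  Ar :: "'a set"
  Src :: "'a \<Rightarrow> 'o"
  Tgt :: "'a \<Rightarrow> 'o"
  Idn :: "'o \<Rightarrow> 'a"
  Cmp :: "'a \<Rightarrow> 'a \<Rightarrow> 'a"  \<comment> \<open>\<open>Cmp C g f\<close> is \<open>g\<close> after \<open>f\<close>\<close>

definition hom :: "('o, 'a) cat \<Rightarrow> 'o \<Rightarrow> 'o \<Rightarrow> 'a set" where
  "hom C X Y = {f \<in> Ar C. Src C f = X \<and> Tgt C f = Y}"

definition category :: "('o, 'a) cat \<Rightarrow> bool" where
  "category C \<longleftrightarrow>
     (\<forall>f\<in>Ar C. Src C f \<in> Ob C \<and> Tgt C f \<in> Ob C) \<and>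
     (\<forall>X\<in>Ob C. Idn C X \<in> hom C X X) \<and>
     (\<forall>f\<in>Ar C. \<forall>g\<in>Ar C. Tgt C f = Src C g \<longrightarrow> Cmp C g f \<in> hom C (Src C f) (Tgt C g)) \<and>
     (\<forall>f\<in>Ar C. Cmp C f (Idn C (Src C f)) = f \<and> Cmp C (Idn C (Tgt C f)) f = f) \<and>
     (\<forall>f\<in>Ar C. \<forall>g\<in>Ar C. \<forall>h\<in>Ar C. Tgt C f = Src C g \<longrightarrow> Tgt C g = Src C h \<longrightarrow>
        Cmp C (Cmp C h g) f = Cmp C h (Cmp C g f))"

definition op_cat :: "('o, 'a) cat \<Rightarrow> ('o, 'a) cat" where
  "op_cat C = \<lparr>Ob = Ob C, Ar = Ar C, Src = Tgt C, Tgt = Src C, Idn = Idn C,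
     Cmp = (\<lambda>g f. Cmp C f g)\<rparr>"

definition disc_cat :: "'a set \<Rightarrow> ('a, 'a) cat" where
  "disc_cat S = \<lparr>Ob = S, Ar = S, Src = (\<lambda>x. x), Tgt = (\<lambda>x. x), Idn = (\<lambda>x. x),
     Cmp = (\<lambda>g f. f)\<rparr>"

definition invertible :: "('o, 'a) cat \<Rightarrow> 'a \<Rightarrow> bool" where
  "invertible C f \<longleftrightarrow> f \<in> Ar C \<and>
     (\<exists>g\<in>hom C (Tgt C f) (Src C f).
        Cmp C g f = Idn C (Src C f) \<and> Cmp C f g = Idn C (Tgt C f))"

record ('o, 'a, 'p, 'b) fctr =
  FO :: "'o \<Rightarrow> 'p"
  FA :: "'a \<Rightarrow> 'b"

definition is_functor ::
  "('o, 'a) cat \<Rightarrow> ('p, 'b) cat \<Rightarrow> ('o, 'a, 'p, 'b) fctr \<Rightarrow> bool" where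
  "is_functor C D F \<longleftrightarrow>
     (\<forall>X\<in>Ob C. FO F X \<in> Ob D) \<and>
     (\<forall>f\<in>Ar C. FA F f \<in> hom D (FO F (Src C f)) (FO F (Tgt C f))) \<and>
     (\<forall>X\<in>Ob C. FA F (Idn C X) = Idn D (FO F X)) \<and>
     (\<forall>f\<in>Ar C. \<forall>g\<in>Ar C. Tgt C f = Src C g \<longrightarrow>
        FA F (Cmp C g f) = Cmp D (FA F g) (FA F f))"

definition iso_functor ::
  "('o, 'a) cat \<Rightarrow> ('p, 'b) cat \<Rightarrow> ('o, 'a, 'p, 'b) fctr \<Rightarrow> bool" where
  "iso_functor C D F \<longleftrightarrow>
     is_functor C D F \<and> bij_betw (FO F) (Ob C) (Ob D) \<and> bij_betw (FA F) (Ar C) (Ar D)"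

definition adjunction ::
  "('x, 'f) cat \<Rightarrow> ('o, 'm) cat \<Rightarrow> ('x, 'f, 'o, 'm) fctr \<Rightarrow> ('o, 'm, 'x, 'f) fctr \<Rightarrow>
   ('x \<Rightarrow> 'f) \<Rightarrow> ('o \<Rightarrow> 'm) \<Rightarrow> bool" where
  "adjunction C D F U \<eta> \<epsilon> \<longleftrightarrow>
     is_functor C D F \<and> is_functor D C U \<and>
     (\<forall>X\<in>Ob C. \<eta> X \<in> hom C X (FO U (FO F X))) \<and>
     (\<forall>f\<in>Ar C. Cmp C (FA U (FA F f)) (\<eta> (Src C f)) = Cmp C (\<eta> (Tgt C f)) f) \<and>
     (\<forall>A\<in>Ob D. \<epsilon> A \<in> hom D (FO F (FO U A)) A) \<and>
     (\<forall>u\<in>Ar D. Cmp D u (\<epsilon> (Src D u)) = Cmp D (\<epsilon> (Tgt D u)) (FA F (FA U u))) \<and>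
     (\<forall>X\<in>Ob C. Cmp D (\<epsilon> (FO F X)) (FA F (\<eta> X)) = Idn D (FO F X)) \<and>
     (\<forall>A\<in>Ob D. Cmp C (FA U (\<epsilon> A)) (\<eta> (FO U A)) = Idn C (FO U A))"

definition is_pullback ::
  "('o, 'a) cat \<Rightarrow> 'o \<Rightarrow> 'a \<Rightarrow> 'a \<Rightarrow> 'a \<Rightarrow> 'a \<Rightarrow> bool" where
  "is_pullback C P p q f g \<longleftrightarrow>
     f \<in> Ar C \<and> g \<in> Ar C \<and> Tgt C f = Tgt C g \<and>
     p \<in> hom C P (Src C f) \<and> q \<in> hom C P (Src C g) \<and> Cmp C f p = Cmp C g q \<and>
     (\<forall>X\<in>Ob C. \<forall>x\<in>hom C X (Src C f). \<forall>y\<in>hom C X (Src C g). Cmp C f x = Cmp C g y \<longrightarrow>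
        (\<exists>!h. h \<in> hom C X P \<and> Cmp C p h = x \<and> Cmp C q h = y))"


section \<open>2-categories and 2-functors\<close>

text \<open>A (strict) 2-category consists of its underlying category \<open>One\<close>, the category \<open>Two\<close>
  whose objects are the 1-cells and whose arrows are the 2-cells under vertical composition,
  and horizontal composition; \<open>HC W b a\<close> is \<open>b\<close> after \<open>a\<close>.\<close>

record ('o, 'm, 'c) twocat =
  One :: "('o, 'm) cat"
  Two :: "('m, 'c) cat"
  HC :: "'c \<Rightarrow> 'c \<Rightarrow> 'c"

definition src0 :: "('o, 'm, 'c) twocat \<Rightarrow> 'c \<Rightarrow> 'o" where
  "src0 W a = Src (One W) (Src (Two W) a)"

definition tgt0 :: "('o, 'm, 'c) twocat \<Rightarrow> 'c \<Rightarrow> 'o" where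
  "tgt0 W a = Tgt (One W) (Src (Two W) a)"

definition twocategory :: "('o, 'm, 'c) twocat \<Rightarrow> bool" where
  "twocategory W \<longleftrightarrow>
     category (One W) \<and> category (Two W) \<and> Ob (Two W) = Ar (One W) \<and>
     (\<forall>a\<in>Ar (Two W). Src (One W) (Tgt (Two W) a) = src0 W a \<and>
                      Tgt (One W) (Tgt (Two W) a) = tgt0 W a) \<and>
     (\<forall>a\<in>Ar (Two W). \<forall>b\<in>Ar (Two W). tgt0 W a = src0 W b \<longrightarrow>
        HC W b a \<in> hom (Two W) (Cmp (One W) (Src (Two W) b) (Src (Two W) a))
                               (Cmp (One W) (Tgt (Two W) b) (Tgt (Two W) a))) \<and>
     (\<forall>f\<in>Ar (One W). \<forall>g\<in>Ar (One W). Tgt (One W) f = Src (One W) g \<longrightarrow>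
        HC W (Idn (Two W) g) (Idn (Two W) f) = Idn (Two W) (Cmp (One W) g f)) \<and>
     (\<forall>a\<in>Ar (Two W). \<forall>a'\<in>Ar (Two W). \<forall>b\<in>Ar (Two W). \<forall>b'\<in>Ar (Two W).
        tgt0 W a = src0 W b \<longrightarrow> Tgt (Two W) a = Src (Two W) a' \<longrightarrow>
        Tgt (Two W) b = Src (Two W) b' \<longrightarrow>
        HC W (Cmp (Two W) b' b) (Cmp (Two W) a' a) =
        Cmp (Two W) (HC W b' a') (HC W b a)) \<and>
     (\<forall>a\<in>Ar (Two W).
        HC W a (Idn (Two W) (Idn (One W) (src0 W a))) = a \<and>
        HC W (Idn (Two W) (Idn (One W) (tgt0 W a))) a = a) \<and>
     (\<forall>a\<in>Ar (Two W). \<forall>b\<in>Ar (Two W). \<forall>c\<in>Ar (Two W).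
        tgt0 W a = src0 W b \<longrightarrow> tgt0 W b = src0 W c \<longrightarrow>
        HC W (HC W c b) a = HC W c (HC W b a))"

definition homcat :: "('o, 'm, 'c) twocat \<Rightarrow> 'o \<Rightarrow> 'o \<Rightarrow> ('m, 'c) cat" where
  "homcat W A B = \<lparr>Ob = hom (One W) A B, Ar = {a \<in> Ar (Two W). src0 W a = A \<and> tgt0 W a = B},
     Src = Src (Two W), Tgt = Tgt (Two W), Idn = Idn (Two W), Cmp = Cmp (Two W)\<rparr>"

definition loc_disc :: "('o, 'a) cat \<Rightarrow> ('o, 'a, 'a) twocat" where
  "loc_disc C = \<lparr>One = C, Two = disc_cat (Ar C), HC = Cmp C\<rparr>"

abbreviation wl :: "('o, 'm, 'c) twocat \<Rightarrow> 'm \<Rightarrow> 'c \<Rightarrow> 'c" where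
  "wl W g a \<equiv> HC W (Idn (Two W) g) a"

abbreviation wr :: "('o, 'm, 'c) twocat \<Rightarrow> 'c \<Rightarrow> 'm \<Rightarrow> 'c" where
  "wr W b f \<equiv> HC W b (Idn (Two W) f)"

record ('o, 'm, 'c, 'p, 'n, 'd) twofun =
  T0 :: "'o \<Rightarrow> 'p"
  T1 :: "'m \<Rightarrow> 'n"
  T2 :: "'c \<Rightarrow> 'd"

definition is_2functor ::
  "('o, 'm, 'c) twocat \<Rightarrow> ('p, 'n, 'd) twocat \<Rightarrow> ('o, 'm, 'c, 'p, 'n, 'd) twofun \<Rightarrow> bool" where
  "is_2functor K W G \<longleftrightarrow>
     is_functor (One K) (One W) \<lparr>FO = T0 G, FA = T1 G\<rparr> \<and>
     is_functor (Two K) (Two W) \<lparr>FO = T1 G, FA = T2 G\<rparr> \<and>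
     (\<forall>a\<in>Ar (Two K). \<forall>b\<in>Ar (Two K). tgt0 K a = src0 K b \<longrightarrow>
        T2 G (HC K b a) = HC W (T2 G b) (T2 G a))"

definition id_2functor :: "('o, 'm, 'c, 'o, 'm, 'c) twofun" where
  "id_2functor = \<lparr>T0 = (\<lambda>x. x), T1 = (\<lambda>x. x), T2 = (\<lambda>x. x)\<rparr>"


section \<open>2-functors into Cat\<close>

text \<open>A 2-functor from a 2-category into \<open>Cat\<close>: \<open>Fib\<close> gives the categories, \<open>Tr\<close> the functors
  assigned to 1-cells and \<open>Tr2\<close> the components of the natural transformations assigned to
  2-cells.\<close>

record ('o, 'm, 'c, 'p, 'q) catfun =
  Fib :: "'o \<Rightarrow> ('p, 'q) cat"
  Tr :: "'m \<Rightarrow> ('p, 'q, 'p, 'q) fctr"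
  Tr2 :: "'c \<Rightarrow> 'p \<Rightarrow> 'q"

definition is_catfun ::
  "('o, 'm, 'c) twocat \<Rightarrow> ('o, 'm, 'c, 'p, 'q) catfun \<Rightarrow> bool" where
  "is_catfun K P \<longleftrightarrow>
     (\<forall>X\<in>Ob (One K). category (Fib P X)) \<and>
     (\<forall>f\<in>Ar (One K). is_functor (Fib P (Src (One K) f)) (Fib P (Tgt (One K) f)) (Tr P f)) \<and>
     (\<forall>X\<in>Ob (One K). (\<forall>p\<in>Ob (Fib P X). FO (Tr P (Idn (One K) X)) p = p) \<and>
                      (\<forall>q\<in>Ar (Fib P X). FA (Tr P (Idn (One K) X)) q = q)) \<and>
     (\<forall>f\<in>Ar (One K). \<forall>g\<in>Ar (One K). Tgt (One K) f = Src (One K) g \<longrightarrow>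
        (\<forall>p\<in>Ob (Fib P (Src (One K) f)).
           FO (Tr P (Cmp (One K) g f)) p = FO (Tr P g) (FO (Tr P f) p)) \<and>
        (\<forall>q\<in>Ar (Fib P (Src (One K) f)).
           FA (Tr P (Cmp (One K) g f)) q = FA (Tr P g) (FA (Tr P f) q))) \<and>
     (\<forall>a\<in>Ar (Two K).
        (\<forall>p\<in>Ob (Fib P (src0 K a)).
           Tr2 P a p \<in> hom (Fib P (tgt0 K a)) (FO (Tr P (Src (Two K) a)) p)
                                              (FO (Tr P (Tgt (Two K) a)) p)) \<and>
        (\<forall>q\<in>Ar (Fib P (src0 K a)).
           Cmp (Fib P (tgt0 K a)) (Tr2 P a (Tgt (Fib P (src0 K a)) q))
                                  (FA (Tr P (Src (Two K) a)) q) =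
           Cmp (Fib P (tgt0 K a)) (FA (Tr P (Tgt (Two K) a)) q)
                                  (Tr2 P a (Src (Fib P (src0 K a)) q)))) \<and>
     (\<forall>f\<in>Ar (One K). \<forall>p\<in>Ob (Fib P (Src (One K) f)).
        Tr2 P (Idn (Two K) f) p = Idn (Fib P (Tgt (One K) f)) (FO (Tr P f) p)) \<and>
     (\<forall>a\<in>Ar (Two K). \<forall>b\<in>Ar (Two K). Tgt (Two K) a = Src (Two K) b \<longrightarrow>
        (\<forall>p\<in>Ob (Fib P (src0 K a)).
           Tr2 P (Cmp (Two K) b a) p = Cmp (Fib P (tgt0 K a)) (Tr2 P b p) (Tr2 P a p))) \<and>
     (\<forall>a\<in>Ar (Two K). \<forall>b\<in>Ar (Two K). tgt0 K a = src0 K b \<longrightarrow>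
        (\<forall>p\<in>Ob (Fib P (src0 K a)).
           Tr2 P (HC K b a) p =
           Cmp (Fib P (tgt0 K b)) (Tr2 P b (FO (Tr P (Tgt (Two K) a)) p))
                                  (FA (Tr P (Src (Two K) b)) (Tr2 P a p))))"

definition twonat ::
  "('o, 'm, 'c) twocat \<Rightarrow> ('o, 'm, 'c, 'p, 'q) catfun \<Rightarrow> ('o, 'm, 'c, 'r, 's) catfun \<Rightarrow>
   ('o \<Rightarrow> ('p, 'q, 'r, 's) fctr) \<Rightarrow> bool" where
  "twonat K P Q \<alpha> \<longleftrightarrow>
     (\<forall>X\<in>Ob (One K). is_functor (Fib P X) (Fib Q X) (\<alpha> X)) \<and>
     (\<forall>f\<in>Ar (One K).
        (\<forall>p\<in>Ob (Fib P (Src (One K) f)).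
           FO (\<alpha> (Tgt (One K) f)) (FO (Tr P f) p) = FO (Tr Q f) (FO (\<alpha> (Src (One K) f)) p)) \<and>
        (\<forall>q\<in>Ar (Fib P (Src (One K) f)).
           FA (\<alpha> (Tgt (One K) f)) (FA (Tr P f) q) = FA (Tr Q f) (FA (\<alpha> (Src (One K) f)) q))) \<and>
     (\<forall>a\<in>Ar (Two K). \<forall>p\<in>Ob (Fib P (src0 K a)).
        FA (\<alpha> (tgt0 K a)) (Tr2 P a p) = Tr2 Q a (FO (\<alpha> (src0 K a)) p))"

definition modification ::
  "('o, 'm, 'c) twocat \<Rightarrow> ('o, 'm, 'c, 'p, 'q) catfun \<Rightarrow> ('o, 'm, 'c, 'r, 's) catfun \<Rightarrow>
   ('o \<Rightarrow> ('p, 'q, 'r, 's) fctr) \<Rightarrow> ('o \<Rightarrow> ('p, 'q, 'r, 's) fctr) \<Rightarrow> ('o \<Rightarrow> 'p \<Rightarrow> 's) \<Rightarrow> bool" where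
  "modification K P Q \<alpha> \<beta> \<mu> \<longleftrightarrow>
     (\<forall>X\<in>Ob (One K).
        (\<forall>p\<in>Ob (Fib P X). \<mu> X p \<in> hom (Fib Q X) (FO (\<alpha> X) p) (FO (\<beta> X) p)) \<and>
        (\<forall>q\<in>Ar (Fib P X).
           Cmp (Fib Q X) (\<mu> X (Tgt (Fib P X) q)) (FA (\<alpha> X) q) =
           Cmp (Fib Q X) (FA (\<beta> X) q) (\<mu> X (Src (Fib P X) q)))) \<and>
     (\<forall>f\<in>Ar (One K). \<forall>p\<in>Ob (Fib P (Src (One K) f)).
        FA (Tr Q f) (\<mu> (Src (One K) f) p) = \<mu> (Tgt (One K) f) (FO (Tr P f) p))"

text \<open>\<open>iso_to_transf H K P Q \<Phi>0 \<Phi>1\<close>: the functor \<open>(\<Phi>0, \<Phi>1)\<close> from \<open>H\<close> to the category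
  \<open>[K, Cat](P, Q)\<close> of 2-natural transformations and modifications is an isomorphism of
  categories. Transformations and modifications are compared on the carriers of \<open>P\<close> only, as
  the values of the representing HOL functions elsewhere are irrelevant.\<close>

definition iso_to_transf ::
  "('h, 'g) cat \<Rightarrow> ('o, 'm, 'c) twocat \<Rightarrow> ('o, 'm, 'c, 'p, 'q) catfun \<Rightarrow>
   ('o, 'm, 'c, 'r, 's) catfun \<Rightarrow> ('h \<Rightarrow> 'o \<Rightarrow> ('p, 'q, 'r, 's) fctr) \<Rightarrow>
   ('g \<Rightarrow> 'o \<Rightarrow> 'p \<Rightarrow> 's) \<Rightarrow> bool" where
  "iso_to_transf H K P Q \<Phi>0 \<Phi>1 \<longleftrightarrow>
     (\<forall>u\<in>Ob H. twonat K P Q (\<Phi>0 u)) \<and>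
     (\<forall>a\<in>Ar H. modification K P Q (\<Phi>0 (Src H a)) (\<Phi>0 (Tgt H a)) (\<Phi>1 a)) \<and>
     (\<forall>u\<in>Ob H. \<forall>X\<in>Ob (One K). \<forall>p\<in>Ob (Fib P X).
        \<Phi>1 (Idn H u) X p = Idn (Fib Q X) (FO (\<Phi>0 u X) p)) \<and>
     (\<forall>a\<in>Ar H. \<forall>b\<in>Ar H. Tgt H a = Src H b \<longrightarrow>
        (\<forall>X\<in>Ob (One K). \<forall>p\<in>Ob (Fib P X).
           \<Phi>1 (Cmp H b a) X p = Cmp (Fib Q X) (\<Phi>1 b X p) (\<Phi>1 a X p))) \<and>
     (\<forall>\<alpha>. twonat K P Q \<alpha> \<longrightarrow>
        (\<exists>!u. u \<in> Ob H \<and>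
           (\<forall>X\<in>Ob (One K). (\<forall>p\<in>Ob (Fib P X). FO (\<Phi>0 u X) p = FO (\<alpha> X) p) \<and>
                            (\<forall>q\<in>Ar (Fib P X). FA (\<Phi>0 u X) q = FA (\<alpha> X) q)))) \<and>
     (\<forall>u\<in>Ob H. \<forall>v\<in>Ob H. \<forall>\<mu>. modification K P Q (\<Phi>0 u) (\<Phi>0 v) \<mu> \<longrightarrow>
        (\<exists>!a. a \<in> hom H u v \<and> (\<forall>X\<in>Ob (One K). \<forall>p\<in>Ob (Fib P X). \<Phi>1 a X p = \<mu> X p)))"

text \<open>The 2-functor \<open>hom\<^sub>W(X, G -)\<close>.\<close>

definition hom_from ::
  "('o, 'm, 'c) twocat \<Rightarrow> 'o \<Rightarrow> ('p, 'n, 'd, 'o, 'm, 'c) twofun \<Rightarrow>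
   ('p, 'n, 'd, 'm, 'c) catfun" where
  "hom_from W X G = \<lparr>Fib = (\<lambda>d. homcat W X (T0 G d)),
     Tr = (\<lambda>g. \<lparr>FO = (\<lambda>u. Cmp (One W) (T1 G g) u), FA = (\<lambda>a. wl W (T1 G g) a)\<rparr>),
     Tr2 = (\<lambda>c u. wr W (T2 G c) u)\<rparr>"


section \<open>Finite weighted limits\<close>

text \<open>\<open>L\<close> with unit \<open>\<zeta>\<close> is a limit of \<open>G\<close> weighted by \<open>\<phi>\<close>: composition with \<open>\<zeta>\<close> gives
  isomorphisms \<open>hom\<^sub>W(X, L) \<cong> [K, Cat](\<phi>, hom\<^sub>W(X, G -))\<close>.\<close>

definition is_weighted_limit ::
  "('o, 'm, 'c) twocat \<Rightarrow> ('p, 'n, 'd) twocat \<Rightarrow> ('p, 'n, 'd, 'r, 's) catfun \<Rightarrow>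
   ('p, 'n, 'd, 'o, 'm, 'c) twofun \<Rightarrow> 'o \<Rightarrow> ('p \<Rightarrow> ('r, 's, 'm, 'c) fctr) \<Rightarrow> bool" where
  "is_weighted_limit W K \<phi> G L \<zeta> \<longleftrightarrow>
     L \<in> Ob (One W) \<and> twonat K \<phi> (hom_from W L G) \<zeta> \<and>
     (\<forall>X\<in>Ob (One W).
        iso_to_transf (homcat W X L) K \<phi> (hom_from W X G)
          (\<lambda>u d. \<lparr>FO = (\<lambda>p. Cmp (One W) (FO (\<zeta> d) p) u), FA = (\<lambda>q. wr W (FA (\<zeta> d) q) u)\<rparr>)
          (\<lambda>a d p. wl W (FO (\<zeta> d) p) a))"

text \<open>Finite indexing 2-categories and finite weights are, up to isomorphism, carried by
  natural numbers.\<close>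

definition has_finite_limits :: "('o, 'm, 'c) twocat \<Rightarrow> bool" where
  "has_finite_limits W \<longleftrightarrow>
     (\<forall>(K :: (nat, nat, nat) twocat) (\<phi> :: (nat, nat, nat, nat, nat) catfun) G.
        twocategory K \<and> finite (Ob (One K)) \<and> finite (Ar (One K)) \<and> finite (Ar (Two K)) \<and>
        is_catfun K \<phi> \<and> (\<forall>d\<in>Ob (One K). finite (Ob (Fib \<phi> d)) \<and> finite (Ar (Fib \<phi> d))) \<and>
        is_2functor K W G \<longrightarrow>
        (\<exists>L \<zeta>. is_weighted_limit W K \<phi> G L \<zeta>))"

definition is_terminal_object :: "('o, 'm, 'c) twocat \<Rightarrow> 'o \<Rightarrow> bool" where
  "is_terminal_object W T \<longleftrightarrow>
     T \<in> Ob (One W) \<and>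
     (\<forall>X\<in>Ob (One W). (\<exists>!f. f \<in> Ob (homcat W X T)) \<and> (\<exists>!a. a \<in> Ar (homcat W X T)))"

definition is_product ::
  "('o, 'm, 'c) twocat \<Rightarrow> 'o \<Rightarrow> 'o \<Rightarrow> 'o \<Rightarrow> 'm \<Rightarrow> 'm \<Rightarrow> bool" where
  "is_product W A B P p q \<longleftrightarrow>
     P \<in> Ob (One W) \<and> p \<in> hom (One W) P A \<and> q \<in> hom (One W) P B \<and>
     (\<forall>X\<in>Ob (One W).
        (\<forall>f\<in>hom (One W) X A. \<forall>g\<in>hom (One W) X B.
           \<exists>!h. h \<in> hom (One W) X P \<and> Cmp (One W) p h = f \<and> Cmp (One W) q h = g) \<and>
        (\<forall>a\<in>Ar (homcat W X A). \<forall>b\<in>Ar (homcat W X B).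
           \<exists>!c. c \<in> Ar (homcat W X P) \<and> wl W p c = a \<and> wl W q c = b))"


section \<open>Discreteness\<close>

record ('o, 'm, 'x, 'f) discreteness =
  Base :: "('x, 'f) cat"
  Incl :: "('x, 'f, 'o, 'm) fctr"
  Refl :: "('o, 'm, 'x, 'f) fctr"
  Unit :: "'x \<Rightarrow> 'f"
  Counit :: "'o \<Rightarrow> 'm"

definition notion_of_discreteness ::
  "('o, 'm, 'c) twocat \<Rightarrow> ('o, 'm, 'x, 'f) discreteness \<Rightarrow> bool" where
  "notion_of_discreteness W N \<longleftrightarrow>
     category (Base N) \<and>
     adjunction (Base N) (One W) (Incl N) (Refl N) (Unit N) (Counit N) \<and>
     (\<forall>X\<in>Ob (Base N). \<forall>Y\<in>Ob (Base N).
        iso_functor (disc_cat (hom (Base N) X Y))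
          (homcat W (FO (Incl N) X) (FO (Incl N) Y))
          \<lparr>FO = FA (Incl N), FA = (\<lambda>f. Idn (Two W) (FA (Incl N) f))\<rparr>) \<and>
     (\<forall>X\<in>Ob (Base N). invertible (Base N) (Unit N X))"

definition discrete_part :: "('o, 'm, 'x, 'f) discreteness \<Rightarrow> 'o \<Rightarrow> 'o" where
  "discrete_part N A = FO (Incl N) (FO (Refl N) A)"

definition fam ::
  "('o, 'm, 'c) twocat \<Rightarrow> ('o, 'm, 'x, 'f) discreteness \<Rightarrow> 'o \<Rightarrow>
   ('x, 'f, 'f, 'm, 'c) catfun" where
  "fam W N A = \<lparr>Fib = (\<lambda>X. homcat W (FO (Incl N) X) A),
     Tr = (\<lambda>f. \<lparr>FO = (\<lambda>u. Cmp (One W) u (FA (Incl N) f)),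
                FA = (\<lambda>a. wr W a (FA (Incl N) f))\<rparr>),
     Tr2 = (\<lambda>f u. Idn (Two W) (Cmp (One W) u (FA (Incl N) f)))\<rparr>"

definition discrete_objects_dense ::
  "('o, 'm, 'c) twocat \<Rightarrow> ('o, 'm, 'x, 'f) discreteness \<Rightarrow> bool" where
  "discrete_objects_dense W N \<longleftrightarrow>
     (\<forall>A\<in>Ob (One W). \<forall>B\<in>Ob (One W).
        iso_to_transf (homcat W A B) (loc_disc (op_cat (Base N))) (fam W N A) (fam W N B)
          (\<lambda>u X. \<lparr>FO = (\<lambda>p. Cmp (One W) u p), FA = (\<lambda>a. wl W u a)\<rparr>)
          (\<lambda>c X p. wr W c p))"


section \<open>Connectives\<close>

definition left_adjoint :: "('o, 'm, 'c) twocat \<Rightarrow> 'm \<Rightarrow> 'm \<Rightarrow> bool" where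
  "left_adjoint W f g \<longleftrightarrow>
     (\<exists>A B \<eta> \<epsilon>. f \<in> hom (One W) A B \<and> g \<in> hom (One W) B A \<and>
        \<eta> \<in> hom (Two W) (Idn (One W) A) (Cmp (One W) g f) \<and>
        \<epsilon> \<in> hom (Two W) (Cmp (One W) f g) (Idn (One W) B) \<and>
        Cmp (Two W) (wr W \<epsilon> f) (wl W f \<eta>) = Idn (Two W) f \<and>
        Cmp (Two W) (wl W g \<epsilon>) (wr W \<eta> g) = Idn (Two W) g)"

datatype connective =
  Terminal_Value | Initial_Value | Products | Closed_Products | Coproducts

definition is_diagonal :: "('o, 'm, 'c) twocat \<Rightarrow> 'o \<Rightarrow> 'o \<Rightarrow> 'm \<Rightarrow> 'm \<Rightarrow> 'm \<Rightarrow> bool" where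
  "is_diagonal W A P p q \<delta> \<longleftrightarrow>
     \<delta> \<in> hom (One W) A P \<and> Cmp (One W) p \<delta> = Idn (One W) A \<and> Cmp (One W) q \<delta> = Idn (One W) A"

text \<open>Terminal objects and binary products are not part of the structure of a 2-category here;
  as they are unique up to isomorphism, it does not matter which ones are used. In the clause
  for closed products, \<open>P = A \<times> A\<close> with projections \<open>p\<close>, \<open>q\<close>, \<open>t = \<times>\<^sub>A\<close>, \<open>R = A \<times> |A|\<close> with
  projections \<open>r\<close>, \<open>s\<close>, \<open>k = id \<times> \<epsilon>\<^sub>A\<close>, and \<open>m = \<langle>t \<circ> k, s\<rangle>\<close>.\<close>

fun has_connective ::
  "('o, 'm, 'c) twocat \<Rightarrow> ('o, 'm, 'x, 'f) discreteness \<Rightarrow> connective \<Rightarrow> 'o \<Rightarrow> bool" where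
  "has_connective W N Terminal_Value A \<longleftrightarrow>
     (\<exists>T e r. is_terminal_object W T \<and> e \<in> hom (One W) A T \<and> left_adjoint W e r)"
| "has_connective W N Initial_Value A \<longleftrightarrow>
     (\<exists>T e l. is_terminal_object W T \<and> e \<in> hom (One W) A T \<and> left_adjoint W l e)"
| "has_connective W N Products A \<longleftrightarrow>
     (\<exists>P p q \<delta> t. is_product W A A P p q \<and> is_diagonal W A P p q \<delta> \<and> left_adjoint W \<delta> t)"
| "has_connective W N Closed_Products A \<longleftrightarrow>
     (\<exists>P p q \<delta> t R r s k m n.
        is_product W A A P p q \<and> is_diagonal W A P p q \<delta> \<and> left_adjoint W \<delta> t \<and>
        is_product W A (discrete_part N A) R r s \<and>
        k \<in> hom (One W) R P \<and> Cmp (One W) p k = r \<and> Cmp (One W) q k = Cmp (One W) (Counit N A) s \<and>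
        m \<in> hom (One W) R R \<and> Cmp (One W) r m = Cmp (One W) t k \<and> Cmp (One W) s m = s \<and>
        left_adjoint W m n)"
| "has_connective W N Coproducts A \<longleftrightarrow>
     (\<exists>P p q \<delta> t. is_product W A A P p q \<and> is_diagonal W A P p q \<delta> \<and> left_adjoint W t \<delta>)"


section \<open>Internal categories\<close>

text \<open>An internal category with object of objects \<open>I0\<close> and object of arrows \<open>I1\<close>. The object
  \<open>I2\<close> of composable pairs is part of the structure: \<open>ifst\<close> and \<open>isnd\<close> project to the first and
  the second arrow of a pair, and \<open>icmp\<close> composes the second after the first.\<close>

record ('x, 'f) icat =
  I0 :: 'x
  I1 :: 'x
  I2 :: 'x
  idom :: 'f
  icod :: 'f
  iidn :: 'f
  ifst :: 'f
  isnd :: 'f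
  icmp :: 'f

text \<open>Composition of the generalised arrows \<open>f, g : X \<rightarrow> I1 A\<close>: \<open>icmp A\<close> after the map
  \<open>\<langle>f, g\<rangle> : X \<rightarrow> I2 A\<close> into the pullback.\<close>

definition gcmp :: "('x, 'f) cat \<Rightarrow> ('x, 'f) icat \<Rightarrow> 'f \<Rightarrow> 'f \<Rightarrow> 'f" where
  "gcmp C A g f = Cmp C (icmp A)
     (THE h. h \<in> hom C (Src C f) (I2 A) \<and> Cmp C (ifst A) h = f \<and> Cmp C (isnd A) h = g)"

definition internal_category :: "('x, 'f) cat \<Rightarrow> ('x, 'f) icat \<Rightarrow> bool" where
  "internal_category C A \<longleftrightarrow>
     I0 A \<in> Ob C \<and> I1 A \<in> Ob C \<and> I2 A \<in> Ob C \<and>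
     idom A \<in> hom C (I1 A) (I0 A) \<and> icod A \<in> hom C (I1 A) (I0 A) \<and>
     iidn A \<in> hom C (I0 A) (I1 A) \<and>
     Cmp C (idom A) (iidn A) = Idn C (I0 A) \<and> Cmp C (icod A) (iidn A) = Idn C (I0 A) \<and>
     is_pullback C (I2 A) (ifst A) (isnd A) (icod A) (idom A) \<and>
     icmp A \<in> hom C (I2 A) (I1 A) \<and>
     Cmp C (idom A) (icmp A) = Cmp C (idom A) (ifst A) \<and>
     Cmp C (icod A) (icmp A) = Cmp C (icod A) (isnd A) \<and>
     (\<forall>X\<in>Ob C. \<forall>f\<in>hom C X (I1 A).
        gcmp C A f (Cmp C (iidn A) (Cmp C (idom A) f)) = f \<and>
        gcmp C A (Cmp C (iidn A) (Cmp C (icod A) f)) f = f) \<and>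
     (\<forall>X\<in>Ob C. \<forall>f\<in>hom C X (I1 A). \<forall>g\<in>hom C X (I1 A). \<forall>h\<in>hom C X (I1 A).
        Cmp C (icod A) f = Cmp C (idom A) g \<longrightarrow> Cmp C (icod A) g = Cmp C (idom A) h \<longrightarrow>
        gcmp C A (gcmp C A h g) f = gcmp C A h (gcmp C A g f))"

record ('x, 'f) ifun =
  isrc :: "('x, 'f) icat"
  itgt :: "('x, 'f) icat"
  i0 :: 'f
  i1 :: 'f

definition internal_functor :: "('x, 'f) cat \<Rightarrow> ('x, 'f) ifun \<Rightarrow> bool" where
  "internal_functor C F \<longleftrightarrow>
     internal_category C (isrc F) \<and> internal_category C (itgt F) \<and>
     i0 F \<in> hom C (I0 (isrc F)) (I0 (itgt F)) \<and>
     i1 F \<in> hom C (I1 (isrc F)) (I1 (itgt F)) \<and>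
     Cmp C (idom (itgt F)) (i1 F) = Cmp C (i0 F) (idom (isrc F)) \<and>
     Cmp C (icod (itgt F)) (i1 F) = Cmp C (i0 F) (icod (isrc F)) \<and>
     Cmp C (i1 F) (iidn (isrc F)) = Cmp C (iidn (itgt F)) (i0 F) \<and>
     Cmp C (i1 F) (icmp (isrc F)) =
       gcmp C (itgt F) (Cmp C (i1 F) (isnd (isrc F))) (Cmp C (i1 F) (ifst (isrc F)))"

record ('x, 'f) itrans =
  tsrc :: "('x, 'f) ifun"
  ttgt :: "('x, 'f) ifun"
  tcmp :: 'f

definition internal_transformation :: "('x, 'f) cat \<Rightarrow> ('x, 'f) itrans \<Rightarrow> bool" where
  "internal_transformation C \<tau> \<longleftrightarrow> (let F = tsrc \<tau>; G = ttgt \<tau>; A = isrc F; B = itgt F in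
     internal_functor C F \<and> internal_functor C G \<and> isrc G = A \<and> itgt G = B \<and>
     tcmp \<tau> \<in> hom C (I0 A) (I1 B) \<and>
     Cmp C (idom B) (tcmp \<tau>) = i0 F \<and> Cmp C (icod B) (tcmp \<tau>) = i0 G \<and>
     gcmp C B (i1 G) (Cmp C (tcmp \<tau>) (idom A)) = gcmp C B (Cmp C (tcmp \<tau>) (icod A)) (i1 F))"

definition ifun_cmp :: "('x, 'f) cat \<Rightarrow> ('x, 'f) ifun \<Rightarrow> ('x, 'f) ifun \<Rightarrow> ('x, 'f) ifun" where
  "ifun_cmp C G F = \<lparr>isrc = isrc F, itgt = itgt G,
     i0 = Cmp C (i0 G) (i0 F), i1 = Cmp C (i1 G) (i1 F)\<rparr>"

text \<open>The 2-category \<open>cat(C)\<close>. The component of a horizontal composite of \<open>a : F \<Rightarrow> F'\<close> and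
  \<open>b : G \<Rightarrow> G'\<close> is \<open>b\<^bsub>F'\<^esub>\<close> after \<open>G(a)\<close>.\<close>

definition intcat :: "('x, 'f) cat \<Rightarrow> (('x, 'f) icat, ('x, 'f) ifun, ('x, 'f) itrans) twocat" where
  "intcat C = \<lparr>
     One = \<lparr>Ob = {A. internal_category C A}, Ar = {F. internal_functor C F},
       Src = isrc, Tgt = itgt,
       Idn = (\<lambda>A. \<lparr>isrc = A, itgt = A, i0 = Idn C (I0 A), i1 = Idn C (I1 A)\<rparr>),
       Cmp = ifun_cmp C\<rparr>,
     Two = \<lparr>Ob = {F. internal_functor C F}, Ar = {\<tau>. internal_transformation C \<tau>},
       Src = tsrc, Tgt = ttgt,
       Idn = (\<lambda>F. \<lparr>tsrc = F, ttgt = F, tcmp = Cmp C (iidn (itgt F)) (i0 F)\<rparr>),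
       Cmp = (\<lambda>b a. \<lparr>tsrc = tsrc a, ttgt = ttgt b,
                tcmp = gcmp C (itgt (tsrc a)) (tcmp b) (tcmp a)\<rparr>)\<rparr>,
     HC = (\<lambda>b a. \<lparr>tsrc = ifun_cmp C (tsrc b) (tsrc a), ttgt = ifun_cmp C (ttgt b) (ttgt a),
             tcmp = gcmp C (itgt (tsrc b)) (Cmp C (tcmp b) (i0 (ttgt a)))
                                           (Cmp C (i1 (tsrc b)) (tcmp a))\<rparr>)\<rparr>"

definition idisc :: "('x, 'f) cat \<Rightarrow> 'x \<Rightarrow> ('x, 'f) icat" where
  "idisc C X = \<lparr>I0 = X, I1 = X, I2 = X, idom = Idn C X, icod = Idn C X, iidn = Idn C X,
     ifst = Idn C X, isnd = Idn C X, icmp = Idn C X\<rparr>"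

definition standard_discreteness ::
  "('x, 'f) cat \<Rightarrow>
   (('x, 'f) icat, ('x, 'f) ifun, 'x, 'f) discreteness" where
  "standard_discreteness C = \<lparr>Base = C,
     Incl = \<lparr>FO = idisc C,
       FA = (\<lambda>f. \<lparr>isrc = idisc C (Src C f), itgt = idisc C (Tgt C f), i0 = f, i1 = f\<rparr>)\<rparr>,
     Refl = \<lparr>FO = I0, FA = i0\<rparr>,
     Unit = Idn C,
     Counit = (\<lambda>A. \<lparr>isrc = idisc C (I0 A), itgt = A, i0 = Idn C (I0 A), i1 = iidn A\<rparr>)\<rparr>"


section \<open>Externalisation and associated categories\<close>

definition ext_fib :: "('x, 'f) cat \<Rightarrow> ('x, 'f) icat \<Rightarrow> 'x \<Rightarrow> ('f, 'f) cat" where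
  "ext_fib C A X = \<lparr>Ob = hom C X (I0 A), Ar = hom C X (I1 A),
     Src = (\<lambda>f. Cmp C (idom A) f), Tgt = (\<lambda>f. Cmp C (icod A) f),
     Idn = (\<lambda>x. Cmp C (iidn A) x), Cmp = gcmp C A\<rparr>"

definition ext :: "('x, 'f) cat \<Rightarrow> ('x, 'f) icat \<Rightarrow> ('x, 'f, 'f, 'f, 'f) catfun" where
  "ext C A = \<lparr>Fib = ext_fib C A,
     Tr = (\<lambda>h. \<lparr>FO = (\<lambda>x. Cmp C x h), FA = (\<lambda>f. Cmp C f h)\<rparr>),
     Tr2 = (\<lambda>h x. Cmp C (iidn A) (Cmp C x h))\<rparr>"

text \<open>For fixed \<open>X\<close>, the 2-functor sending \<open>A\<close> to the fibre over \<open>X\<close> of the externalisation of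
  \<open>E(A)\<close>.\<close>

definition ext_at ::
  "('x, 'f) cat \<Rightarrow>
   ('o, 'm, 'c, ('x, 'f) icat, ('x, 'f) ifun, ('x, 'f) itrans) twofun \<Rightarrow> 'x \<Rightarrow>
   ('o, 'm, 'c, 'f, 'f) catfun" where
  "ext_at C E X = \<lparr>Fib = (\<lambda>A. ext_fib C (T0 E A) X),
     Tr = (\<lambda>u. \<lparr>FO = (\<lambda>x. Cmp C (i0 (T1 E u)) x), FA = (\<lambda>f. Cmp C (i1 (T1 E u)) f)\<rparr>),
     Tr2 = (\<lambda>a x. Cmp C (tcmp (T2 E a)) x)\<rparr>"

text \<open>\<open>E\<close> is a 2-functor and \<open>\<theta>\<close> a 2-natural isomorphism between \<open>fam\<close> and the externalisation
  of \<open>E\<close>: \<open>\<theta> A X\<close> is an isomorphism of categories, natural in \<open>X\<close> and 2-natural in \<open>A\<close>.\<close>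

definition associated_category ::
  "('o, 'm, 'c) twocat \<Rightarrow> ('o, 'm, 'x, 'f) discreteness \<Rightarrow>
   ('o, 'm, 'c, ('x, 'f) icat, ('x, 'f) ifun, ('x, 'f) itrans) twofun \<Rightarrow>
   ('o \<Rightarrow> 'x \<Rightarrow> ('m, 'c, 'f, 'f) fctr) \<Rightarrow> bool" where
  "associated_category W N E \<theta> \<longleftrightarrow>
     is_2functor W (intcat (Base N)) E \<and>
     (\<forall>A\<in>Ob (One W). \<forall>X\<in>Ob (Base N).
        iso_functor (homcat W (FO (Incl N) X) A) (ext_fib (Base N) (T0 E A) X) (\<theta> A X)) \<and>
     (\<forall>A\<in>Ob (One W).
        twonat (loc_disc (op_cat (Base N))) (fam W N A) (ext (Base N) (T0 E A)) (\<theta> A)) \<and>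
     (\<forall>X\<in>Ob (Base N).
        twonat W (hom_from W (FO (Incl N) X) id_2functor) (ext_at (Base N) E X) (\<lambda>A. \<theta> A X))"

end

theory Submission
  imports Defs
begin

text \<open>The connectives are adjoints of 1-cells built from the terminal object, binary products and
  the counit. The 2-functor \<open>E\<close> preserves adjunctions, and by the Yoneda lemma, applied to objects
  and to arrows of \<open>hom(F X, -)\<close> separately, it preserves terminal objects and binary products; it
  also preserves the counit up to an isomorphism of its domain. This gives the first half. If the
  discrete objects are dense, then \<open>E\<close> is an isomorphism on hom-categories, hence reflects
  adjunctions; since limits exist in the source and are unique up to isomorphism, an adjunction
  over an arbitrary product in the target can be moved to the image of a product in the source.\<close>

text \<open>Over \<open>X\<close>, the externalisation of \<open>T0 E A\<close> has the maps from
  \<open>X\<close> to \<open>I0\<close> as objects and those to \<open>I1\<close> as arrows. So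
  \<open>\<theta>\<close> says that \<open>I0 (T0 E A)\<close> and \<open>I1 (T0 E A)\<close>
  represent the 1-cells and the 2-cells from \<open>F X\<close> to \<open>A\<close>. This is why the
  Yoneda argument splits into two levels, and why the base category may lack limits: the required
  products appear at exactly these two objects, and a levelwise product of internal categories is a
  product. Internal structure is handled by generalised elements: \<open>gcmp\<close> composes maps
  from \<open>X\<close> to \<open>I1\<close> as in an ordinary category, and an internal equation is
  the instance at the universal arrow. The discrete part of \<open>T0 E A\<close> is literally an
  \<open>idisc\<close>, while \<open>E\<close> applied to the discrete part of \<open>A\<close> is
  an internal category in which every arrow is an identity, because all 2-cells between discrete
  objects are. A comparison isomorphism \<open>j\<close> is therefore carried through the treatment
  of closed products. Density enters by conjugation: an internal functor acts on externalisations by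
  composition, \<open>\<theta>\<close> turns this action into a transformation between families, and
  density realises that by a unique 1-cell; internal transformations give modifications in the same
  way.\<close>

lemma hom_iff: "f \<in> hom C X Y \<longleftrightarrow> f \<in> Ar C \<and> Src C f = X \<and> Tgt C f = Y"
  by (simp add: hom_def)

lemma intcat_simps [simp]:
  "Ob (One (intcat C)) = {A. internal_category C A}"
  "Ar (One (intcat C)) = {F. internal_functor C F}"
  "Src (One (intcat C)) = isrc" "Tgt (One (intcat C)) = itgt"
  "Idn (One (intcat C)) A = \<lparr>isrc = A, itgt = A, i0 = Idn C (I0 A), i1 = Idn C (I1 A)\<rparr>"
  "Cmp (One (intcat C)) = ifun_cmp C"
  "Ob (Two (intcat C)) = {F. internal_functor C F}"
  "Ar (Two (intcat C)) = {a. internal_transformation C a}"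
  "Src (Two (intcat C)) = tsrc" "Tgt (Two (intcat C)) = ttgt"
  "Idn (Two (intcat C)) F = \<lparr>tsrc = F, ttgt = F, tcmp = Cmp C (iidn (itgt F)) (i0 F)\<rparr>"
  "Cmp (Two (intcat C)) b a =
    \<lparr>tsrc = tsrc a, ttgt = ttgt b, tcmp = gcmp C (itgt (tsrc a)) (tcmp b) (tcmp a)\<rparr>"
  "HC (intcat C) b a = \<lparr>tsrc = ifun_cmp C (tsrc b) (tsrc a), ttgt = ifun_cmp C (ttgt b) (ttgt a),
     tcmp = gcmp C (itgt (tsrc b)) (Cmp C (tcmp b) (i0 (ttgt a))) (Cmp C (i1 (tsrc b)) (tcmp a))\<rparr>"
  "src0 (intcat C) a = isrc (tsrc a)" "tgt0 (intcat C) a = itgt (tsrc a)"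
  by (simp_all add: intcat_def src0_def tgt0_def)

lemma ifun_cmp_simps [simp]:
  "isrc (ifun_cmp C G F) = isrc F" "itgt (ifun_cmp C G F) = itgt G"
  "i0 (ifun_cmp C G F) = Cmp C (i0 G) (i0 F)" "i1 (ifun_cmp C G F) = Cmp C (i1 G) (i1 F)"
  by (simp_all add: ifun_cmp_def)

lemma homcat_simps [simp]:
  "Ob (homcat W A B) = hom (One W) A B"
  "Ar (homcat W A B) = {a \<in> Ar (Two W). src0 W a = A \<and> tgt0 W a = B}"
  "Src (homcat W A B) = Src (Two W)" "Tgt (homcat W A B) = Tgt (Two W)"
  "Idn (homcat W A B) = Idn (Two W)" "Cmp (homcat W A B) = Cmp (Two W)"
  by (simp_all add: homcat_def)

text \<open>The purely 1-dimensional product. It is used in the base category, separately for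
  objects of objects and objects of arrows, where no 2-cells exist.\<close>

definition is_product1 :: "('o, 'a) cat \<Rightarrow> 'o \<Rightarrow> 'o \<Rightarrow> 'o \<Rightarrow> 'a \<Rightarrow> 'a \<Rightarrow> bool" where
  "is_product1 C A B P p q \<longleftrightarrow> p \<in> hom C P A \<and> q \<in> hom C P B \<and>
     (\<forall>X\<in>Ob C. \<forall>f\<in>hom C X A. \<forall>g\<in>hom C X B.
        \<exists>!h. h \<in> hom C X P \<and> Cmp C p h = f \<and> Cmp C q h = g)"

section \<open>Internal categories by generalised elements\<close>

context
  fixes C :: "('o, 'a) cat"
  assumes cat: "category C"
begin

abbreviation cat_comp (infixr "\<cdot>" 70) where "cat_comp \<equiv> Cmp C"

lemma src_in_Ob [simp]: "f \<in> Ar C \<Longrightarrow> Src C f \<in> Ob C"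
  and tgt_in_Ob [simp]: "f \<in> Ar C \<Longrightarrow> Tgt C f \<in> Ob C"
  and Idn_in_Ar [simp]: "X \<in> Ob C \<Longrightarrow> Idn C X \<in> Ar C"
  and src_Idn [simp]: "X \<in> Ob C \<Longrightarrow> Src C (Idn C X) = X"
  and tgt_Idn [simp]: "X \<in> Ob C \<Longrightarrow> Tgt C (Idn C X) = X"
  and Cmp_in_Ar [simp]: "f \<in> Ar C \<Longrightarrow> g \<in> Ar C \<Longrightarrow> Tgt C f = Src C g \<Longrightarrow> g \<cdot> f \<in> Ar C"
  and src_Cmp [simp]: "f \<in> Ar C \<Longrightarrow> g \<in> Ar C \<Longrightarrow> Tgt C f = Src C g \<Longrightarrow> Src C (g \<cdot> f) = Src C f"
  and tgt_Cmp [simp]: "f \<in> Ar C \<Longrightarrow> g \<in> Ar C \<Longrightarrow> Tgt C f = Src C g \<Longrightarrow> Tgt C (g \<cdot> f) = Tgt C g"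
  using cat unfolding category_def hom_def by simp_all

lemma Cmp_Idn_right [simp]: "f \<in> Ar C \<Longrightarrow> X = Src C f \<Longrightarrow> f \<cdot> Idn C X = f"
  and Cmp_Idn_left [simp]: "f \<in> Ar C \<Longrightarrow> X = Tgt C f \<Longrightarrow> Idn C X \<cdot> f = f"
  and Cmp_assoc [simp]: "f \<in> Ar C \<Longrightarrow> g \<in> Ar C \<Longrightarrow> h \<in> Ar C \<Longrightarrow> Tgt C f = Src C g \<Longrightarrow>
    Tgt C g = Src C h \<Longrightarrow> (h \<cdot> g) \<cdot> f = h \<cdot> (g \<cdot> f)"
  using cat unfolding category_def by simp_all

text \<open>The simplifier nests composites to the right, so an equation for
  \<open>g \<cdot> f\<close> does not match inside a longer composite. This is its form under
  precomposition with \<open>x\<close>.\<close>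

lemma Cmp_extend:
  assumes "g \<cdot> f = k" "f \<in> Ar C" "g \<in> Ar C" "x \<in> Ar C" "Tgt C f = Src C g" "Tgt C x = Src C f"
  shows "g \<cdot> (f \<cdot> x) = k \<cdot> x"
  using Cmp_assoc[of x f g] assms by simp

section \<open>Generalised arrows of an internal category and their composition\<close>

lemma internal_category_simps [simp]:
  assumes "internal_category C A"
  shows "I0 A \<in> Ob C" "I1 A \<in> Ob C" "I2 A \<in> Ob C"
    "idom A \<in> Ar C" "Src C (idom A) = I1 A" "Tgt C (idom A) = I0 A"
    "icod A \<in> Ar C" "Src C (icod A) = I1 A" "Tgt C (icod A) = I0 A"
    "iidn A \<in> Ar C" "Src C (iidn A) = I0 A" "Tgt C (iidn A) = I1 A"
    "ifst A \<in> Ar C" "Src C (ifst A) = I2 A" "Tgt C (ifst A) = I1 A"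
    "isnd A \<in> Ar C" "Src C (isnd A) = I2 A" "Tgt C (isnd A) = I1 A"
    "icmp A \<in> Ar C" "Src C (icmp A) = I2 A" "Tgt C (icmp A) = I1 A"
    "idom A \<cdot> iidn A = Idn C (I0 A)" "icod A \<cdot> iidn A = Idn C (I0 A)"
    "icod A \<cdot> ifst A = idom A \<cdot> isnd A"
    "idom A \<cdot> icmp A = idom A \<cdot> ifst A" "icod A \<cdot> icmp A = icod A \<cdot> isnd A"
  using assms unfolding internal_category_def is_pullback_def hom_iff by simp_all

lemma dom_iidn [simp]:
  assumes "internal_category C A" "x \<in> Ar C" "Tgt C x = I0 A"
  shows "idom A \<cdot> (iidn A \<cdot> x) = x"
  using assms Cmp_extend[of "idom A" "iidn A"] by simp

lemma cod_iidn [simp]: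
  assumes "internal_category C A" "x \<in> Ar C" "Tgt C x = I0 A"
  shows "icod A \<cdot> (iidn A \<cdot> x) = x"
  using assms Cmp_extend[of "icod A" "iidn A"] by simp

text \<open>The universal property of the pullback \<open>I2 A\<close>, phrased so as to match the
  definite description in \<open>gcmp\<close>.\<close>

lemma pair_exists1:
  assumes A: "internal_category C A" and f: "f \<in> Ar C" "Tgt C f = I1 A"
    and g: "g \<in> Ar C" "Tgt C g = I1 A" and fg: "Src C f = Src C g" "icod A \<cdot> f = idom A \<cdot> g"
  shows "\<exists>!h. h \<in> hom C (Src C f) (I2 A) \<and> ifst A \<cdot> h = f \<and> isnd A \<cdot> h = g"
proof -
  have "is_pullback C (I2 A) (ifst A) (isnd A) (icod A) (idom A)"
    using A unfolding internal_category_def by (elim conjE)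
  then have "\<And>X x y. X \<in> Ob C \<Longrightarrow> x \<in> hom C X (I1 A) \<Longrightarrow> y \<in> hom C X (I1 A) \<Longrightarrow>
      icod A \<cdot> x = idom A \<cdot> y \<Longrightarrow>
      \<exists>!h. h \<in> hom C X (I2 A) \<and> ifst A \<cdot> h = x \<and> isnd A \<cdot> h = y"
    unfolding is_pullback_def using A by simp
  from this[of "Src C f" f g] show ?thesis
    using f g fg by (simp add: hom_iff)
qed

text \<open>\<open>gcmp\<close> hides a definite description; exhibiting any \<open>h\<close> with
  the right projections evaluates it. Composability of \<open>f\<close> and \<open>g\<close> is
  automatic, since both factor through the pullback.\<close>

lemma gcmp_via_pair:
  assumes A: "internal_category C A"
    and h: "h \<in> Ar C" "Tgt C h = I2 A" "ifst A \<cdot> h = f" "isnd A \<cdot> h = g"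
  shows "gcmp C A g f = icmp A \<cdot> h"
proof -
  have f: "f \<in> Ar C" "Tgt C f = I1 A" "Src C f = Src C h"
    and g: "g \<in> Ar C" "Tgt C g = I1 A" "Src C g = Src C h"
    using A h by auto
  \<comment> \<open>The pullback square, precomposed with \<open>h\<close>, makes \<open>f\<close>
    and \<open>g\<close> composable.\<close>
  have "icod A \<cdot> (ifst A \<cdot> h) = (idom A \<cdot> isnd A) \<cdot> h"
    using A h(1,2) by (intro Cmp_extend) simp_all
  then have "icod A \<cdot> f = idom A \<cdot> g"
    using A h by simp
  from pair_exists1[OF A f(1,2) g(1,2) _ this] f g
  have "\<exists>!h. h \<in> hom C (Src C f) (I2 A) \<and> ifst A \<cdot> h = f \<and> isnd A \<cdot> h = g"
    by simp
  moreover have "h \<in> hom C (Src C f) (I2 A) \<and> ifst A \<cdot> h = f \<and> isnd A \<cdot> h = g"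
    using h f by (simp add: hom_iff)
  ultimately show ?thesis
    unfolding gcmp_def by (simp add: the1_equality)
qed

lemma gcmp_obtain:
  assumes A: "internal_category C A" and f: "f \<in> Ar C" "Tgt C f = I1 A"
    and g: "g \<in> Ar C" "Tgt C g = I1 A" and fg: "Src C f = Src C g" "icod A \<cdot> f = idom A \<cdot> g"
  obtains h where "h \<in> Ar C" "Src C h = Src C g" "Tgt C h = I2 A" "ifst A \<cdot> h = f"
    "isnd A \<cdot> h = g" "gcmp C A g f = icmp A \<cdot> h"
  using pair_exists1[OF assms] gcmp_via_pair[OF A] fg(1) by (auto simp: hom_iff)

text \<open>All clauses are read off the map \<open>h\<close> into \<open>I2 A\<close> that pairs
  \<open>f\<close> and \<open>g\<close>. The last one is stability under change of stage:
  \<open>h \<cdot> k\<close> pairs \<open>f \<cdot> k\<close> and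
  \<open>g \<cdot> k\<close>.\<close>

lemma gcmp_simps [simp]:
  assumes A: "internal_category C A" and f: "f \<in> Ar C" "Tgt C f = I1 A"
    and g: "g \<in> Ar C" "Tgt C g = I1 A" and fg: "Src C f = Src C g" "icod A \<cdot> f = idom A \<cdot> g"
  shows "gcmp C A g f \<in> Ar C" "Src C (gcmp C A g f) = Src C g" "Tgt C (gcmp C A g f) = I1 A"
    "idom A \<cdot> gcmp C A g f = idom A \<cdot> f" "icod A \<cdot> gcmp C A g f = icod A \<cdot> g"
    "\<And>k. k \<in> Ar C \<Longrightarrow> Tgt C k = Src C g \<Longrightarrow> gcmp C A g f \<cdot> k = gcmp C A (g \<cdot> k) (f \<cdot> k)"
proof -
  obtain h where h: "h \<in> Ar C" "Src C h = Src C g" "Tgt C h = I2 A" "ifst A \<cdot> h = f"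
    "isnd A \<cdot> h = g" "gcmp C A g f = icmp A \<cdot> h"
    by (rule gcmp_obtain[OF assms])
  show "gcmp C A g f \<in> Ar C" "Src C (gcmp C A g f) = Src C g" "Tgt C (gcmp C A g f) = I1 A"
    using A h by simp_all
  have "idom A \<cdot> (icmp A \<cdot> h) = (idom A \<cdot> ifst A) \<cdot> h"
    "icod A \<cdot> (icmp A \<cdot> h) = (icod A \<cdot> isnd A) \<cdot> h"
    using A h(1-3) by (intro Cmp_extend; simp)+
  then show "idom A \<cdot> gcmp C A g f = idom A \<cdot> f" "icod A \<cdot> gcmp C A g f = icod A \<cdot> g"
    using A h by simp_all
  fix k assume k: "k \<in> Ar C" "Tgt C k = Src C g"
  have "gcmp C A (g \<cdot> k) (f \<cdot> k) = icmp A \<cdot> (h \<cdot> k)"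
    using A h(1-3) k by (intro gcmp_via_pair) (simp_all flip: h(4,5))
  then show "gcmp C A g f \<cdot> k = gcmp C A (g \<cdot> k) (f \<cdot> k)"
    using A h k by simp
qed

text \<open>The universal composable pair is classified by the identity of \<open>I2 A\<close>.
  Hence laws stated with \<open>icmp\<close> become laws about \<open>gcmp\<close>.\<close>

lemma icmp_eq_gcmp:
  assumes "internal_category C A"
  shows "icmp A = gcmp C A (isnd A) (ifst A)"
  using gcmp_via_pair[of A "Idn C (I2 A)"] assms by simp

lemma gcmp_iidn:
  assumes A: "internal_category C A" and f: "f \<in> Ar C" "Tgt C f = I1 A"
  shows "gcmp C A f (iidn A \<cdot> (idom A \<cdot> f)) = f" "gcmp C A (iidn A \<cdot> (icod A \<cdot> f)) f = f"
proof -
  have *: "\<forall>X\<in>Ob C. \<forall>f\<in>hom C X (I1 A). gcmp C A f (iidn A \<cdot> (idom A \<cdot> f)) = f \<and>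
      gcmp C A (iidn A \<cdot> (icod A \<cdot> f)) f = f"
    using A unfolding internal_category_def by (elim conjE)
  have "Src C f \<in> Ob C" "f \<in> hom C (Src C f) (I1 A)"
    using f by (simp_all add: hom_iff)
  then show "gcmp C A f (iidn A \<cdot> (idom A \<cdot> f)) = f" "gcmp C A (iidn A \<cdot> (icod A \<cdot> f)) f = f"
    using * by blast+
qed

text \<open>The object \<open>x\<close> is left free, with an equation as premise, so that the unit
  laws still apply after the domain or codomain of \<open>f\<close> has been rewritten.\<close>

lemma gcmp_iidn_simps [simp]:
  assumes "internal_category C A" "f \<in> Ar C" "Tgt C f = I1 A"
  shows "x = idom A \<cdot> f \<Longrightarrow> gcmp C A f (iidn A \<cdot> x) = f"
    "x = icod A \<cdot> f \<Longrightarrow> gcmp C A (iidn A \<cdot> x) f = f"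
  using assms gcmp_iidn by blast+

lemma gcmp_assoc [simp]:
  assumes A: "internal_category C A" and ar: "f \<in> Ar C" "g \<in> Ar C" "h \<in> Ar C"
    "Tgt C f = I1 A" "Tgt C g = I1 A" "Tgt C h = I1 A" "Src C f = Src C g" "Src C g = Src C h"
    and cmp: "icod A \<cdot> f = idom A \<cdot> g" "icod A \<cdot> g = idom A \<cdot> h"
  shows "gcmp C A (gcmp C A h g) f = gcmp C A h (gcmp C A g f)"
proof -
  have *: "\<forall>X\<in>Ob C. \<forall>f\<in>hom C X (I1 A). \<forall>g\<in>hom C X (I1 A). \<forall>h\<in>hom C X (I1 A).
      icod A \<cdot> f = idom A \<cdot> g \<longrightarrow> icod A \<cdot> g = idom A \<cdot> h \<longrightarrow>
      gcmp C A (gcmp C A h g) f = gcmp C A h (gcmp C A g f)"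
    using A unfolding internal_category_def by (elim conjE)
  have "Src C h \<in> Ob C" "f \<in> hom C (Src C h) (I1 A)" "g \<in> hom C (Src C h) (I1 A)"
    "h \<in> hom C (Src C h) (I1 A)"
    using ar by (simp_all add: hom_iff)
  then show ?thesis
    using * cmp by blast
qed

section \<open>Internal functors and transformations on generalised arrows\<close>

lemma internal_functor_simps [simp]:
  assumes "internal_functor C F"
  shows "internal_category C (isrc F)" "internal_category C (itgt F)"
    "i0 F \<in> Ar C" "Src C (i0 F) = I0 (isrc F)" "Tgt C (i0 F) = I0 (itgt F)"
    "i1 F \<in> Ar C" "Src C (i1 F) = I1 (isrc F)" "Tgt C (i1 F) = I1 (itgt F)"
  using assms unfolding internal_functor_def hom_iff by simp_all

lemma functor_dom [simp]:
  assumes "internal_functor C F" "itgt F = B"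
  shows "idom B \<cdot> i1 F = i0 F \<cdot> idom (isrc F)"
    and "f \<in> Ar C \<Longrightarrow> Tgt C f = I1 (isrc F) \<Longrightarrow>
      idom B \<cdot> (i1 F \<cdot> f) = i0 F \<cdot> (idom (isrc F) \<cdot> f)"
proof -
  show *: "idom B \<cdot> i1 F = i0 F \<cdot> idom (isrc F)"
    using assms unfolding internal_functor_def by simp
  show "idom B \<cdot> (i1 F \<cdot> f) = i0 F \<cdot> (idom (isrc F) \<cdot> f)"
    if "f \<in> Ar C" "Tgt C f = I1 (isrc F)"
    using that assms Cmp_extend[OF *] by auto
qed

lemma functor_cod [simp]:
  assumes "internal_functor C F" "itgt F = B"
  shows "icod B \<cdot> i1 F = i0 F \<cdot> icod (isrc F)"
    and "f \<in> Ar C \<Longrightarrow> Tgt C f = I1 (isrc F) \<Longrightarrow>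
      icod B \<cdot> (i1 F \<cdot> f) = i0 F \<cdot> (icod (isrc F) \<cdot> f)"
proof -
  show *: "icod B \<cdot> i1 F = i0 F \<cdot> icod (isrc F)"
    using assms unfolding internal_functor_def by simp
  show "icod B \<cdot> (i1 F \<cdot> f) = i0 F \<cdot> (icod (isrc F) \<cdot> f)"
    if "f \<in> Ar C" "Tgt C f = I1 (isrc F)"
    using that assms Cmp_extend[OF *] by auto
qed

lemma functor_iidn [simp]:
  assumes "internal_functor C F" "isrc F = A"
  shows "i1 F \<cdot> iidn A = iidn (itgt F) \<cdot> i0 F"
    and "x \<in> Ar C \<Longrightarrow> Tgt C x = I0 A \<Longrightarrow> i1 F \<cdot> (iidn A \<cdot> x) = iidn (itgt F) \<cdot> (i0 F \<cdot> x)"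
proof -
  show *: "i1 F \<cdot> iidn A = iidn (itgt F) \<cdot> i0 F"
    using assms unfolding internal_functor_def by simp
  show "i1 F \<cdot> (iidn A \<cdot> x) = iidn (itgt F) \<cdot> (i0 F \<cdot> x)"
    if "x \<in> Ar C" "Tgt C x = I0 A"
    using that assms Cmp_extend[OF *] by auto
qed

text \<open>The functor axiom concerns the universal composable pair only; precomposing it with the
  map \<open>h\<close> that classifies the pair \<open>f\<close>, \<open>g\<close> gives all other
  cases.\<close>

lemma functor_gcmp [simp]:
  assumes F: "internal_functor C F" "isrc F = A" and f: "f \<in> Ar C" "Tgt C f = I1 A"
    and g: "g \<in> Ar C" "Tgt C g = I1 A" and fg: "Src C f = Src C g" "icod A \<cdot> f = idom A \<cdot> g"
  shows "i1 F \<cdot> gcmp C A g f = gcmp C (itgt F) (i1 F \<cdot> g) (i1 F \<cdot> f)"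
proof -
  have A: "internal_category C A" "internal_category C (itgt F)" using F by auto
  obtain h where h: "h \<in> Ar C" "Src C h = Src C g" "Tgt C h = I2 A" "ifst A \<cdot> h = f"
    "isnd A \<cdot> h = g" "gcmp C A g f = icmp A \<cdot> h"
    by (rule gcmp_obtain[OF A(1) f g fg])
  have "i1 F \<cdot> gcmp C A g f = (i1 F \<cdot> icmp A) \<cdot> h"
    using A F h by simp
  also have "i1 F \<cdot> icmp A = gcmp C (itgt F) (i1 F \<cdot> isnd A) (i1 F \<cdot> ifst A)"
    using F unfolding internal_functor_def by simp
  also have "\<dots> \<cdot> h = gcmp C (itgt F) (i1 F \<cdot> (isnd A \<cdot> h)) (i1 F \<cdot> (ifst A \<cdot> h))"
    using A F h(1-3) by simp
  finally show ?thesis using h by simp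
qed

lemma internal_functorI:
  assumes A: "internal_category C (isrc F)" "internal_category C (itgt F)"
    and F: "i0 F \<in> Ar C" "Src C (i0 F) = I0 (isrc F)" "Tgt C (i0 F) = I0 (itgt F)"
      "i1 F \<in> Ar C" "Src C (i1 F) = I1 (isrc F)" "Tgt C (i1 F) = I1 (itgt F)"
    and "idom (itgt F) \<cdot> i1 F = i0 F \<cdot> idom (isrc F)"
      "icod (itgt F) \<cdot> i1 F = i0 F \<cdot> icod (isrc F)"
      "i1 F \<cdot> iidn (isrc F) = iidn (itgt F) \<cdot> i0 F"
      "i1 F \<cdot> gcmp C (isrc F) (isnd (isrc F)) (ifst (isrc F)) =
        gcmp C (itgt F) (i1 F \<cdot> isnd (isrc F)) (i1 F \<cdot> ifst (isrc F))"
  shows "internal_functor C F"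
  using assms unfolding internal_functor_def hom_iff icmp_eq_gcmp[OF A(1)] by simp

lemma internal_transformation_simps [simp]:
  assumes "internal_transformation C a"
  shows "internal_functor C (tsrc a)" "internal_functor C (ttgt a)"
    "isrc (ttgt a) = isrc (tsrc a)" "itgt (ttgt a) = itgt (tsrc a)"
    "tcmp a \<in> Ar C" "Src C (tcmp a) = I0 (isrc (tsrc a))" "Tgt C (tcmp a) = I1 (itgt (tsrc a))"
  using assms unfolding internal_transformation_def hom_iff Let_def by simp_all

lemma transformation_dom_cod [simp]:
  assumes a: "internal_transformation C a" and B: "itgt (tsrc a) = B"
  shows "idom B \<cdot> tcmp a = i0 (tsrc a)" "icod B \<cdot> tcmp a = i0 (ttgt a)"
    "x \<in> Ar C \<Longrightarrow> Tgt C x = I0 (isrc (tsrc a)) \<Longrightarrow> idom B \<cdot> (tcmp a \<cdot> x) = i0 (tsrc a) \<cdot> x"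
    "x \<in> Ar C \<Longrightarrow> Tgt C x = I0 (isrc (tsrc a)) \<Longrightarrow> icod B \<cdot> (tcmp a \<cdot> x) = i0 (ttgt a) \<cdot> x"
proof -
  show *: "idom B \<cdot> tcmp a = i0 (tsrc a)" "icod B \<cdot> tcmp a = i0 (ttgt a)"
    using a B unfolding internal_transformation_def Let_def by simp_all
  have "internal_functor C (tsrc a)" using a by simp
  then have "internal_category C B" using B internal_functor_simps(2) by blast
  then show "idom B \<cdot> (tcmp a \<cdot> x) = i0 (tsrc a) \<cdot> x" "icod B \<cdot> (tcmp a \<cdot> x) = i0 (ttgt a) \<cdot> x"
    if "x \<in> Ar C" "Tgt C x = I0 (isrc (tsrc a))"
    using that a B Cmp_extend[OF *(1)] Cmp_extend[OF *(2)] by auto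
qed

text \<open>The axiom is naturality at the universal arrow of the source; precomposition with
  \<open>f\<close> yields it at every generalised arrow.\<close>

lemma transformation_natural:
  assumes a: "internal_transformation C a" and f: "f \<in> Ar C" "Tgt C f = I1 (isrc (tsrc a))"
  shows "gcmp C (itgt (tsrc a)) (i1 (ttgt a) \<cdot> f) (tcmp a \<cdot> (idom (isrc (tsrc a)) \<cdot> f)) =
    gcmp C (itgt (tsrc a)) (tcmp a \<cdot> (icod (isrc (tsrc a)) \<cdot> f)) (i1 (tsrc a) \<cdot> f)"
proof -
  have "gcmp C (itgt (tsrc a)) (i1 (ttgt a)) (tcmp a \<cdot> idom (isrc (tsrc a))) \<cdot> f =
    gcmp C (itgt (tsrc a)) (tcmp a \<cdot> icod (isrc (tsrc a))) (i1 (tsrc a)) \<cdot> f"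
    using a unfolding internal_transformation_def Let_def by simp
  then show ?thesis using a f by simp
qed

lemma internal_transformationI:
  assumes "internal_functor C (tsrc a)" "internal_functor C (ttgt a)"
    "isrc (ttgt a) = isrc (tsrc a)" "itgt (ttgt a) = itgt (tsrc a)"
    "tcmp a \<in> Ar C" "Src C (tcmp a) = I0 (isrc (tsrc a))" "Tgt C (tcmp a) = I1 (itgt (tsrc a))"
    "idom (itgt (tsrc a)) \<cdot> tcmp a = i0 (tsrc a)" "icod (itgt (tsrc a)) \<cdot> tcmp a = i0 (ttgt a)"
    "gcmp C (itgt (tsrc a)) (i1 (ttgt a)) (tcmp a \<cdot> idom (isrc (tsrc a))) =
      gcmp C (itgt (tsrc a)) (tcmp a \<cdot> icod (isrc (tsrc a))) (i1 (tsrc a))"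
  shows "internal_transformation C a"
  using assms unfolding internal_transformation_def hom_iff Let_def by simp

section \<open>Identities and composites in the 2-category of internal categories\<close>

lemma internal_functor_id [simp]:
  assumes "internal_category C A"
  shows "internal_functor C \<lparr>isrc = A, itgt = A, i0 = Idn C (I0 A), i1 = Idn C (I1 A)\<rparr>"
  using assms by (intro internal_functorI) simp_all

lemma internal_functor_cmp [simp]:
  assumes "internal_functor C F" "internal_functor C G" "itgt F = isrc G"
  shows "internal_functor C (ifun_cmp C G F)"
  using assms by (intro internal_functorI) simp_all

lemma internal_transformation_id [simp]:
  assumes "internal_functor C F"
  shows "internal_transformation C \<lparr>tsrc = F, ttgt = F, tcmp = iidn (itgt F) \<cdot> i0 F\<rparr>"
  using assms by (intro internal_transformationI) simp_all

lemma transformationD: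
  assumes t: "internal_transformation C \<lparr>tsrc = F, ttgt = G, tcmp = a\<rparr>" and A: "isrc F = A" "itgt F = B"
  shows "internal_category C A" "internal_category C B" "internal_functor C F" "internal_functor C G"
    "isrc F = A" "itgt F = B" "isrc G = A" "itgt G = B"
    "a \<in> Ar C" "Src C a = I0 A" "Tgt C a = I1 B" "idom B \<cdot> a = i0 F" "icod B \<cdot> a = i0 G"
    "\<And>x. x \<in> Ar C \<Longrightarrow> Tgt C x = I0 A \<Longrightarrow> idom B \<cdot> (a \<cdot> x) = i0 F \<cdot> x"
    "\<And>x. x \<in> Ar C \<Longrightarrow> Tgt C x = I0 A \<Longrightarrow> icod B \<cdot> (a \<cdot> x) = i0 G \<cdot> x"
proof -
  show F: "internal_functor C F" "internal_functor C G"
    using internal_transformation_simps(1,2)[OF t] by simp_all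
  show "internal_category C A" "internal_category C B"
    using internal_functor_simps(1,2)[OF F(1)] A by simp_all
qed (use internal_transformation_simps[OF t] transformation_dom_cod[OF t] A in simp_all)

lemma transformation_naturalD:
  assumes t: "internal_transformation C \<lparr>tsrc = F, ttgt = G, tcmp = a\<rparr>" and A: "isrc F = A" "itgt F = B"
  shows "gcmp C B (i1 G) (a \<cdot> idom A) = gcmp C B (a \<cdot> icod A) (i1 F)"
    "\<And>f x y. f \<in> Ar C \<Longrightarrow> Tgt C f = I1 A \<Longrightarrow> x = idom A \<cdot> f \<Longrightarrow> y = icod A \<cdot> f \<Longrightarrow>
      gcmp C B (i1 G \<cdot> f) (a \<cdot> x) = gcmp C B (a \<cdot> y) (i1 F \<cdot> f)"
  using t transformation_natural[OF t] A unfolding internal_transformation_def by (auto simp: Let_def)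

lemma transformationI:
  assumes "internal_functor C F" "internal_functor C G"
    "isrc F = A" "itgt F = B" "isrc G = A" "itgt G = B"
    "a \<in> Ar C" "Src C a = I0 A" "Tgt C a = I1 B"
    "idom B \<cdot> a = i0 F" "icod B \<cdot> a = i0 G"
    "gcmp C B (i1 G) (a \<cdot> idom A) = gcmp C B (a \<cdot> icod A) (i1 F)"
  shows "internal_transformation C \<lparr>tsrc = F, ttgt = G, tcmp = a\<rparr>"
  using assms unfolding internal_transformation_def hom_iff Let_def by simp

text \<open>The naturality square of the composite is obtained by pasting the square of
  \<open>b\<close> onto that of \<open>a\<close>; the chain below uses them in this order.\<close>

lemma transformation_vcmp:
  assumes a: "internal_transformation C \<lparr>tsrc = F, ttgt = G, tcmp = a\<rparr>"
    and b: "internal_transformation C \<lparr>tsrc = G, ttgt = H, tcmp = b\<rparr>"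
    and A: "isrc F = A" "itgt F = B"
  shows "internal_transformation C \<lparr>tsrc = F, ttgt = H, tcmp = gcmp C B b a\<rparr>"
proof -
  note a' = transformationD[OF a A]
  note b' = transformationD[OF b a'(7,8)]
  have "gcmp C B (i1 H) (gcmp C B (b \<cdot> idom A) (a \<cdot> idom A)) =
     gcmp C B (gcmp C B (i1 H) (b \<cdot> idom A)) (a \<cdot> idom A)"
    using a' b' by simp
  also have "gcmp C B (i1 H) (b \<cdot> idom A) = gcmp C B (b \<cdot> icod A) (i1 G)"
    using transformation_naturalD[OF b] a' by blast
  also have "gcmp C B (gcmp C B (b \<cdot> icod A) (i1 G)) (a \<cdot> idom A) =
      gcmp C B (b \<cdot> icod A) (gcmp C B (i1 G) (a \<cdot> idom A))"
    using a' b' by simp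
  also have "gcmp C B (i1 G) (a \<cdot> idom A) = gcmp C B (a \<cdot> icod A) (i1 F)"
    using transformation_naturalD[OF a] A by blast
  finally show ?thesis
    using a' b' by (intro transformationI[of F H A B]) simp_all
qed

text \<open>The outer square splits into naturality of \<open>b\<close> at the generalised arrow
  \<open>i1 F'\<close> and the image under \<open>G\<close> of the naturality square of
  \<open>a\<close>.\<close>

lemma transformation_hcmp:
  assumes a: "internal_transformation C \<lparr>tsrc = F, ttgt = F', tcmp = a\<rparr>"
    and b: "internal_transformation C \<lparr>tsrc = G, ttgt = G', tcmp = b\<rparr>"
    and A: "isrc F = A" "itgt F = B" "isrc G = B" "itgt G = D"
  shows "internal_transformation C \<lparr>tsrc = ifun_cmp C G F, ttgt = ifun_cmp C G' F',
     tcmp = gcmp C D (b \<cdot> i0 F') (i1 G \<cdot> a)\<rparr>"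
proof -
  note a' = transformationD[OF a A(1,2)]
  note b' = transformationD[OF b A(3,4)]
  have "gcmp C D (i1 G' \<cdot> i1 F') (gcmp C D (b \<cdot> (i0 F' \<cdot> idom A)) (i1 G \<cdot> (a \<cdot> idom A))) =
      gcmp C D (gcmp C D (i1 G' \<cdot> i1 F') (b \<cdot> (i0 F' \<cdot> idom A))) (i1 G \<cdot> (a \<cdot> idom A))"
    using a' b' by simp
  also have "gcmp C D (i1 G' \<cdot> i1 F') (b \<cdot> (i0 F' \<cdot> idom A)) =
      gcmp C D (b \<cdot> (i0 F' \<cdot> icod A)) (i1 G \<cdot> i1 F')"
    using a' b' by (intro transformation_naturalD(2)[OF b A(3,4)]) simp_all
  also have "gcmp C D \<dots> (i1 G \<cdot> (a \<cdot> idom A)) =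
      gcmp C D (b \<cdot> (i0 F' \<cdot> icod A)) (i1 G \<cdot> gcmp C B (i1 F') (a \<cdot> idom A))"
    using a' b' by simp
  also have "gcmp C B (i1 F') (a \<cdot> idom A) = gcmp C B (a \<cdot> icod A) (i1 F)"
    using transformation_naturalD[OF a] A by blast
  finally show ?thesis
    using a' b' by (intro transformationI[of _ _ A D]) simp_all
qed

lemma transformation_interchange:
  assumes a: "internal_transformation C \<lparr>tsrc = F, ttgt = F', tcmp = a\<rparr>"
    and a': "internal_transformation C \<lparr>tsrc = F', ttgt = F'', tcmp = a'\<rparr>"
    and b: "internal_transformation C \<lparr>tsrc = G, ttgt = G', tcmp = b\<rparr>"
    and b': "internal_transformation C \<lparr>tsrc = G', ttgt = G'', tcmp = b'\<rparr>"
    and A: "isrc F = A" "itgt F = B" "isrc G = B" "itgt G = D"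
  shows "gcmp C D (gcmp C D b' b \<cdot> i0 F'') (i1 G \<cdot> gcmp C B a' a) =
    gcmp C D (gcmp C D (b' \<cdot> i0 F'') (i1 G' \<cdot> a')) (gcmp C D (b \<cdot> i0 F') (i1 G \<cdot> a))"
proof -
  note 1 = transformationD[OF a A(1,2)]
  note 2 = transformationD[OF a' 1(7,8)]
  note 3 = transformationD[OF b A(3,4)]
  note 4 = transformationD[OF b' 3(7,8)]
  \<comment> \<open>The two inner factors are exchanged by naturality of \<open>b\<close> at
    \<open>a'\<close>, regarded as a generalised arrow at the stage \<open>I0 A\<close>. The rest is
    reassociation.\<close>
  have eq: "gcmp C D (i1 G' \<cdot> a') (b \<cdot> i0 F') = gcmp C D (b \<cdot> i0 F'') (i1 G \<cdot> a')"
    using 1 2 by (intro transformation_naturalD(2)[OF b A(3,4)]) simp_all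
  have "gcmp C D (b \<cdot> i0 F'') (gcmp C D (i1 G \<cdot> a') (i1 G \<cdot> a)) =
      gcmp C D (gcmp C D (b \<cdot> i0 F'') (i1 G \<cdot> a')) (i1 G \<cdot> a)"
    using 1 2 3 4 by simp
  also have "\<dots> = gcmp C D (i1 G' \<cdot> a') (gcmp C D (b \<cdot> i0 F') (i1 G \<cdot> a))"
    unfolding eq[symmetric] using 1 2 3 4 by simp
  finally show ?thesis
    using 1 2 3 4 by simp
qed

text \<open>Both sides are one threefold composite, with factors coming from \<open>a\<close>,
  \<open>b\<close> and \<open>c\<close>: functoriality of \<open>H\<close> and associativity of
  \<open>gcmp\<close> identify the two bracketings.\<close>

lemma transformation_hcmp_assoc:
  assumes a: "internal_transformation C \<lparr>tsrc = F, ttgt = F', tcmp = a\<rparr>"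
    and b: "internal_transformation C \<lparr>tsrc = G, ttgt = G', tcmp = b\<rparr>"
    and c: "internal_transformation C \<lparr>tsrc = H, ttgt = H', tcmp = c\<rparr>"
    and A: "isrc F = A" "itgt F = B" "isrc G = B" "itgt G = D" "isrc H = D" "itgt H = J"
  shows "gcmp C J (gcmp C J (c \<cdot> i0 G') (i1 H \<cdot> b) \<cdot> i0 F') ((i1 H \<cdot> i1 G) \<cdot> a) =
    gcmp C J (c \<cdot> (i0 G' \<cdot> i0 F')) (i1 H \<cdot> gcmp C D (b \<cdot> i0 F') (i1 G \<cdot> a))"
proof -
  note 1 = transformationD[OF a A(1,2)]
  note 2 = transformationD[OF b A(3,4)]
  note 3 = transformationD[OF c A(5,6)]
  have "gcmp C J (c \<cdot> i0 G') (i1 H \<cdot> b) \<cdot> i0 F' = gcmp C J (c \<cdot> (i0 G' \<cdot> i0 F')) (i1 H \<cdot> (b \<cdot> i0 F'))"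
    using 1 2 3 by simp
  moreover have "(i1 H \<cdot> i1 G) \<cdot> a = i1 H \<cdot> (i1 G \<cdot> a)"
    using 1 2 3 by simp
  moreover have "i1 H \<cdot> gcmp C D (b \<cdot> i0 F') (i1 G \<cdot> a) =
      gcmp C J (i1 H \<cdot> (b \<cdot> i0 F')) (i1 H \<cdot> (i1 G \<cdot> a))"
    using 1 2 3 by simp
  moreover have "gcmp C J (gcmp C J (c \<cdot> (i0 G' \<cdot> i0 F')) (i1 H \<cdot> (b \<cdot> i0 F'))) (i1 H \<cdot> (i1 G \<cdot> a)) =
      gcmp C J (c \<cdot> (i0 G' \<cdot> i0 F')) (gcmp C J (i1 H \<cdot> (b \<cdot> i0 F')) (i1 H \<cdot> (i1 G \<cdot> a)))"
    using 1 2 3 by (intro gcmp_assoc) simp_all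
  ultimately show ?thesis by simp
qed

lemma category_intcat: "category (One (intcat C))" "category (Two (intcat C))"
proof -
  show "category (One (intcat C))"
    unfolding category_def by (auto simp: hom_iff intro!: ifun.equality)
  show "category (Two (intcat C))"
    unfolding category_def
  proof (intro conjI ballI impI)
    fix a b assume "a \<in> Ar (Two (intcat C))" "b \<in> Ar (Two (intcat C))"
      "Tgt (Two (intcat C)) a = Src (Two (intcat C)) b"
    then show "Cmp (Two (intcat C)) b a \<in> hom (Two (intcat C)) (Src (Two (intcat C)) a) (Tgt (Two
        (intcat C)) b)"
      by (cases a, cases b) (auto simp: hom_iff intro: transformation_vcmp)
  next
    fix a b c assume "a \<in> Ar (Two (intcat C))" "b \<in> Ar (Two (intcat C))" "c \<in> Ar (Two (intcat C))"
      "Tgt (Two (intcat C)) a = Src (Two (intcat C)) b"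
      "Tgt (Two (intcat C)) b = Src (Two (intcat C)) c"
    then obtain F G H I \<alpha> \<beta> \<gamma> A B where
       eq: "a = \<lparr>tsrc = F, ttgt = G, tcmp = \<alpha>\<rparr>" "b = \<lparr>tsrc = G, ttgt = H, tcmp = \<beta>\<rparr>" "c = \<lparr>tsrc =
           H, ttgt = I, tcmp = \<gamma>\<rparr>"
       "isrc F = A" "itgt F = B" and
      a: "internal_transformation C \<lparr>tsrc = F, ttgt = G, tcmp = \<alpha>\<rparr>"
      and b: "internal_transformation C \<lparr>tsrc = G, ttgt = H, tcmp = \<beta>\<rparr>" and
      c: "internal_transformation C \<lparr>tsrc = H, ttgt = I, tcmp = \<gamma>\<rparr>"
      by (cases a, cases b, cases c) auto
    note 1 = transformationD[OF a eq(4,5)]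
    note 2 = transformationD[OF b 1(7,8)]
    note 3 = transformationD[OF c 2(7,8)]
    show "Cmp (Two (intcat C)) (Cmp (Two (intcat C)) c b) a =
        Cmp (Two (intcat C)) c (Cmp (Two (intcat C)) b a)"
      using 1 2 3 by (simp add: eq)
  qed (auto simp: hom_iff intro!: itrans.equality)
qed

text \<open>This makes the general results on whiskering, adjunctions and products available in the
  target of \<open>E\<close>.\<close>

lemma twocategory_intcat: "twocategory (intcat C)"
  unfolding twocategory_def
proof (intro conjI ballI impI)
  show "category (One (intcat C))" "category (Two (intcat C))" by (rule category_intcat)+
next
  fix a b assume "a \<in> Ar (Two (intcat C))" "b \<in> Ar (Two (intcat C))"
    "tgt0 (intcat C) a = src0 (intcat C) b"
  then show "HC (intcat C) b a \<in> hom (Two (intcat C))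
      (Cmp (One (intcat C)) (Src (Two (intcat C)) b) (Src (Two (intcat C)) a))
      (Cmp (One (intcat C)) (Tgt (Two (intcat C)) b) (Tgt (Two (intcat C)) a))"
    by (cases a, cases b) (auto simp: hom_iff intro: transformation_hcmp)
next
  fix a a' b b' assume "a \<in> Ar (Two (intcat C))" "a' \<in> Ar (Two (intcat C))" "b \<in> Ar (Two (intcat C))"
      "b' \<in> Ar (Two (intcat C))" "tgt0 (intcat C) a = src0 (intcat C) b"
      "Tgt (Two (intcat C)) a = Src (Two (intcat C)) a'"
      "Tgt (Two (intcat C)) b = Src (Two (intcat C)) b'"
  then obtain F F' F'' G G' G'' \<alpha> \<alpha>' \<beta> \<beta>' where
     eq: "a = \<lparr>tsrc = F, ttgt = F', tcmp = \<alpha>\<rparr>" "a' = \<lparr>tsrc = F', ttgt = F'', tcmp = \<alpha>'\<rparr>"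
         "b = \<lparr>tsrc = G, ttgt = G', tcmp = \<beta>\<rparr>" "b' = \<lparr>tsrc = G', ttgt = G'', tcmp = \<beta>'\<rparr>"
     "isrc G = itgt F" and
     t: "internal_transformation C \<lparr>tsrc = F, ttgt = F', tcmp = \<alpha>\<rparr>"
      "internal_transformation C \<lparr>tsrc = F', ttgt = F'', tcmp = \<alpha>'\<rparr>"
      "internal_transformation C \<lparr>tsrc = G, ttgt = G', tcmp = \<beta>\<rparr>"
      "internal_transformation C \<lparr>tsrc = G', ttgt = G'', tcmp = \<beta>'\<rparr>"
    by (cases a, cases a', cases b, cases b') auto
  define A B D where "A = isrc F" "B = itgt F" "D = itgt G"
  then have A: "isrc F = A" "itgt F = B" "isrc G = B" "itgt G = D"
    using eq(5) by simp_all
  note e = A transformationD(7,8)[OF t(1) A(1,2)] transformationD(7,8)[OF t(3) A(3,4)]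
  show "HC (intcat C) (Cmp (Two (intcat C)) b' b) (Cmp (Two (intcat C)) a' a) =
      Cmp (Two (intcat C)) (HC (intcat C) b' a') (HC (intcat C) b a)"
    by (simp only: eq(1-4) e intcat_simps itrans.simps ifun_cmp_simps transformation_interchange[OF t A])
next
  fix a b c assume "a \<in> Ar (Two (intcat C))" "b \<in> Ar (Two (intcat C))" "c \<in> Ar (Two (intcat C))"
    "tgt0 (intcat C) a = src0 (intcat C) b" "tgt0 (intcat C) b = src0 (intcat C) c"
  then obtain F F' G G' H H' \<alpha> \<beta> \<gamma> where
     eq: "a = \<lparr>tsrc = F, ttgt = F', tcmp = \<alpha>\<rparr>" "b = \<lparr>tsrc = G, ttgt = G', tcmp = \<beta>\<rparr>" "c = \<lparr>tsrc =
         H, ttgt = H', tcmp = \<gamma>\<rparr>"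
     "isrc G = itgt F" "isrc H = itgt G" and
     t: "internal_transformation C \<lparr>tsrc = F, ttgt = F', tcmp = \<alpha>\<rparr>"
      "internal_transformation C \<lparr>tsrc = G, ttgt = G', tcmp = \<beta>\<rparr>"
      "internal_transformation C \<lparr>tsrc = H, ttgt = H', tcmp = \<gamma>\<rparr>"
    by (cases a, cases b, cases c) auto
  define A B D J where "A = isrc F" "B = itgt F" "D = itgt G" "J = itgt H"
  then have A: "isrc F = A" "itgt F = B" "isrc G = B" "itgt G = D" "isrc H = D" "itgt H = J"
    using eq(4,5) by simp_all
  note 1 = transformationD[OF t(1) A(1,2)]
  note 2 = transformationD[OF t(2) A(3,4)]
  note 3 = transformationD[OF t(3) A(5,6)]
  show "HC (intcat C) (HC (intcat C) c b) a = HC (intcat C) c (HC (intcat C) b a)"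
    using 1 2 3 transformation_hcmp_assoc[OF t A]
    by (simp only: eq(1-3) intcat_simps itrans.simps ifun_cmp_simps itrans.ext_inject ifun_cmp_def
        ifun.simps)
      simp
next
  fix a assume "a \<in> Ar (Two (intcat C))"
  then show "HC (intcat C) a (Idn (Two (intcat C)) (Idn (One (intcat C)) (src0 (intcat C) a))) = a"
    "HC (intcat C) (Idn (Two (intcat C)) (Idn (One (intcat C)) (tgt0 (intcat C) a))) a = a"
    by (auto intro!: itrans.equality ifun.equality)
next
  fix f g assume "f \<in> Ar (One (intcat C))" "g \<in> Ar (One (intcat C))"
    "Tgt (One (intcat C)) f = Src (One (intcat C)) g"
  then show "HC (intcat C) (Idn (Two (intcat C)) g) (Idn (Two (intcat C)) f) =
    Idn (Two (intcat C)) (Cmp (One (intcat C)) g f)"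
    by auto
qed (auto simp: hom_iff)

subsection \<open>Products and discrete objects\<close>

lemma product1_obtain:
  assumes "is_product1 C A B P p q" "f \<in> Ar C" "g \<in> Ar C" "Src C f = Src C g" "Tgt C f = A" "Tgt C g = B"
  obtains h where "h \<in> Ar C" "Src C h = Src C f" "Tgt C h = P" "p \<cdot> h = f" "q \<cdot> h = g"
proof -
  have "\<exists>!h. h \<in> hom C (Src C f) P \<and> Cmp C p h = f \<and> Cmp C q h = g"
    using assms unfolding is_product1_def by (simp add: hom_iff)
  then show ?thesis using that by (auto simp: hom_iff)
qed

lemma product1_eq:
  assumes P: "is_product1 C A B P p q" and hk: "h \<in> Ar C" "k \<in> Ar C" "Src C h = Src C k" "Tgt C h =
      P" "Tgt C k = P"
    and e: "p \<cdot> h = p \<cdot> k" "q \<cdot> h = q \<cdot> k"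
  shows "h = k"
proof -
  have pq: "p \<in> hom C P A" "q \<in> hom C P B" using P unfolding is_product1_def by auto
  then have "\<exists>!l. l \<in> hom C (Src C h) P \<and> p \<cdot> l = p \<cdot> h \<and> q \<cdot> l = q \<cdot> h"
    using P hk unfolding is_product1_def by (simp add: hom_iff)
  moreover have "h \<in> hom C (Src C h) P" "k \<in> hom C (Src C h) P"
    using hk by (simp_all add: hom_iff)
  ultimately show ?thesis using e by metis
qed

text \<open>The horizontal composite contains an identity factor contributed by \<open>H\<close>,
  which the unit law of \<open>gcmp\<close> removes.\<close>

lemma wl_intcat:
  assumes a: "internal_transformation C \<lparr>tsrc = F, ttgt = G, tcmp = a\<rparr>" "isrc F = A" "itgt F = B"
    and H: "internal_functor C H" "isrc H = B"
  shows "wl (intcat C) H \<lparr>tsrc = F, ttgt = G, tcmp = a\<rparr> =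
    \<lparr>tsrc = ifun_cmp C H F, ttgt = ifun_cmp C H G, tcmp = i1 H \<cdot> a\<rparr>"
  using H transformationD[OF a] by simp

lemma itrans_collapse: "\<lparr>tsrc = tsrc t, ttgt = ttgt t, tcmp = tcmp t\<rparr> = (t :: ('o, 'a) itrans)"
  by simp

lemma ifun_eq_iff:
  "(F :: ('o, 'a) ifun) = G \<longleftrightarrow> isrc F = isrc G \<and> itgt F = itgt G \<and> i0 F = i0 G \<and> i1 F = i1 G"
  by (auto intro: ifun.equality)

text \<open>Products of internal categories are formed levelwise. The mediating maps
  \<open>h0\<close> and \<open>h1\<close> exist in \<open>C\<close>; they form an internal functor
  because each functor equation can be tested after composing with the jointly monic components of
  \<open>p\<close> and \<open>q\<close>, where it becomes an equation for \<open>f\<close> and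
  \<open>g\<close>.\<close>

lemma product_intcat_1:
  assumes p: "internal_functor C p" "isrc p = P" "itgt p = A"
    and q: "internal_functor C q" "isrc q = P" "itgt q = B"
    and P0: "is_product1 C (I0 A) (I0 B) (I0 P) (i0 p) (i0 q)"
    and P1: "is_product1 C (I1 A) (I1 B) (I1 P) (i1 p) (i1 q)"
    and f: "internal_functor C f" "isrc f = X" "itgt f = A"
    and g: "internal_functor C g" "isrc g = X" "itgt g = B"
  shows "\<exists>!h. h \<in> hom (One (intcat C)) X P \<and>
    Cmp (One (intcat C)) p h = f \<and> Cmp (One (intcat C)) q h = g"
proof -
  have I: "internal_category C P" "internal_category C A" "internal_category C B" "internal_category C X"
    using internal_functor_simps(1,2)[OF p(1)] internal_functor_simps(1,2)[OF q(1)]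
      internal_functor_simps(1,2)[OF f(1)] p q f by simp_all
  obtain h0 where h0: "h0 \<in> Ar C" "Src C h0 = I0 X" "Tgt C h0 = I0 P" "i0 p \<cdot> h0 = i0 f"
    "i0 q \<cdot> h0 = i0 g"
    using product1_obtain[OF P0, of "i0 f" "i0 g"] f g by auto
  obtain h1 where h1: "h1 \<in> Ar C" "Src C h1 = I1 X" "Tgt C h1 = I1 P" "i1 p \<cdot> h1 = i1 f"
    "i1 q \<cdot> h1 = i1 g"
    using product1_obtain[OF P1, of "i1 f" "i1 g"] f g by auto
  have ext0: "i0 p \<cdot> (h0 \<cdot> x) = i0 f \<cdot> x" "i0 q \<cdot> (h0 \<cdot> x) = i0 g \<cdot> x"
    if "x \<in> Ar C" "Tgt C x = I0 X" for x
    using that h0 p q I Cmp_extend[OF h0(4)] Cmp_extend[OF h0(5)] by simp_all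
  have ext1: "i1 p \<cdot> (h1 \<cdot> x) = i1 f \<cdot> x" "i1 q \<cdot> (h1 \<cdot> x) = i1 g \<cdot> x"
    if "x \<in> Ar C" "Tgt C x = I1 X" for x
    using that h1 p q I Cmp_extend[OF h1(4)] Cmp_extend[OF h1(5)] by simp_all
  note H = I p q f g h0 h1 ext0 ext1
  \<comment> \<open>Since \<open>p\<close> and \<open>q\<close> commute with domain and codomain,
    the boundaries of \<open>h1\<close> can be computed at the level of objects from
    \<open>i1 f\<close> and \<open>i1 g\<close>.\<close>
  have eqs: "i0 p \<cdot> (idom P \<cdot> h1) = idom A \<cdot> (i1 p \<cdot> h1)" "i0 q \<cdot> (idom P \<cdot> h1) = idom B \<cdot> (i1 q \<cdot> h1)"
    "i0 p \<cdot> (icod P \<cdot> h1) = icod A \<cdot> (i1 p \<cdot> h1)" "i0 q \<cdot> (icod P \<cdot> h1) = icod B \<cdot> (i1 q \<cdot> h1)"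
    using I p q h1(1-3) by simp_all
  note eqs = eqs[unfolded h1(4,5)]
  have d: "idom P \<cdot> h1 = h0 \<cdot> idom X"
    by (rule product1_eq[OF P0]) (use I f g h0(1-3) h1(1-3) ext0 in \<open>simp_all add: eqs\<close>)
  have c: "icod P \<cdot> h1 = h0 \<cdot> icod X"
    by (rule product1_eq[OF P0]) (use I f g h0(1-3) h1(1-3) ext0 in \<open>simp_all add: eqs\<close>)
  have i: "h1 \<cdot> iidn X = iidn P \<cdot> h0"
    by (rule product1_eq[OF P1]; use H in simp)
  have de: "idom P \<cdot> (h1 \<cdot> x) = h0 \<cdot> (idom X \<cdot> x)" "icod P \<cdot> (h1 \<cdot> x) = h0 \<cdot> (icod X \<cdot> x)"
    if "x \<in> Ar C" "Tgt C x = I1 X" for x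
    using that H Cmp_extend[OF d] Cmp_extend[OF c] by simp_all
  \<comment> \<open>Tested after \<open>i1 p\<close> and \<open>i1 q\<close>, this is compatibility
    of \<open>f\<close> and \<open>g\<close> with composition; \<open>de\<close> supplies
    composability of the right-hand factors.\<close>
  have m: "h1 \<cdot> gcmp C X (isnd X) (ifst X) = gcmp C P (h1 \<cdot> isnd X) (h1 \<cdot> ifst X)"
    by (rule product1_eq[OF P1]; use H de in simp)
  let ?h = "\<lparr>isrc = X, itgt = P, i0 = h0, i1 = h1\<rparr>"
  have "internal_functor C ?h"
    using I h0 h1 d c i m by (intro internal_functorI) simp_all
  then have "?h \<in> hom (One (intcat C)) X P \<and>
    Cmp (One (intcat C)) p ?h = f \<and> Cmp (One (intcat C)) q ?h = g"
    using H by (simp add: hom_iff ifun_eq_iff)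
  moreover have "k = ?h" if k: "k \<in> hom (One (intcat C)) X P \<and>
    Cmp (One (intcat C)) p k = f \<and> Cmp (One (intcat C)) q k = g" for k
  proof -
    have k': "internal_functor C k" "isrc k = X" "itgt k = P" using k by (simp_all add: hom_iff)
    have k0: "i0 p \<cdot> i0 k = i0 f" "i0 q \<cdot> i0 k = i0 g" "i1 p \<cdot> i1 k = i1 f" "i1 q \<cdot> i1 k = i1 g"
      using k by (auto simp: hom_iff)
    have "i0 k = h0"
      by (rule product1_eq[OF P0]; use k' k0 I h0 in simp)
    moreover have "i1 k = h1"
      by (rule product1_eq[OF P1]; use k' k0 I h1 in simp)
    ultimately show ?thesis using k' by (simp add: ifun_eq_iff)
  qed
  ultimately show ?thesis by blast
qed

text \<open>A component of a transformation out of \<open>X\<close> is a map from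
  \<open>I0 X\<close> to an object of arrows. So the new component \<open>c\<close> comes from the
  product at the level of arrows, and its source and target functors \<open>h\<close>,
  \<open>h'\<close> from the 1-dimensional case.\<close>

lemma product_intcat_2:
  assumes p: "internal_functor C p" "isrc p = P" "itgt p = A"
    and q: "internal_functor C q" "isrc q = P" "itgt q = B"
    and P0: "is_product1 C (I0 A) (I0 B) (I0 P) (i0 p) (i0 q)"
    and P1: "is_product1 C (I1 A) (I1 B) (I1 P) (i1 p) (i1 q)"
    and a: "internal_transformation C \<lparr>tsrc = f, ttgt = f', tcmp = a\<rparr>" "isrc f = X" "itgt f = A"
    and b: "internal_transformation C \<lparr>tsrc = g, ttgt = g', tcmp = b\<rparr>" "isrc g = X" "itgt g = B"
  shows "\<exists>!c. c \<in> Ar (homcat (intcat C) X P) \<and>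
    wl (intcat C) p c = \<lparr>tsrc = f, ttgt = f', tcmp = a\<rparr> \<and>
    wl (intcat C) q c = \<lparr>tsrc = g, ttgt = g', tcmp = b\<rparr>"
proof -
  note a' = transformationD[OF a] and b' = transformationD[OF b]
  have I: "internal_category C P"
    using internal_functor_simps(1)[OF p(1)] p by simp
  note ex1 = product_intcat_1[OF p q P0 P1 a'(3,5,6) b'(3,5,6)]
  then obtain h where h: "internal_functor C h" "isrc h = X" "itgt h = P" "ifun_cmp C p h = f"
    "ifun_cmp C q h = g"
    by (auto simp: hom_iff)
  note ex1' = product_intcat_1[OF p q P0 P1 a'(4,7,8) b'(4,7,8)]
  then obtain h' where h': "internal_functor C h'" "isrc h' = X" "itgt h' = P" "ifun_cmp C p h' =
      f'" "ifun_cmp C q h' = g'"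
    by (auto simp: hom_iff)
  have fg: "i0 f = i0 p \<cdot> i0 h" "i1 f = i1 p \<cdot> i1 h" "i0 g = i0 q \<cdot> i0 h" "i1 g = i1 q \<cdot> i1 h"
     "i0 f' = i0 p \<cdot> i0 h'" "i1 f' = i1 p \<cdot> i1 h'" "i0 g' = i0 q \<cdot> i0 h'" "i1 g' = i1 q \<cdot> i1 h'"
    using h h' by auto
  obtain c where c: "c \<in> Ar C" "Src C c = I0 X" "Tgt C c = I1 P" "i1 p \<cdot> c = a" "i1 q \<cdot> c = b"
    using product1_obtain[OF P1, of a b] a' b' by auto
  have ext: "i1 p \<cdot> (c \<cdot> x) = a \<cdot> x" "i1 q \<cdot> (c \<cdot> x) = b \<cdot> x"
    if "x \<in> Ar C" "Tgt C x = I0 X" for x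
    using that c p q I Cmp_extend[OF c(4)] Cmp_extend[OF c(5)] by simp_all
  note H = I p q a' b' h(1-3) h'(1-3) c
  have eqs: "i0 p \<cdot> (idom P \<cdot> c) = idom A \<cdot> (i1 p \<cdot> c)" "i0 q \<cdot> (idom P \<cdot> c) = idom B \<cdot> (i1 q \<cdot> c)"
    "i0 p \<cdot> (icod P \<cdot> c) = icod A \<cdot> (i1 p \<cdot> c)" "i0 q \<cdot> (icod P \<cdot> c) = icod B \<cdot> (i1 q \<cdot> c)"
    using I p q c(1-3) by simp_all
  have d: "idom P \<cdot> c = i0 h"
  proof (rule product1_eq[OF P0])
    show "i0 p \<cdot> (idom P \<cdot> c) = i0 p \<cdot> i0 h" "i0 q \<cdot> (idom P \<cdot> c) = i0 q \<cdot> i0 h"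
      by (simp_all only: eqs c(4,5) a'(12) b'(12) fg)
  qed (use I h c(1-3) in simp_all)
  have e: "icod P \<cdot> c = i0 h'"
  proof (rule product1_eq[OF P0])
    show "i0 p \<cdot> (icod P \<cdot> c) = i0 p \<cdot> i0 h'" "i0 q \<cdot> (icod P \<cdot> c) = i0 q \<cdot> i0 h'"
      by (simp_all only: eqs c(4,5) a'(13) b'(13) fg)
  qed (use I h' c(1-3) in simp_all)
  have de: "idom P \<cdot> (c \<cdot> x) = i0 h \<cdot> x" "icod P \<cdot> (c \<cdot> x) = i0 h' \<cdot> x"
    if "x \<in> Ar C" "Tgt C x = I0 X" for x
    using that H Cmp_extend[OF d] Cmp_extend[OF e] by simp_all
  \<comment> \<open>Naturality of \<open>c\<close> is tested after both projections, where it is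
    naturality of \<open>a\<close> and of \<open>b\<close>.\<close>
  have n: "gcmp C P (i1 h') (c \<cdot> idom X) = gcmp C P (c \<cdot> icod X) (i1 h)"
  proof (rule product1_eq[OF P1])
    have "i1 p \<cdot> gcmp C P (i1 h') (c \<cdot> idom X) = gcmp C A (i1 f') (a \<cdot> idom X)"
      using H de ext fg by simp
    also have "\<dots> = gcmp C A (a \<cdot> icod X) (i1 f)"
      by (rule transformation_naturalD[OF a])
    also have "\<dots> = i1 p \<cdot> gcmp C P (c \<cdot> icod X) (i1 h)"
      using H de ext fg by simp
    finally show "i1 p \<cdot> gcmp C P (i1 h') (c \<cdot> idom X) = i1 p \<cdot> gcmp C P (c \<cdot> icod X) (i1 h)" .
    have "i1 q \<cdot> gcmp C P (i1 h') (c \<cdot> idom X) = gcmp C B (i1 g') (b \<cdot> idom X)"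
      using H de ext fg by simp
    also have "\<dots> = gcmp C B (b \<cdot> icod X) (i1 g)"
      by (rule transformation_naturalD[OF b])
    also have "\<dots> = i1 q \<cdot> gcmp C P (c \<cdot> icod X) (i1 h)"
      using H de ext fg by simp
    finally show "i1 q \<cdot> gcmp C P (i1 h') (c \<cdot> idom X) = i1 q \<cdot> gcmp C P (c \<cdot> icod X) (i1 h)" .
  qed (use H de in simp_all)
  let ?c = "\<lparr>tsrc = h, ttgt = h', tcmp = c\<rparr>"
  have c': "internal_transformation C ?c"
    by (rule transformationI[OF h(1) h'(1) h(2,3) h'(2,3) c(1-3) d e n])
  have "?c \<in> Ar (homcat (intcat C) X P) \<and>
    wl (intcat C) p ?c = \<lparr>tsrc = f, ttgt = f', tcmp = a\<rparr> \<and>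
    wl (intcat C) q ?c = \<lparr>tsrc = g, ttgt = g', tcmp = b\<rparr>"
    unfolding wl_intcat[OF c' h(2,3) p(1,2)] wl_intcat[OF c' h(2,3) q(1,2)] using c' h h' c by simp
  moreover have "k = ?c" if k: "k \<in> Ar (homcat (intcat C) X P) \<and>
    wl (intcat C) p k = \<lparr>tsrc = f, ttgt = f', tcmp = a\<rparr> \<and>
    wl (intcat C) q k = \<lparr>tsrc = g, ttgt = g', tcmp = b\<rparr>" for k
  proof -
    obtain s t k' where k': "k = \<lparr>tsrc = s, ttgt = t, tcmp = k'\<rparr>" by (cases k) auto
    have K: "internal_transformation C \<lparr>tsrc = s, ttgt = t, tcmp = k'\<rparr>" "isrc s = X" "itgt s = P"
      using k unfolding k' by simp_all
    note K' = transformationD[OF K]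
    have "wl (intcat C) p k = \<lparr>tsrc = ifun_cmp C p s, ttgt = ifun_cmp C p t, tcmp = i1 p \<cdot> k'\<rparr>"
      "wl (intcat C) q k = \<lparr>tsrc = ifun_cmp C q s, ttgt = ifun_cmp C q t, tcmp = i1 q \<cdot> k'\<rparr>"
      unfolding k' by (rule wl_intcat[OF K p(1,2)] wl_intcat[OF K q(1,2)])+
    then have eq: "ifun_cmp C p s = f" "ifun_cmp C p t = f'" "i1 p \<cdot> k' = a"
      "ifun_cmp C q s = g" "ifun_cmp C q t = g'" "i1 q \<cdot> k' = b"
      using k by simp_all
    \<comment> \<open>Uniqueness first fixes the boundary functors by the 1-dimensional property,
      then the component.\<close>
    have "s = h" using ex1 h eq K' by (auto simp: hom_iff)
    moreover have "t = h'" using ex1' h' eq K' by (auto simp: hom_iff)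
    moreover have "k' = c"
      by (rule product1_eq[OF P1]; use K' eq c in simp)
    ultimately show ?thesis by (simp add: k')
  qed
  ultimately show ?thesis by blast
qed

lemma product_intcat:
  assumes p: "internal_functor C p" "isrc p = P" "itgt p = A"
    and q: "internal_functor C q" "isrc q = P" "itgt q = B"
    and P0: "is_product1 C (I0 A) (I0 B) (I0 P) (i0 p) (i0 q)"
    and P1: "is_product1 C (I1 A) (I1 B) (I1 P) (i1 p) (i1 q)"
  shows "is_product (intcat C) A B P p q"
  unfolding is_product_def
proof (intro conjI ballI)
  show "P \<in> Ob (One (intcat C))" "p \<in> hom (One (intcat C)) P A" "q \<in> hom (One (intcat C)) P B"
    using internal_functor_simps(1)[OF p(1)] p q by (simp_all add: hom_iff)
next
  fix X f g assume "f \<in> hom (One (intcat C)) X A" "g \<in> hom (One (intcat C)) X B"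
  then show "\<exists>!h. h \<in> hom (One (intcat C)) X P \<and>
      Cmp (One (intcat C)) p h = f \<and> Cmp (One (intcat C)) q h = g"
    by (intro product_intcat_1[OF assms]) (simp_all add: hom_iff)
next
  fix X a b assume "a \<in> Ar (homcat (intcat C) X A)" "b \<in> Ar (homcat (intcat C) X B)"
  then have "\<exists>!c. c \<in> Ar (homcat (intcat C) X P) \<and>
      wl (intcat C) p c = \<lparr>tsrc = tsrc a, ttgt = ttgt a, tcmp = tcmp a\<rparr> \<and>
      wl (intcat C) q c = \<lparr>tsrc = tsrc b, ttgt = ttgt b, tcmp = tcmp b\<rparr>"
    by (intro product_intcat_2[OF assms]) (simp_all add: itrans_collapse)
  then show "\<exists>!c. c \<in> Ar (homcat (intcat C) X P) \<and> wl (intcat C) p c = a \<and> wl (intcat C) q c = b"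
    by (simp only: itrans_collapse)
qed

text \<open>Any two parallel maps into \<open>I0 T\<close> or \<open>I1 T\<close> coincide, so all
  functor equations hold at once. The only transformation is the identity of the only
  functor.\<close>

lemma terminal_intcat:
  assumes T: "internal_category C T"
    and 0: "\<And>X. X \<in> Ob C \<Longrightarrow> \<exists>!f. f \<in> hom C X (I0 T)"
    and 1: "\<And>X. X \<in> Ob C \<Longrightarrow> \<exists>!f. f \<in> hom C X (I1 T)"
  shows "is_terminal_object (intcat C) T"
proof -
  have u0: "f = g" if "f \<in> Ar C" "g \<in> Ar C" "Src C f = Src C g" "Tgt C f = I0 T" "Tgt C g = I0 T" for f g
    using that 0[of "Src C f"] by (auto simp: hom_iff)
  have u1: "f = g" if "f \<in> Ar C" "g \<in> Ar C" "Src C f = Src C g" "Tgt C f = I1 T" "Tgt C g = I1 T" for f g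
    using that 1[of "Src C f"] by (auto simp: hom_iff)
  have "\<exists>!f. f \<in> Ob (homcat (intcat C) X T)" "\<exists>!a. a \<in> Ar (homcat (intcat C) X T)"
    if X: "internal_category C X" for X
  proof -
    obtain f0 where f0: "f0 \<in> Ar C" "Src C f0 = I0 X" "Tgt C f0 = I0 T"
      using 0[of "I0 X"] X by (auto simp: hom_iff)
    obtain f1 where f1: "f1 \<in> Ar C" "Src C f1 = I1 X" "Tgt C f1 = I1 T"
      using 1[of "I1 X"] X by (auto simp: hom_iff)
    let ?f = "\<lparr>isrc = X, itgt = T, i0 = f0, i1 = f1\<rparr>"
    have d: "idom T \<cdot> f1 = f0 \<cdot> idom X" "icod T \<cdot> f1 = f0 \<cdot> icod X"
      by (rule u0; use X T f0 f1 in simp)+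
    have de: "idom T \<cdot> (f1 \<cdot> x) = f0 \<cdot> (idom X \<cdot> x)" "icod T \<cdot> (f1 \<cdot> x) = f0 \<cdot> (icod X \<cdot> x)"
      if "x \<in> Ar C" "Tgt C x = I1 X" for x
      using that X T f0 f1 Cmp_extend[OF d(1)] Cmp_extend[OF d(2)] by simp_all
    have i: "f1 \<cdot> iidn X = iidn T \<cdot> f0"
      by (rule u1; use X T f0 f1 in simp)
    have m: "f1 \<cdot> gcmp C X (isnd X) (ifst X) = gcmp C T (f1 \<cdot> isnd X) (f1 \<cdot> ifst X)"
      by (rule u1; use X T f0 f1 de in simp)
    have f: "internal_functor C ?f"
      using X T f0 f1 d i m by (intro internal_functorI) simp_all
    have uf: "g = ?f" if g: "internal_functor C g" "isrc g = X" "itgt g = T" for g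
    proof -
      have "i0 g = f0" by (rule u0; use g f0 X T in simp)
      moreover have "i1 g = f1" by (rule u1; use g f1 X T in simp)
      ultimately show ?thesis using g by (simp add: ifun_eq_iff)
    qed
    show "\<exists>!f. f \<in> Ob (homcat (intcat C) X T)"
    proof (rule ex1I)
      show "?f \<in> Ob (homcat (intcat C) X T)" using f by (simp add: hom_iff)
    qed (rule uf; simp add: hom_iff)
    let ?a = "\<lparr>tsrc = ?f, ttgt = ?f, tcmp = iidn T \<cdot> f0\<rparr>"
    have a: "internal_transformation C ?a"
      using internal_transformation_id[OF f] by simp
    show "\<exists>!a. a \<in> Ar (homcat (intcat C) X T)"
    proof (intro ex1I[of _ ?a])
      show "?a \<in> Ar (homcat (intcat C) X T)" using a by simp
      fix b assume b: "b \<in> Ar (homcat (intcat C) X T)"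
      then have b': "internal_transformation C b" "isrc (tsrc b) = X" "itgt (tsrc b) = T" by simp_all
      note bs = internal_transformation_simps[OF b'(1)]
      have "tsrc b = ?f" "ttgt b = ?f" using b' bs by (intro uf; simp)+
      moreover have "tcmp b = iidn T \<cdot> f0"
        by (rule u1; use bs b' X T f0 in simp)
      ultimately show "b = ?a" by simp
    qed
  qed
  then show ?thesis using T by (simp add: is_terminal_object_def)
qed

section \<open>Discrete internal categories\<close>

lemma idisc_simps [simp]:
  "I0 (idisc C X) = X" "I1 (idisc C X) = X" "I2 (idisc C X) = X"
  "idom (idisc C X) = Idn C X" "icod (idisc C X) = Idn C X" "iidn (idisc C X) = Idn C X"
  "ifst (idisc C X) = Idn C X" "isnd (idisc C X) = Idn C X" "icmp (idisc C X) = Idn C X"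
  by (simp_all add: idisc_def)

text \<open>In \<open>idisc C X\<close> a composable pair consists of equal members and is
  classified by that member itself.\<close>

lemma gcmp_idisc:
  assumes "f \<in> Ar C" "Tgt C f = X"
  shows "gcmp C (idisc C X) f f = f"
proof -
  have "(THE h. h \<in> hom C (Src C f) X \<and> Idn C X \<cdot> h = f \<and> Idn C X \<cdot> h = f) = f"
    using assms by (intro the_equality) (auto simp: hom_iff)
  then show ?thesis using assms unfolding gcmp_def by simp
qed

lemma internal_category_idisc:
  assumes X: "X \<in> Ob C"
  shows "internal_category C (idisc C X)"
proof -
  have "is_pullback C X (Idn C X) (Idn C X) (Idn C X) (Idn C X)"
    unfolding is_pullback_def using X by (auto simp: hom_iff intro: ex1I[of _ "_ :: 'a"])
  moreover have "f \<cdot> Idn C Y = f" "Idn C X \<cdot> f = f" if "f \<in> hom C Y X" for f Y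
    using that by (auto simp: hom_iff)
  ultimately show ?thesis
    unfolding internal_category_def using X gcmp_idisc by (auto simp: hom_iff)
qed

text \<open>Compatibility with composition reduces to the fact that an identity composed with itself
  is that identity.\<close>

lemma internal_functor_counit:
  assumes A: "internal_category C A"
  shows "internal_functor C \<lparr>isrc = idisc C (I0 A), itgt = A, i0 = Idn C (I0 A), i1 = iidn A\<rparr>"
    (is "internal_functor C ?F")
proof (intro internal_functorI)
  have "gcmp C A (iidn A) (iidn A) = iidn A"
    using gcmp_iidn(1)[OF A, of "iidn A"] A by simp
  then show "i1 ?F \<cdot> gcmp C (isrc ?F) (isnd (isrc ?F)) (ifst (isrc ?F)) =
      gcmp C (itgt ?F) (i1 ?F \<cdot> isnd (isrc ?F)) (i1 ?F \<cdot> ifst (isrc ?F))"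
    using A gcmp_idisc[of "Idn C (I0 A)" "I0 A"] by simp
qed (use A internal_category_idisc[of "I0 A"] in simp_all)

text \<open>The hypothesis on \<open>iidn B\<close> says that every arrow of \<open>B\<close> is an
  identity. If moreover \<open>e\<close> is invertible on objects, then \<open>B\<close> over
  \<open>A\<close> is a copy of the standard discrete part of \<open>A\<close> with its counit. It
  is applied to the image under \<open>E\<close> of a counit in \<open>W\<close>.\<close>

lemma discrete_internal_iso:
  assumes e: "internal_functor C e" "isrc e = B" "itgt e = A"
    and B: "iidn B \<cdot> idom B = Idn C (I1 B)"
    and v: "v \<in> hom C (I0 A) (I0 B)" "i0 e \<cdot> v = Idn C (I0 A)" "v \<cdot> i0 e = Idn C (I0 B)"
  defines "D \<equiv> idisc C (I0 A)"
  shows "\<exists>j j'. j \<in> hom (One (intcat C)) B D \<and> j' \<in> hom (One (intcat C)) D B \<and>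
    Cmp (One (intcat C)) j' j = Idn (One (intcat C)) B \<and>
    Cmp (One (intcat C)) j j' = Idn (One (intcat C)) D \<and>
    Cmp (One (intcat C)) \<lparr>isrc = D, itgt = A, i0 = Idn C (I0 A), i1 = iidn A\<rparr> j = e"
proof -
  have I: "internal_category C A" "internal_category C B"
    using internal_functor_simps(1,2)[OF e(1)] e by simp_all
  have D: "internal_category C D" unfolding D_def by (rule internal_category_idisc) (use I in simp)
  have Bx: "iidn B \<cdot> (idom B \<cdot> x) = x" if "x \<in> Ar C" "Tgt C x = I1 B" for x
    using that I Cmp_extend[OF B] by simp
  \<comment> \<open>Since \<open>iidn B\<close> inverts \<open>idom B\<close> and is also a section
    of \<open>icod B\<close>, one has
    \<open>icod B = icod B \<cdot> iidn B \<cdot> idom B = idom B\<close>.\<close>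
  have cod: "icod B = idom B"
    using Cmp_extend[OF B, of "Idn C (I1 B)"] I cod_iidn[OF I(2), of "idom B"] B by simp
  have v': "v \<in> Ar C" "Src C v = I0 A" "Tgt C v = I0 B" using v by (simp_all add: hom_iff)
  have gB: "gcmp C B x x = x" if x: "x \<in> Ar C" "Tgt C x = I1 B" for x
  proof -
    have "gcmp C B x (iidn B \<cdot> (idom B \<cdot> x)) = x" using x I by simp
    then show ?thesis using Bx[OF x] by simp
  qed
  \<comment> \<open>An arrow of \<open>B\<close> is recovered from its domain, and the members of a
    composable pair have the same domain because \<open>icod B = idom B\<close>.\<close>
  have "ifst B = isnd B"
  proof -
    have "iidn B \<cdot> (idom B \<cdot> ifst B) = iidn B \<cdot> (icod B \<cdot> ifst B)" by (simp add: cod)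
    also have "\<dots> = iidn B \<cdot> (idom B \<cdot> isnd B)" using I by simp
    finally show ?thesis using I Bx by simp
  qed
  \<comment> \<open>On arrows, \<open>?j\<close> takes the domain and applies \<open>e\<close>,
    because arrows of \<open>D\<close> are objects of \<open>A\<close>; \<open>?j'\<close> sends
    such an object to the identity arrow at its image under \<open>v\<close>.\<close>
  let ?j = "\<lparr>isrc = B, itgt = D, i0 = i0 e, i1 = i0 e \<cdot> idom B\<rparr>"
  let ?j' = "\<lparr>isrc = D, itgt = B, i0 = v, i1 = iidn B \<cdot> v\<rparr>"
  have "internal_functor C ?j"
  proof (intro internal_functorI)
    show "i1 ?j \<cdot> gcmp C (isrc ?j) (isnd (isrc ?j)) (ifst (isrc ?j)) =
        gcmp C (itgt ?j) (i1 ?j \<cdot> isnd (isrc ?j)) (i1 ?j \<cdot> ifst (isrc ?j))"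
      unfolding D_def using I e gB[of "isnd B"] gcmp_idisc[of "i0 e \<cdot> (idom B \<cdot> isnd B)" "I0 A"]
      by (simp add: \<open>ifst B = isnd B\<close>)
  qed (use I D e cod in \<open>simp_all add: D_def\<close>)
  moreover have "internal_functor C ?j'"
  proof (intro internal_functorI)
    show "i1 ?j' \<cdot> gcmp C (isrc ?j') (isnd (isrc ?j')) (ifst (isrc ?j')) =
        gcmp C (itgt ?j') (i1 ?j' \<cdot> isnd (isrc ?j')) (i1 ?j' \<cdot> ifst (isrc ?j'))"
      unfolding D_def using I v' gB[of "iidn B \<cdot> v"] gcmp_idisc[of "Idn C (I0 A)" "I0 A"]
      by simp
  qed (use I D v' cod in \<open>simp_all add: D_def\<close>)
  moreover have "ifun_cmp C ?j' ?j = Idn (One (intcat C)) B"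
    using I v v' e Cmp_extend[OF v(3), of "idom B"] B by (simp add: ifun_eq_iff)
  moreover have "ifun_cmp C ?j ?j' = Idn (One (intcat C)) D"
    using I v v' e by (simp add: ifun_eq_iff D_def)
  \<comment> \<open>As every arrow of \<open>B\<close> is an identity, \<open>i1 e\<close> is
    determined by \<open>i0 e\<close>, so \<open>e\<close> factors through the counit.\<close>
  moreover have "iidn A \<cdot> (i0 e \<cdot> idom B) = i1 e"
    using I e functor_iidn(2)[OF e(1,2), of "idom B"] B by simp
  then have "ifun_cmp C \<lparr>isrc = D, itgt = A, i0 = Idn C (I0 A), i1 = iidn A\<rparr> ?j = e"
    using I e by (simp add: ifun_eq_iff)
  ultimately show ?thesis
    by (intro exI[of _ ?j] exI[of _ ?j']) (simp add: hom_iff)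
qed

end

section \<open>Adjunctions and products in a 2-category\<close>

definition inverses :: "('o, 'm, 'c) twocat \<Rightarrow> 'm \<Rightarrow> 'm \<Rightarrow> bool" where
  "inverses W i i' \<longleftrightarrow> i \<in> Ar (One W) \<and> i' \<in> Ar (One W) \<and>
     Src (One W) i' = Tgt (One W) i \<and> Tgt (One W) i' = Src (One W) i \<and>
     Cmp (One W) i' i = Idn (One W) (Src (One W) i) \<and>
     Cmp (One W) i i' = Idn (One W) (Tgt (One W) i)"

context
  fixes W :: "('o, 'm, 'c) twocat"
  assumes tw: "twocategory W"
begin

abbreviation comp1 (infixr "\<cdot>" 70) where "comp1 \<equiv> Cmp (One W)"
abbreviation comp2 (infixr "\<bullet>" 65) where "comp2 \<equiv> Cmp (Two W)"
abbreviation whl (infixr "\<rhd>" 70) where "whl \<equiv> wl W"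
abbreviation whr (infixl "\<lhd>" 70) where "whr \<equiv> wr W"

lemma category_One [simp]: "category (One W)"
  and category_Two [simp]: "category (Two W)"
  and Ob_Two [simp]: "Ob (Two W) = Ar (One W)"
  using tw unfolding twocategory_def by simp_all

lemma src_tgt2 [simp]:
  assumes "a \<in> Ar (Two W)"
  shows "Src (One W) (Tgt (Two W) a) = Src (One W) (Src (Two W) a)"
    "Tgt (One W) (Tgt (Two W) a) = Tgt (One W) (Src (Two W) a)"
    "Src (Two W) a \<in> Ar (One W)" "Tgt (Two W) a \<in> Ar (One W)"
  using tw assms src_in_Ob[OF category_Two assms] tgt_in_Ob[OF category_Two assms]
  unfolding twocategory_def by (simp_all add: src0_def tgt0_def)

section \<open>Whiskering calculus\<close>

lemma HC_hom:
  assumes "a \<in> Ar (Two W)" "b \<in> Ar (Two W)" "Tgt (One W) (Src (Two W) a) = Src (One W) (Src (Two W) b)"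
  shows "HC W b a \<in> Ar (Two W)" "Src (Two W) (HC W b a) = Src (Two W) b \<cdot> Src (Two W) a"
    "Tgt (Two W) (HC W b a) = Tgt (Two W) b \<cdot> Tgt (Two W) a"
proof -
  have "\<forall>a\<in>Ar (Two W). \<forall>b\<in>Ar (Two W). tgt0 W a = src0 W b \<longrightarrow>
        HC W b a \<in> hom (Two W) (Cmp (One W) (Src (Two W) b) (Src (Two W) a))
                               (Cmp (One W) (Tgt (Two W) b) (Tgt (Two W) a))"
    using tw unfolding twocategory_def by (elim conjE)
  then have "HC W b a \<in> hom (Two W) (Src (Two W) b \<cdot> Src (Two W) a) (Tgt (Two W) b \<cdot> Tgt (Two W) a)"
    using assms by (simp add: src0_def tgt0_def)
  then show "HC W b a \<in> Ar (Two W)" "Src (Two W) (HC W b a) = Src (Two W) b \<cdot> Src (Two W) a"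
    "Tgt (Two W) (HC W b a) = Tgt (Two W) b \<cdot> Tgt (Two W) a"
    by (simp_all add: hom_iff)
qed

lemma HC_Idn [simp]:
  assumes "f \<in> Ar (One W)" "g \<in> Ar (One W)" "Tgt (One W) f = Src (One W) g"
  shows "g \<rhd> Idn (Two W) f = Idn (Two W) (g \<cdot> f)"
proof -
  have "\<forall>f\<in>Ar (One W). \<forall>g\<in>Ar (One W). Tgt (One W) f = Src (One W) g \<longrightarrow>
        HC W (Idn (Two W) g) (Idn (Two W) f) = Idn (Two W) (Cmp (One W) g f)"
    using tw unfolding twocategory_def by (elim conjE)
  then show ?thesis using assms by blast
qed

lemma interchange:
  assumes "a \<in> Ar (Two W)" "a' \<in> Ar (Two W)" "b \<in> Ar (Two W)" "b' \<in> Ar (Two W)"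
    "Tgt (One W) (Src (Two W) a) = Src (One W) (Src (Two W) b)"
    "Tgt (Two W) a = Src (Two W) a'" "Tgt (Two W) b = Src (Two W) b'"
  shows "HC W (b' \<bullet> b) (a' \<bullet> a) = HC W b' a' \<bullet> HC W b a"
proof -
  have "\<forall>a\<in>Ar (Two W). \<forall>a'\<in>Ar (Two W). \<forall>b\<in>Ar (Two W). \<forall>b'\<in>Ar (Two W).
        tgt0 W a = src0 W b \<longrightarrow> Tgt (Two W) a = Src (Two W) a' \<longrightarrow>
        Tgt (Two W) b = Src (Two W) b' \<longrightarrow>
        HC W (Cmp (Two W) b' b) (Cmp (Two W) a' a) =
        Cmp (Two W) (HC W b' a') (HC W b a)"
    using tw unfolding twocategory_def by (elim conjE)
  then show ?thesis using assms by (simp add: src0_def tgt0_def)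
qed

lemma HC_unit [simp]:
  assumes "a \<in> Ar (Two W)"
  shows "X = Src (One W) (Src (Two W) a) \<Longrightarrow> a \<lhd> Idn (One W) X = a"
    "Y = Tgt (One W) (Src (Two W) a) \<Longrightarrow> Idn (One W) Y \<rhd> a = a"
proof -
  have "\<forall>a\<in>Ar (Two W).
        HC W a (Idn (Two W) (Idn (One W) (src0 W a))) = a \<and>
        HC W (Idn (Two W) (Idn (One W) (tgt0 W a))) a = a"
    using tw unfolding twocategory_def by (elim conjE)
  then show "X = Src (One W) (Src (Two W) a) \<Longrightarrow> a \<lhd> Idn (One W) X = a"
    "Y = Tgt (One W) (Src (Two W) a) \<Longrightarrow> Idn (One W) Y \<rhd> a = a"
    using assms by (auto simp: src0_def tgt0_def)
qed

lemma HC_assoc: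
  assumes "a \<in> Ar (Two W)" "b \<in> Ar (Two W)" "c \<in> Ar (Two W)"
    "Tgt (One W) (Src (Two W) a) = Src (One W) (Src (Two W) b)"
    "Tgt (One W) (Src (Two W) b) = Src (One W) (Src (Two W) c)"
  shows "HC W (HC W c b) a = HC W c (HC W b a)"
proof -
  have "\<forall>a\<in>Ar (Two W). \<forall>b\<in>Ar (Two W). \<forall>c\<in>Ar (Two W).
        tgt0 W a = src0 W b \<longrightarrow> tgt0 W b = src0 W c \<longrightarrow>
        HC W (HC W c b) a = HC W c (HC W b a)"
    using tw unfolding twocategory_def by (elim conjE)
  then show ?thesis using assms by (simp add: src0_def tgt0_def)
qed

lemma wl_simps [simp]:
  assumes "a \<in> Ar (Two W)" "g \<in> Ar (One W)" "Tgt (One W) (Src (Two W) a) = Src (One W) g"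
  shows "g \<rhd> a \<in> Ar (Two W)" "Src (Two W) (g \<rhd> a) = g \<cdot> Src (Two W) a"
    "Tgt (Two W) (g \<rhd> a) = g \<cdot> Tgt (Two W) a"
  using HC_hom[of a "Idn (Two W) g"] assms by simp_all

lemma wr_simps [simp]:
  assumes "a \<in> Ar (Two W)" "f \<in> Ar (One W)" "Src (One W) (Src (Two W) a) = Tgt (One W) f"
  shows "a \<lhd> f \<in> Ar (Two W)" "Src (Two W) (a \<lhd> f) = Src (Two W) a \<cdot> f"
    "Tgt (Two W) (a \<lhd> f) = Tgt (Two W) a \<cdot> f"
  using HC_hom[of "Idn (Two W) f" a] assms by simp_all

lemma wl_wl:
  assumes "a \<in> Ar (Two W)" "f \<in> Ar (One W)" "g \<in> Ar (One W)"
    "Tgt (One W) (Src (Two W) a) = Src (One W) f" "Tgt (One W) f = Src (One W) g"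
  shows "g \<rhd> f \<rhd> a = (g \<cdot> f) \<rhd> a"
  using HC_assoc[of a "Idn (Two W) f" "Idn (Two W) g"] assms by simp

lemma wr_wr:
  assumes "a \<in> Ar (Two W)" "f \<in> Ar (One W)" "g \<in> Ar (One W)"
    "Src (One W) (Src (Two W) a) = Tgt (One W) f" "Src (One W) f = Tgt (One W) g"
  shows "(a \<lhd> f) \<lhd> g = a \<lhd> (f \<cdot> g)"
  using HC_assoc[of "Idn (Two W) g" "Idn (Two W) f" a] assms by simp

lemma wl_wr:
  assumes "a \<in> Ar (Two W)" "f \<in> Ar (One W)" "g \<in> Ar (One W)"
    "Src (One W) (Src (Two W) a) = Tgt (One W) f" "Tgt (One W) (Src (Two W) a) = Src (One W) g"
  shows "(g \<rhd> a) \<lhd> f = g \<rhd> (a \<lhd> f)"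
  using HC_assoc[of "Idn (Two W) f" a "Idn (Two W) g"] assms by simp

lemma wl_comp2:
  assumes "a \<in> Ar (Two W)" "b \<in> Ar (Two W)" "g \<in> Ar (One W)"
    "Tgt (One W) (Src (Two W) a) = Src (One W) g" "Tgt (Two W) a = Src (Two W) b"
  shows "g \<rhd> (b \<bullet> a) = (g \<rhd> b) \<bullet> (g \<rhd> a)"
  using interchange[of a b "Idn (Two W) g" "Idn (Two W) g"] assms by simp

lemma wr_comp2:
  assumes "a \<in> Ar (Two W)" "b \<in> Ar (Two W)" "f \<in> Ar (One W)"
    "Src (One W) (Src (Two W) a) = Tgt (One W) f" "Tgt (Two W) a = Src (Two W) b"
  shows "(b \<bullet> a) \<lhd> f = (b \<lhd> f) \<bullet> (a \<lhd> f)"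
  using interchange[of "Idn (Two W) f" "Idn (Two W) f" a b] assms by simp

section \<open>Invariance of adjunctions, products and diagonals under isomorphism\<close>

lemma inversesD:
  assumes "inverses W i i'"
  shows "i \<in> Ar (One W)" "i' \<in> Ar (One W)" "Src (One W) i' = Tgt (One W) i"
    "Tgt (One W) i' = Src (One W) i"
    "i' \<cdot> i = Idn (One W) (Src (One W) i)" "i \<cdot> i' = Idn (One W) (Tgt (One W) i)"
    "\<And>x. x \<in> Ar (One W) \<Longrightarrow> Tgt (One W) x = Src (One W) i \<Longrightarrow> i' \<cdot> (i \<cdot> x) = x"
    "\<And>x. x \<in> Ar (One W) \<Longrightarrow> Tgt (One W) x = Tgt (One W) i \<Longrightarrow> i \<cdot> (i' \<cdot> x) = x"
proof -
  show i: "i \<in> Ar (One W)" "i' \<in> Ar (One W)" "Src (One W) i' = Tgt (One W) i"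
    "Tgt (One W) i' = Src (One W) i"
    "i' \<cdot> i = Idn (One W) (Src (One W) i)" "i \<cdot> i' = Idn (One W) (Tgt (One W) i)"
    using assms unfolding inverses_def by simp_all
  show "i' \<cdot> (i \<cdot> x) = x" if "x \<in> Ar (One W)" "Tgt (One W) x = Src (One W) i" for x
    using Cmp_extend[OF category_One i(5)] i(1-4) that by simp
  show "i \<cdot> (i' \<cdot> x) = x" if "x \<in> Ar (One W)" "Tgt (One W) x = Tgt (One W) i" for x
    using Cmp_extend[OF category_One i(6)] i(1-4) that by simp
qed

lemma left_adjointE:
  assumes "left_adjoint W f g"
  obtains \<eta> \<epsilon> where "f \<in> Ar (One W)" "g \<in> Ar (One W)" "Src (One W) g = Tgt (One W) f"
    "Tgt (One W) g = Src (One W) f"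
    "\<eta> \<in> Ar (Two W)" "Src (Two W) \<eta> = Idn (One W) (Src (One W) f)" "Tgt (Two W) \<eta> = g \<cdot> f"
    "\<epsilon> \<in> Ar (Two W)" "Src (Two W) \<epsilon> = f \<cdot> g" "Tgt (Two W) \<epsilon> = Idn (One W) (Tgt (One W) f)"
    "(\<epsilon> \<lhd> f) \<bullet> (f \<rhd> \<eta>) = Idn (Two W) f" "(g \<rhd> \<epsilon>) \<bullet> (\<eta> \<lhd> g) = Idn (Two W) g"
  using assms unfolding left_adjoint_def hom_iff by (elim exE conjE) (rule that; simp)

lemma left_adjointI:
  assumes "f \<in> Ar (One W)" "g \<in> Ar (One W)" "Src (One W) g = Tgt (One W) f"
    "Tgt (One W) g = Src (One W) f"
    "\<eta> \<in> Ar (Two W)" "Src (Two W) \<eta> = Idn (One W) (Src (One W) f)" "Tgt (Two W) \<eta> = g \<cdot> f"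
    "\<epsilon> \<in> Ar (Two W)" "Src (Two W) \<epsilon> = f \<cdot> g" "Tgt (Two W) \<epsilon> = Idn (One W) (Tgt (One W) f)"
    "(\<epsilon> \<lhd> f) \<bullet> (f \<rhd> \<eta>) = Idn (Two W) f" "(g \<rhd> \<epsilon>) \<bullet> (\<eta> \<lhd> g) = Idn (Two W) g"
  shows "left_adjoint W f g"
  using assms unfolding left_adjoint_def hom_iff by blast

text \<open>Since \<open>(g \<cdot> i') \<cdot> (i \<cdot> f) = g \<cdot> f\<close>, the old unit
  still serves; the counit is conjugated by \<open>i\<close>. The triangle identities are the old
  ones whiskered by \<open>i\<close> on the left and by \<open>i'\<close> on the right.\<close>

lemma left_adjoint_iso_tgt:
  assumes fg: "left_adjoint W f g" and i: "inverses W i i'" "Src (One W) i = Tgt (One W) f"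
  shows "left_adjoint W (i \<cdot> f) (g \<cdot> i')"
proof -
  obtain \<eta> \<epsilon> where a: "f \<in> Ar (One W)" "g \<in> Ar (One W)" "Src (One W) g = Tgt (One W) f"
    "Tgt (One W) g = Src (One W) f"
    "\<eta> \<in> Ar (Two W)" "Src (Two W) \<eta> = Idn (One W) (Src (One W) f)" "Tgt (Two W) \<eta> = g \<cdot> f"
    "\<epsilon> \<in> Ar (Two W)" "Src (Two W) \<epsilon> = f \<cdot> g" "Tgt (Two W) \<epsilon> = Idn (One W) (Tgt (One W) f)"
    and t: "(\<epsilon> \<lhd> f) \<bullet> (f \<rhd> \<eta>) = Idn (Two W) f" "(g \<rhd> \<epsilon>) \<bullet> (\<eta> \<lhd> g) = Idn (Two W) g"
    by (rule left_adjointE[OF fg])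
  note i' = inversesD[OF i(1)]
  show ?thesis
  proof (rule left_adjointI[where \<eta> = \<eta> and \<epsilon> = "i \<rhd> (\<epsilon> \<lhd> i')"])
    have "((i \<rhd> (\<epsilon> \<lhd> i')) \<lhd> (i \<cdot> f)) \<bullet> ((i \<cdot> f) \<rhd> \<eta>) = (i \<rhd> (\<epsilon> \<lhd> f)) \<bullet> (i \<rhd> (f \<rhd> \<eta>))"
      using a i i' by (simp add: wl_wr wr_wr wl_wl)
    also have "\<dots> = i \<rhd> ((\<epsilon> \<lhd> f) \<bullet> (f \<rhd> \<eta>))"
      using a i i' by (simp add: wl_comp2)
    finally show "((i \<rhd> (\<epsilon> \<lhd> i')) \<lhd> (i \<cdot> f)) \<bullet> ((i \<cdot> f) \<rhd> \<eta>) = Idn (Two W) (i \<cdot> f)"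
      using a i i' t by simp
    have "((g \<cdot> i') \<rhd> (i \<rhd> (\<epsilon> \<lhd> i'))) \<bullet> (\<eta> \<lhd> (g \<cdot> i')) = ((g \<rhd> \<epsilon>) \<lhd> i') \<bullet> ((\<eta> \<lhd> g) \<lhd> i')"
      using a i i' by (simp add: wl_wr wr_wr wl_wl)
    also have "\<dots> = ((g \<rhd> \<epsilon>) \<bullet> (\<eta> \<lhd> g)) \<lhd> i'"
      using a i i' by (simp add: wr_comp2)
    finally show "((g \<cdot> i') \<rhd> (i \<rhd> (\<epsilon> \<lhd> i'))) \<bullet> (\<eta> \<lhd> (g \<cdot> i')) = Idn (Two W) (g \<cdot> i')"
      using a i i' t by simp
  qed (use a i i' in simp_all)
qed

text \<open>Here the counit stays, because
  \<open>(f \<cdot> i') \<cdot> (i \<cdot> g) = f \<cdot> g\<close>, and the unit is conjugated by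
  \<open>i\<close>.\<close>

lemma left_adjoint_iso_src:
  assumes fg: "left_adjoint W f g" and i: "inverses W i i'" "Src (One W) i = Src (One W) f"
  shows "left_adjoint W (f \<cdot> i') (i \<cdot> g)"
proof -
  obtain \<eta> \<epsilon> where a: "f \<in> Ar (One W)" "g \<in> Ar (One W)" "Src (One W) g = Tgt (One W) f"
    "Tgt (One W) g = Src (One W) f"
    "\<eta> \<in> Ar (Two W)" "Src (Two W) \<eta> = Idn (One W) (Src (One W) f)" "Tgt (Two W) \<eta> = g \<cdot> f"
    "\<epsilon> \<in> Ar (Two W)" "Src (Two W) \<epsilon> = f \<cdot> g" "Tgt (Two W) \<epsilon> = Idn (One W) (Tgt (One W) f)"
    and t: "(\<epsilon> \<lhd> f) \<bullet> (f \<rhd> \<eta>) = Idn (Two W) f" "(g \<rhd> \<epsilon>) \<bullet> (\<eta> \<lhd> g) = Idn (Two W) g"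
    by (rule left_adjointE[OF fg])
  note i' = inversesD[OF i(1)]
  show ?thesis
  proof (rule left_adjointI[where \<eta> = "i \<rhd> (\<eta> \<lhd> i')" and \<epsilon> = \<epsilon>])
    have "(\<epsilon> \<lhd> (f \<cdot> i')) \<bullet> ((f \<cdot> i') \<rhd> (i \<rhd> (\<eta> \<lhd> i'))) = ((\<epsilon> \<lhd> f) \<lhd> i') \<bullet> ((f \<rhd> \<eta>) \<lhd> i')"
      using a i i' by (simp add: wl_wr wr_wr wl_wl)
    also have "\<dots> = ((\<epsilon> \<lhd> f) \<bullet> (f \<rhd> \<eta>)) \<lhd> i'"
      using a i i' by (simp add: wr_comp2)
    finally show "(\<epsilon> \<lhd> (f \<cdot> i')) \<bullet> ((f \<cdot> i') \<rhd> (i \<rhd> (\<eta> \<lhd> i'))) = Idn (Two W) (f \<cdot> i')"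
      using a i i' t by simp
    have "((i \<cdot> g) \<rhd> \<epsilon>) \<bullet> ((i \<rhd> (\<eta> \<lhd> i')) \<lhd> (i \<cdot> g)) = (i \<rhd> (g \<rhd> \<epsilon>)) \<bullet> (i \<rhd> (\<eta> \<lhd> g))"
      using a i i' by (simp add: wl_wr wr_wr wl_wl)
    also have "\<dots> = i \<rhd> ((g \<rhd> \<epsilon>) \<bullet> (\<eta> \<lhd> g))"
      using a i i' by (simp add: wl_comp2)
    finally show "((i \<cdot> g) \<rhd> \<epsilon>) \<bullet> ((i \<rhd> (\<eta> \<lhd> i')) \<lhd> (i \<cdot> g)) = Idn (Two W) (i \<cdot> g)"
      using a i i' t by simp
  qed (use a i i' in simp_all)
qed

lemma terminal_unique1:
  assumes "is_terminal_object W T" "f \<in> hom (One W) X T" "g \<in> hom (One W) X T"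
  shows "f = g"
proof -
  have "X \<in> Ob (One W)" using assms(2) by (auto simp: hom_iff)
  then show ?thesis using assms unfolding is_terminal_object_def by auto
qed

lemma terminal_iso:
  assumes T: "is_terminal_object W T" and T': "is_terminal_object W T'"
  obtains i i' where "inverses W i i'" "i \<in> hom (One W) T T'"
proof -
  have o: "T \<in> Ob (One W)" "T' \<in> Ob (One W)" using T T' unfolding is_terminal_object_def by auto
  then obtain i i' where i: "i \<in> hom (One W) T T'" "i' \<in> hom (One W) T' T"
    using T T' unfolding is_terminal_object_def by (auto simp del: Ex1_def) metis
  have "i' \<cdot> i = Idn (One W) T" "i \<cdot> i' = Idn (One W) T'"
    by (rule terminal_unique1[OF T] terminal_unique1[OF T']; use i o in \<open>simp add: hom_iff\<close>)+
  then show ?thesis using i that[of i i'] by (simp add: inverses_def hom_iff)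
qed

lemma product_typing:
  assumes "is_product W A B P p q"
  shows "p \<in> Ar (One W)" "Src (One W) p = P" "Tgt (One W) p = A"
    "q \<in> Ar (One W)" "Src (One W) q = P" "Tgt (One W) q = B"
    "P \<in> Ob (One W)" "A \<in> Ob (One W)" "B \<in> Ob (One W)"
  using assms unfolding is_product_def hom_iff by auto

lemma product_obtain:
  assumes P: "is_product W A B P p q" and f: "f \<in> Ar (One W)" "g \<in> Ar (One W)"
    "Src (One W) f = Src (One W) g" "Tgt (One W) f = A" "Tgt (One W) g = B"
  obtains h where "h \<in> Ar (One W)" "Src (One W) h = Src (One W) f" "Tgt (One W) h = P"
    "p \<cdot> h = f" "q \<cdot> h = g"
proof -
  have "Src (One W) f \<in> Ob (One W)" "f \<in> hom (One W) (Src (One W) f) A"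
    "g \<in> hom (One W) (Src (One W) f) B"
    using f by (simp_all add: hom_iff)
  then have "\<exists>!h. h \<in> hom (One W) (Src (One W) f) P \<and> p \<cdot> h = f \<and> q \<cdot> h = g"
    using P unfolding is_product_def by blast
  then show ?thesis using that by (auto simp: hom_iff)
qed

lemma product_eq:
  assumes P: "is_product W A B P p q" and hk: "h \<in> Ar (One W)" "k \<in> Ar (One W)"
    "Src (One W) h = Src (One W) k" "Tgt (One W) h = P" "Tgt (One W) k = P"
    and e: "p \<cdot> h = p \<cdot> k" "q \<cdot> h = q \<cdot> k"
  shows "h = k"
proof -
  have X: "Src (One W) h \<in> Ob (One W)" "p \<cdot> h \<in> hom (One W) (Src (One W) h) A"
    "q \<cdot> h \<in> hom (One W) (Src (One W) h) B"
    "h \<in> hom (One W) (Src (One W) h) P" "k \<in> hom (One W) (Src (One W) h) P"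
    using hk product_typing[OF P] by (simp_all add: hom_iff)
  then have "\<exists>!l. l \<in> hom (One W) (Src (One W) h) P \<and> p \<cdot> l = p \<cdot> h \<and> q \<cdot> l = q \<cdot> h"
    using P unfolding is_product_def by blast
  then show ?thesis using e X by metis
qed

lemma ext_eq:
  assumes "g \<cdot> f = k" "f \<in> Ar (One W)" "g \<in> Ar (One W)" "Tgt (One W) f = Src (One W) g"
  shows "\<And>x. x \<in> Ar (One W) \<Longrightarrow> Tgt (One W) x = Src (One W) f \<Longrightarrow> g \<cdot> (f \<cdot> x) = k \<cdot> x"
  using Cmp_extend[OF category_One] assms by blast

text \<open>The second factor may vary along an isomorphism: for closed products it is the discrete
  part, which is known in the target only up to isomorphism.\<close>

lemma product_iso:
  assumes P: "is_product W A B P p q" and P': "is_product W A B' P' p' q'"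
    and j: "inverses W j j'" "Src (One W) j = B" "Tgt (One W) j = B'"
  obtains i i' where "inverses W i i'" "i \<in> hom (One W) P P'" "p' \<cdot> i = p" "q' \<cdot> i = j \<cdot> q"
    "p \<cdot> i' = p'" "q \<cdot> i' = j' \<cdot> q'"
proof -
  note t = product_typing[OF P] product_typing[OF P'] inversesD[OF j(1)] j(2,3)
  obtain i where i: "i \<in> Ar (One W)" "Src (One W) i = P" "Tgt (One W) i = P'" "p' \<cdot> i = p"
    "q' \<cdot> i = j \<cdot> q"
    using product_obtain[OF P', of p "j \<cdot> q"] t by auto
  obtain i' where i': "i' \<in> Ar (One W)" "Src (One W) i' = P'" "Tgt (One W) i' = P" "p \<cdot> i' = p'"
    "q \<cdot> i' = j' \<cdot> q'"
    using product_obtain[OF P, of p' "j' \<cdot> q'"] t by auto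
  note x = ext_eq[OF i(4)] ext_eq[OF i(5)] ext_eq[OF i'(4)] ext_eq[OF i'(5)]
  have "i' \<cdot> i = Idn (One W) P"
    by (rule product_eq[OF P]; use t i i' x in simp)
  moreover have "i \<cdot> i' = Idn (One W) P'"
    by (rule product_eq[OF P']; use t i i' x in simp)
  ultimately show ?thesis
    using that[of i i'] i i' by (simp add: inverses_def hom_iff)
qed

lemma inverses_Idn: "B \<in> Ob (One W) \<Longrightarrow> inverses W (Idn (One W) B) (Idn (One W) B)"
  by (simp add: inverses_def)

lemma product_iso':
  assumes P: "is_product W A B P p q" and P': "is_product W A B P' p' q'"
  obtains i i' where "inverses W i i'" "i \<in> hom (One W) P P'" "p' \<cdot> i = p" "q' \<cdot> i = q"
    "p \<cdot> i' = p'" "q \<cdot> i' = q'"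
  using product_iso[OF assms inverses_Idn] product_typing[OF P] product_typing[OF P'] by auto

text \<open>The product object is kept and the isomorphism is absorbed into the second projection.
  In this way the image of a product with the discrete part becomes a product with the standard
  discrete part.\<close>

lemma product_change_iso:
  assumes P: "is_product W A B P p q" and j: "inverses W j j'" "Src (One W) j = B" "Tgt (One W) j = B'"
  shows "is_product W A B' P p (j \<cdot> q)"
  unfolding is_product_def
proof (intro conjI ballI)
  note t = product_typing[OF P] inversesD[OF j(1)] j(2,3)
  show "P \<in> Ob (One W)" "p \<in> hom (One W) P A" "j \<cdot> q \<in> hom (One W) P B'"
    using t by (simp_all add: hom_iff)
  fix X assume X: "X \<in> Ob (One W)"
  {
    fix f g assume "f \<in> hom (One W) X A" "g \<in> hom (One W) X B'"
    then have f: "f \<in> Ar (One W)" "Src (One W) f = X" "Tgt (One W) f = A"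
      "g \<in> Ar (One W)" "Src (One W) g = X" "Tgt (One W) g = B'" by (simp_all add: hom_iff)
    have "j' \<cdot> g \<in> hom (One W) X B" "f \<in> hom (One W) X A" using f t by (simp_all add: hom_iff)
    then have ex: "\<exists>!h. h \<in> hom (One W) X P \<and> p \<cdot> h = f \<and> q \<cdot> h = j' \<cdot> g"
      using P X unfolding is_product_def by blast
    \<comment> \<open>Composition with \<open>j\<close> and \<open>j'\<close> makes the two
      conditions on \<open>h\<close> equivalent, so unique existence carries over.\<close>
    have "(q \<cdot> h = j' \<cdot> g) = ((j \<cdot> q) \<cdot> h = g)" if h: "h \<in> hom (One W) X P" for h
    proof
      have h': "h \<in> Ar (One W)" "Tgt (One W) h = P" using h by (simp_all add: hom_iff)
      show "(j \<cdot> q) \<cdot> h = g" if "q \<cdot> h = j' \<cdot> g" using that h' t f by simp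
      show "q \<cdot> h = j' \<cdot> g" if e: "(j \<cdot> q) \<cdot> h = g" using t h' f by (simp flip: e)
    qed
    then show "\<exists>!h. h \<in> hom (One W) X P \<and> p \<cdot> h = f \<and> (j \<cdot> q) \<cdot> h = g"
      using ex by (metis (no_types, lifting))
  next
    fix a b assume a: "a \<in> Ar (homcat W X A)" and "b \<in> Ar (homcat W X B')"
    then have b: "b \<in> Ar (Two W)" "Src (One W) (Src (Two W) b) = X" "Tgt (One W) (Src (Two W) b) = B'"
      by (simp_all add: src0_def tgt0_def)
    have "j' \<rhd> b \<in> Ar (homcat W X B)" using b t by (simp add: src0_def tgt0_def)
    then have ex: "\<exists>!c. c \<in> Ar (homcat W X P) \<and> p \<rhd> c = a \<and> q \<rhd> c = j' \<rhd> b"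
      using a P X unfolding is_product_def by blast
    have "(q \<rhd> c = j' \<rhd> b) = ((j \<cdot> q) \<rhd> c = b)" if c: "c \<in> Ar (homcat W X P)" for c
    proof
      have c': "c \<in> Ar (Two W)" "Tgt (One W) (Src (Two W) c) = P"
        using c by (simp_all add: src0_def tgt0_def)
      have qc: "(j \<cdot> q) \<rhd> c = j \<rhd> q \<rhd> c" "j' \<rhd> (j \<cdot> q) \<rhd> c = q \<rhd> c"
        using c' t by (simp_all add: wl_wl)
      show "(j \<cdot> q) \<rhd> c = b" if "q \<rhd> c = j' \<rhd> b" using that t b by (simp add: qc wl_wl)
      show "q \<rhd> c = j' \<rhd> b" if e: "(j \<cdot> q) \<rhd> c = b" using qc(2) by (simp add: e)
    qed
    then show "\<exists>!c. c \<in> Ar (homcat W X P) \<and> p \<rhd> c = a \<and> (j \<cdot> q) \<rhd> c = b"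
      using ex by (metis (no_types, lifting))
  }
qed

text \<open>Both 1-cells have identities as projections from \<open>P'\<close>, and these determine
  a 1-cell into the product.\<close>

lemma diagonal_transport:
  assumes P: "is_product W A A P p q" "is_diagonal W A P p q \<delta>"
    and P': "is_product W A A P' p' q'" "is_diagonal W A P' p' q' \<delta>'"
    and i: "inverses W i i'" "i \<in> hom (One W) P P'" "p' \<cdot> i = p" "q' \<cdot> i = q"
  shows "\<delta>' = i \<cdot> \<delta>"
proof -
  note t = product_typing[OF P(1)] product_typing[OF P'(1)] inversesD[OF i(1)] i(2-4)
  note d = P(2)[unfolded is_diagonal_def hom_iff] P'(2)[unfolded is_diagonal_def hom_iff]
  have "i \<in> Ar (One W)" "Src (One W) i = P" "Tgt (One W) i = P'" using i(2) by (simp_all add: hom_iff)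
  note i = i this
  show ?thesis
    by (rule product_eq[OF P'(1)]) (simp_all add: i(5-) t d ext_eq[OF i(3)] ext_eq[OF i(4)])
qed

text \<open>The 1-cell whose right adjoint defines closed products is built from chosen products and
  from \<open>t\<close>. With another choice, primed here, it becomes the conjugate of
  \<open>m\<close> by the isomorphism \<open>j\<close> between the two products with the discrete
  part, so adjoints pass over.\<close>

lemma closed_transport:
  assumes P: "is_product W A A P p q" and P': "is_product W A A P' p' q'"
    and i: "inverses W i i'" "i \<in> hom (One W) P P'" "p' \<cdot> i = p" "q' \<cdot> i = q"
      "p \<cdot> i' = p'" "q \<cdot> i' = q'"
    and t: "t \<in> hom (One W) P A"
    and R: "is_product W A D R r s" and R': "is_product W A D' R' r' s'"
    and j0: "inverses W j0 j0'" "j0 \<in> hom (One W) D' D" and e: "e \<in> hom (One W) D A" "e \<cdot> j0 = e'"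
    and k: "k \<in> hom (One W) R P" "p \<cdot> k = r" "q \<cdot> k = e \<cdot> s"
    and m: "m \<in> hom (One W) R R" "r \<cdot> m = t \<cdot> k" "s \<cdot> m = s"
    and k': "k' \<in> hom (One W) R' P'" "p' \<cdot> k' = r'" "q' \<cdot> k' = e' \<cdot> s'"
    and m': "m' \<in> hom (One W) R' R'" "r' \<cdot> m' = (t \<cdot> i') \<cdot> k'" "s' \<cdot> m' = s'"
    and n: "left_adjoint W m n"
  shows "\<exists>n'. left_adjoint W m' n'"
proof -
  \<comment> \<open>The product comparison runs from \<open>R\<close> to \<open>R'\<close>, hence
    needs the isomorphism from \<open>D\<close> to \<open>D'\<close>.\<close>
  have inv: "inverses W j0' j0" using inversesD[OF j0(1)] unfolding inverses_def by simp
  have j0h: "Src (One W) j0 = D'" "Tgt (One W) j0 = D" using j0(2) by (simp_all add: hom_iff)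
  note J0 = inversesD[OF j0(1), unfolded j0h] j0h
  obtain j j' where j: "inverses W j j'" "j \<in> hom (One W) R R'" "r' \<cdot> j = r" "s' \<cdot> j = j0' \<cdot> s"
    "r \<cdot> j' = r'" "s \<cdot> j' = j0 \<cdot> s'"
    using product_iso[OF R R' inv] J0 by auto
  have jh: "Src (One W) j = R" "Tgt (One W) j = R'" using j(2) by (simp_all add: hom_iff)
  have ih: "Src (One W) i = P" "Tgt (One W) i = P'" using i(2) by (simp_all add: hom_iff)
  note J = inversesD[OF j(1), unfolded jh] jh and I = inversesD[OF i(1), unfolded ih] ih
  have h: "t \<in> Ar (One W)" "Src (One W) t = P" "Tgt (One W) t = A"
    "e \<in> Ar (One W)" "Src (One W) e = D" "Tgt (One W) e = A"
    "k \<in> Ar (One W)" "Src (One W) k = R" "Tgt (One W) k = P"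
    "k' \<in> Ar (One W)" "Src (One W) k' = R'" "Tgt (One W) k' = P'"
    "m \<in> Ar (One W)" "Src (One W) m = R" "Tgt (One W) m = R"
    "m' \<in> Ar (One W)" "Src (One W) m' = R'" "Tgt (One W) m' = R'"
    using t e k k' m m' by (simp_all add: hom_iff)
  note ty = product_typing[OF P] product_typing[OF P'] product_typing[OF R] product_typing[OF
      R'] J0 J I h
  \<comment> \<open>The two versions of the product of the identity with the counit correspond under
    the comparison isomorphisms, since they have the same projections.\<close>
  have kk: "i' \<cdot> k' = k \<cdot> j'"
  proof (rule product_eq[OF P])
    have "p \<cdot> (i' \<cdot> k') = p' \<cdot> k'" by (simp add: ext_eq[OF i(5)] ty)
    also have "\<dots> = p \<cdot> (k \<cdot> j')" by (simp add: ext_eq[OF k(2)] k'(2) j(5) ty)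
    finally show "p \<cdot> (i' \<cdot> k') = p \<cdot> (k \<cdot> j')" .
    have "q \<cdot> (i' \<cdot> k') = q' \<cdot> k'" by (simp add: ext_eq[OF i(6)] ty)
    also have "\<dots> = e \<cdot> (j0 \<cdot> s')" by (simp add: ext_eq[OF e(2)] k'(3) ty)
    also have "\<dots> = (e \<cdot> s) \<cdot> j'" by (simp add: j(6) ty)
    also have "\<dots> = q \<cdot> (k \<cdot> j')" by (simp add: ext_eq[OF k(3)] ty)
    finally show "q \<cdot> (i' \<cdot> k') = q \<cdot> (k \<cdot> j')" .
  qed (simp_all add: ty)
  \<comment> \<open>Tested after \<open>r'\<close> and \<open>s'\<close>: the first projection
    reduces to \<open>kk\<close>, the second to \<open>s \<cdot> m = s\<close>.\<close>
  have "m' = (j \<cdot> m) \<cdot> j'"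
  proof (rule product_eq[OF R'])
    have "r' \<cdot> ((j \<cdot> m) \<cdot> j') = (r \<cdot> m) \<cdot> j'" by (simp add: ext_eq[OF j(3)] ty)
    also have "\<dots> = t \<cdot> (i' \<cdot> k')" by (simp add: m(2) kk ty)
    finally show "r' \<cdot> m' = r' \<cdot> ((j \<cdot> m) \<cdot> j')" by (simp add: m'(2) ty)
    have "s' \<cdot> ((j \<cdot> m) \<cdot> j') = (j0' \<cdot> s) \<cdot> (m \<cdot> j')" by (simp add: ext_eq[OF j(4)] ty)
    also have "\<dots> = j0' \<cdot> (s \<cdot> j')" by (simp add: ext_eq[OF m(3)] ty)
    also have "\<dots> = s'" by (simp add: j(6) ty)
    finally show "s' \<cdot> m' = s' \<cdot> ((j \<cdot> m) \<cdot> j')" using m' by simp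
  qed (simp_all add: ty)
  moreover have "left_adjoint W ((j \<cdot> m) \<cdot> j') (j \<cdot> (n \<cdot> j'))"
    using left_adjoint_iso_src[OF left_adjoint_iso_tgt[OF n j(1)] j(1)] by (simp add: ty)
  ultimately show ?thesis by blast
qed

end

section \<open>2-functors\<close>

lemma is_functorD:
  assumes "is_functor C D F"
  shows "\<And>X. X \<in> Ob C \<Longrightarrow> FO F X \<in> Ob D"
    "\<And>f. f \<in> Ar C \<Longrightarrow> FA F f \<in> Ar D"
    "\<And>f. f \<in> Ar C \<Longrightarrow> Src D (FA F f) = FO F (Src C f)"
    "\<And>f. f \<in> Ar C \<Longrightarrow> Tgt D (FA F f) = FO F (Tgt C f)"
    "\<And>X. X \<in> Ob C \<Longrightarrow> FA F (Idn C X) = Idn D (FO F X)"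
    "\<And>f g. f \<in> Ar C \<Longrightarrow> g \<in> Ar C \<Longrightarrow> Tgt C f = Src C g \<Longrightarrow>
      FA F (Cmp C g f) = Cmp D (FA F g) (FA F f)"
  using assms unfolding is_functor_def by (simp_all add: hom_iff)

text \<open>This is 2-full faithfulness; it is what density of the discrete objects yields for
  \<open>E\<close>.\<close>

definition locally_iso ::
  "('o, 'm, 'c) twocat \<Rightarrow> ('p, 'n, 'd) twocat \<Rightarrow> ('o, 'm, 'c, 'p, 'n, 'd) twofun \<Rightarrow> bool" where
  "locally_iso W V G \<longleftrightarrow> (\<forall>A\<in>Ob (One W). \<forall>B\<in>Ob (One W).
     iso_functor (homcat W A B) (homcat V (T0 G A) (T0 G B)) \<lparr>FO = T1 G, FA = T2 G\<rparr>)"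

context
  fixes W :: "('o, 'm, 'c) twocat" and V :: "('p, 'n, 'd) twocat"
    and G :: "('o, 'm, 'c, 'p, 'n, 'd) twofun"
  assumes W: "twocategory W" and V: "twocategory V" and G: "is_2functor W V G"
begin

lemma underlying_functors:
  "is_functor (One W) (One V) \<lparr>FO = T0 G, FA = T1 G\<rparr>"
  "is_functor (Two W) (Two V) \<lparr>FO = T1 G, FA = T2 G\<rparr>"
  using G unfolding is_2functor_def by blast+

lemma twofunctor_simps:
  "\<And>X. X \<in> Ob (One W) \<Longrightarrow> T0 G X \<in> Ob (One V)"
  "\<And>f. f \<in> Ar (One W) \<Longrightarrow> T1 G f \<in> Ar (One V)"
  "\<And>f. f \<in> Ar (One W) \<Longrightarrow> Src (One V) (T1 G f) = T0 G (Src (One W) f)"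
  "\<And>f. f \<in> Ar (One W) \<Longrightarrow> Tgt (One V) (T1 G f) = T0 G (Tgt (One W) f)"
  "\<And>X. X \<in> Ob (One W) \<Longrightarrow> T1 G (Idn (One W) X) = Idn (One V) (T0 G X)"
  "\<And>f g. f \<in> Ar (One W) \<Longrightarrow> g \<in> Ar (One W) \<Longrightarrow> Tgt (One W) f = Src (One W) g \<Longrightarrow>
    T1 G (Cmp (One W) g f) = Cmp (One V) (T1 G g) (T1 G f)"
  "\<And>a. a \<in> Ar (Two W) \<Longrightarrow> T2 G a \<in> Ar (Two V)"
  "\<And>a. a \<in> Ar (Two W) \<Longrightarrow> Src (Two V) (T2 G a) = T1 G (Src (Two W) a)"
  "\<And>a. a \<in> Ar (Two W) \<Longrightarrow> Tgt (Two V) (T2 G a) = T1 G (Tgt (Two W) a)"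
  "\<And>f. f \<in> Ar (One W) \<Longrightarrow> T2 G (Idn (Two W) f) = Idn (Two V) (T1 G f)"
  "\<And>a b. a \<in> Ar (Two W) \<Longrightarrow> b \<in> Ar (Two W) \<Longrightarrow> Tgt (Two W) a = Src (Two W) b \<Longrightarrow>
    T2 G (Cmp (Two W) b a) = Cmp (Two V) (T2 G b) (T2 G a)"
  "\<And>a b. a \<in> Ar (Two W) \<Longrightarrow> b \<in> Ar (Two W) \<Longrightarrow>
    Tgt (One W) (Src (Two W) a) = Src (One W) (Src (Two W) b) \<Longrightarrow>
    T2 G (HC W b a) = HC V (T2 G b) (T2 G a)"
proof -
  show "T2 G (HC W b a) = HC V (T2 G b) (T2 G a)" if "a \<in> Ar (Two W)" "b \<in> Ar (Two W)"
    "Tgt (One W) (Src (Two W) a) = Src (One W) (Src (Two W) b)" for a b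
    using G that unfolding is_2functor_def by (simp add: src0_def tgt0_def)
qed (use is_functorD[OF underlying_functors(1)] is_functorD[OF underlying_functors(2)] W
    in simp_all)

lemma twofunctor_hom: "f \<in> hom (One W) A B \<Longrightarrow> T1 G f \<in> hom (One V) (T0 G A) (T0 G B)"
  by (auto simp: hom_iff twofunctor_simps)

lemma twofunctor_comp:
  "f \<in> hom (One W) A B \<Longrightarrow> g \<in> hom (One W) B D \<Longrightarrow> Cmp (One W) g f = k \<Longrightarrow>
    Cmp (One V) (T1 G g) (T1 G f) = T1 G k"
  by (auto simp: hom_iff twofunctor_simps)

lemma left_adjoint_preserved:
  assumes "left_adjoint W f g"
  shows "left_adjoint V (T1 G f) (T1 G g)"
proof -
  obtain \<eta> \<epsilon> where a: "f \<in> Ar (One W)" "g \<in> Ar (One W)" "Src (One W) g = Tgt (One W) f"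
    "Tgt (One W) g = Src (One W) f"
    "\<eta> \<in> Ar (Two W)" "Src (Two W) \<eta> = Idn (One W) (Src (One W) f)" "Tgt (Two W) \<eta> = Cmp (One W) g f"
    "\<epsilon> \<in> Ar (Two W)" "Src (Two W) \<epsilon> = Cmp (One W) f g" "Tgt (Two W) \<epsilon> = Idn (One W) (Tgt (One W) f)"
    and t: "Cmp (Two W) (wr W \<epsilon> f) (wl W f \<eta>) = Idn (Two W) f"
      "Cmp (Two W) (wl W g \<epsilon>) (wr W \<eta> g) = Idn (Two W) g"
    by (rule left_adjointE[OF W assms])
  note tf = twofunctor_simps
  show ?thesis
  proof (rule left_adjointI[OF V, where \<eta> = "T2 G \<eta>" and \<epsilon> = "T2 G \<epsilon>"])
    have "Cmp (Two V) (wr V (T2 G \<epsilon>) (T1 G f)) (wl V (T1 G f) (T2 G \<eta>)) =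
        T2 G (Cmp (Two W) (wr W \<epsilon> f) (wl W f \<eta>))"
      using a W by (simp add: tf)
    then show "Cmp (Two V) (wr V (T2 G \<epsilon>) (T1 G f)) (wl V (T1 G f) (T2 G \<eta>)) = Idn (Two V) (T1 G f)"
      using a by (simp add: t tf)
    have "Cmp (Two V) (wl V (T1 G g) (T2 G \<epsilon>)) (wr V (T2 G \<eta>) (T1 G g)) =
        T2 G (Cmp (Two W) (wl W g \<epsilon>) (wr W \<eta> g))"
      using a W by (simp add: tf)
    then show "Cmp (Two V) (wl V (T1 G g) (T2 G \<epsilon>)) (wr V (T2 G \<eta>) (T1 G g)) = Idn (Two V) (T1 G g)"
      using a by (simp add: t tf)
  qed (use a W in \<open>simp_all add: tf\<close>)
qed

context
  assumes ff: "locally_iso W V G"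
begin

lemma locally_isoD:
  assumes "A \<in> Ob (One W)" "B \<in> Ob (One W)"
  shows "bij_betw (T1 G) (hom (One W) A B) (hom (One V) (T0 G A) (T0 G B))"
    "bij_betw (T2 G) (Ar (homcat W A B)) (Ar (homcat V (T0 G A) (T0 G B)))"
  using ff assms unfolding locally_iso_def iso_functor_def by simp_all

lemma full1:
  assumes "\<phi> \<in> hom (One V) (T0 G A) (T0 G B)" "A \<in> Ob (One W)" "B \<in> Ob (One W)"
  obtains u where "u \<in> hom (One W) A B" "T1 G u = \<phi>"
proof -
  have "\<phi> \<in> T1 G ` hom (One W) A B"
    using locally_isoD(1)[OF assms(2,3)] assms(1) by (simp add: bij_betw_def)
  then show ?thesis using that by blast
qed

lemma faithful1:
  assumes "T1 G u = T1 G v" "u \<in> hom (One W) A B" "v \<in> hom (One W) A B"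
  shows "u = v"
proof -
  have "A \<in> Ob (One W)" "B \<in> Ob (One W)" using assms W by (auto simp: hom_iff)
  from locally_isoD(1)[OF this] show ?thesis
    using assms unfolding bij_betw_def inj_on_def by blast
qed

text \<open>Bijectivity on all 2-cells of a hom-category does not mention boundaries. The preimage
  of \<open>\<tau>\<close> has the right source and target because \<open>T1 G\<close> is injective
  on 1-cells.\<close>

lemma full2:
  assumes u: "u \<in> hom (One W) A B" "v \<in> hom (One W) A B"
    and \<tau>: "\<tau> \<in> hom (Two V) (T1 G u) (T1 G v)"
  obtains c where "c \<in> hom (Two W) u v" "T2 G c = \<tau>"
proof -
  have AB: "A \<in> Ob (One W)" "B \<in> Ob (One W)" using u W by (auto simp: hom_iff)
  have "\<tau> \<in> Ar (homcat V (T0 G A) (T0 G B))"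
    using u \<tau> by (simp add: hom_iff src0_def tgt0_def) (auto simp: twofunctor_simps)
  then have "\<tau> \<in> T2 G ` Ar (homcat W A B)"
    using locally_isoD(2)[OF AB] by (simp only: bij_betw_def)
  then obtain c where c: "c \<in> Ar (homcat W A B)" "T2 G c = \<tau>"
    by blast
  then have c': "c \<in> Ar (Two W)" "Src (Two W) c \<in> hom (One W) A B" "Tgt (Two W) c \<in> hom (One W) A B"
    using W by (auto simp: src0_def tgt0_def hom_iff)
  then have "T1 G (Src (Two W) c) = T1 G u" "T1 G (Tgt (Two W) c) = T1 G v"
    using c(2) \<tau> by (auto simp: hom_iff twofunctor_simps)
  then have "Src (Two W) c = u" "Tgt (Two W) c = v"
    using c' u faithful1 by blast+
  then show ?thesis using that[of c] c c' by (simp add: hom_iff)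
qed

lemma faithful2:
  assumes "T2 G a = T2 G b" "a \<in> Ar (Two W)" "b \<in> Ar (Two W)"
    "Src (Two W) a \<in> hom (One W) A B" "Src (Two W) b \<in> hom (One W) A B"
  shows "a = b"
proof -
  have AB: "A \<in> Ob (One W)" "B \<in> Ob (One W)" using assms W by (auto simp: hom_iff)
  moreover have "a \<in> Ar (homcat W A B)" "b \<in> Ar (homcat W A B)"
    using assms by (auto simp: src0_def tgt0_def hom_iff)
  ultimately show ?thesis
    using locally_isoD(2)[OF AB] assms(1) unfolding bij_betw_def inj_on_def by blast
qed

text \<open>Unit and counit are lifted by fullness on 2-cells; the triangle identities hold because
  they hold after the faithful \<open>T2 G\<close>.\<close>

lemma left_adjoint_reflected:
  assumes f: "f \<in> hom (One W) A B" and g: "g \<in> hom (One W) B A"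
    and fg: "left_adjoint V (T1 G f) (T1 G g)"
  shows "left_adjoint W f g"
proof -
  note tf = twofunctor_simps
  have f': "f \<in> Ar (One W)" "Src (One W) f = A" "Tgt (One W) f = B" "A \<in> Ob (One W)" "B \<in> Ob (One W)"
    and g': "g \<in> Ar (One W)" "Src (One W) g = B" "Tgt (One W) g = A"
    using f g W by (auto simp: hom_iff)
  obtain \<eta> \<epsilon> where a: "\<eta> \<in> Ar (Two V)" "Src (Two V) \<eta> = Idn (One V) (Src (One V) (T1 G f))"
    "Tgt (Two V) \<eta> = Cmp (One V) (T1 G g) (T1 G f)"
    "\<epsilon> \<in> Ar (Two V)" "Src (Two V) \<epsilon> = Cmp (One V) (T1 G f) (T1 G g)"
    "Tgt (Two V) \<epsilon> = Idn (One V) (Tgt (One V) (T1 G f))"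
    and t: "Cmp (Two V) (wr V \<epsilon> (T1 G f)) (wl V (T1 G f) \<eta>) = Idn (Two V) (T1 G f)"
      "Cmp (Two V) (wl V (T1 G g) \<epsilon>) (wr V \<eta> (T1 G g)) = Idn (Two V) (T1 G g)"
    by (rule left_adjointE[OF V fg])
  obtain h where h: "h \<in> hom (Two W) (Idn (One W) A) (Cmp (One W) g f)" "T2 G h = \<eta>"
    by (rule full2[of "Idn (One W) A" A A "Cmp (One W) g f" \<eta>])
      (use f' g' a W in \<open>simp_all add: hom_iff tf\<close>)
  obtain e where e: "e \<in> hom (Two W) (Cmp (One W) f g) (Idn (One W) B)" "T2 G e = \<epsilon>"
    by (rule full2[of "Cmp (One W) f g" B B "Idn (One W) B" \<epsilon>])
      (use f' g' a W in \<open>simp_all add: hom_iff tf\<close>)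
  have he: "h \<in> Ar (Two W)" "Src (Two W) h = Idn (One W) A" "Tgt (Two W) h = Cmp (One W) g f"
    "e \<in> Ar (Two W)" "Src (Two W) e = Cmp (One W) f g" "Tgt (Two W) e = Idn (One W) B"
    using h e by (simp_all add: hom_iff)
  show ?thesis
  proof (rule left_adjointI[OF W, where \<eta> = h and \<epsilon> = e])
    have "T2 G (Cmp (Two W) (wr W e f) (wl W f h)) = T2 G (Idn (Two W) f)"
      using f' g' he W t(1) by (simp add: tf h(2) e(2))
    then show "Cmp (Two W) (wr W e f) (wl W f h) = Idn (Two W) f"
      by (rule faithful2[where A = A and B = B]) (use f' g' he W in \<open>simp_all add: hom_iff\<close>)
    have "T2 G (Cmp (Two W) (wl W g e) (wr W h g)) = T2 G (Idn (Two W) g)"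
      using f' g' he W t(2) by (simp add: tf h(2) e(2))
    then show "Cmp (Two W) (wl W g e) (wr W h g) = Idn (Two W) g"
      by (rule faithful2[where A = B and B = A]) (use f' g' he W in \<open>simp_all add: hom_iff\<close>)
  qed (use f' g' he in simp_all)
qed

text \<open>Only \<open>f\<close> is known to come from \<open>W\<close>; the adjoint
  \<open>\<phi>\<close> is lifted by fullness on 1-cells before the adjunction is reflected.\<close>

lemma right_adjoint_reflected:
  assumes f: "f \<in> hom (One W) A B" and fg: "left_adjoint V (T1 G f) \<phi>"
  obtains g where "g \<in> hom (One W) B A" "T1 G g = \<phi>" "left_adjoint W f g"
proof -
  have AB: "A \<in> Ob (One W)" "B \<in> Ob (One W)" using f W by (auto simp: hom_iff)
  have "\<phi> \<in> hom (One V) (T0 G B) (T0 G A)"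
    using left_adjointE[OF V fg] twofunctor_hom[OF f] by (simp add: hom_iff) metis
  then obtain g where "g \<in> hom (One W) B A" "T1 G g = \<phi>" by (rule full1[OF _ AB(2,1)])
  then show ?thesis using that left_adjoint_reflected[OF f] fg by blast
qed

lemma left_adjoint_reflected':
  assumes f: "f \<in> hom (One W) A B" and fg: "left_adjoint V \<phi> (T1 G f)"
  obtains g where "g \<in> hom (One W) B A" "T1 G g = \<phi>" "left_adjoint W g f"
proof -
  have AB: "A \<in> Ob (One W)" "B \<in> Ob (One W)" using f W by (auto simp: hom_iff)
  have "\<phi> \<in> hom (One V) (T0 G B) (T0 G A)"
    using left_adjointE[OF V fg] twofunctor_hom[OF f] by (simp add: hom_iff) metis
  then obtain g where "g \<in> hom (One W) B A" "T1 G g = \<phi>" by (rule full1[OF _ AB(2,1)])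
  then show ?thesis using that left_adjoint_reflected[OF _ f] fg by blast
qed

end
end

section \<open>Finite products from finite limits\<close>

lemma disc_cat_simps [simp]:
  "Ob (disc_cat S) = S" "Ar (disc_cat S) = S" "Src (disc_cat S) = (\<lambda>x. x)" "Tgt (disc_cat S) = (\<lambda>x. x)"
  "Idn (disc_cat S) = (\<lambda>x. x)" "Cmp (disc_cat S) g f = f"
  by (simp_all add: disc_cat_def)

lemma loc_disc_simps [simp]:
  "One (loc_disc C) = C" "Two (loc_disc C) = disc_cat (Ar C)" "HC (loc_disc C) = Cmp C"
  "src0 (loc_disc C) f = Src C f" "tgt0 (loc_disc C) f = Tgt C f"
  by (simp_all add: loc_disc_def src0_def tgt0_def)

lemma hom_from_simps [simp]:
  "Fib (hom_from W X G) d = homcat W X (T0 G d)"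
  "FO (Tr (hom_from W X G) g) u = Cmp (One W) (T1 G g) u"
  "FA (Tr (hom_from W X G) g) a = wl W (T1 G g) a"
  "Tr2 (hom_from W X G) c u = wr W (T2 G c) u"
  by (simp_all add: hom_from_def)

text \<open>A product is the limit over a discrete index with weight constantly the terminal
  category. Keeping the finite index set \<open>S\<close> arbitrary covers the terminal object and
  binary products together, with their 2-dimensional universal property.\<close>

lemma finite_products_exist:
  assumes W: "twocategory W" and lim: "has_finite_limits W"
    and S: "finite (S :: nat set)" and D: "\<forall>d\<in>S. D d \<in> Ob (One W)"
  shows "\<exists>L \<pi>. L \<in> Ob (One W) \<and> (\<forall>d\<in>S. \<pi> d \<in> hom (One W) L (D d)) \<and>
    (\<forall>X\<in>Ob (One W).
      (\<forall>f. (\<forall>d\<in>S. f d \<in> hom (One W) X (D d)) \<longrightarrow>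
        (\<exists>!h. h \<in> hom (One W) X L \<and> (\<forall>d\<in>S. Cmp (One W) (\<pi> d) h = f d))) \<and>
      (\<forall>a. (\<forall>d\<in>S. a d \<in> Ar (homcat W X (D d))) \<longrightarrow>
        (\<exists>!c. c \<in> Ar (homcat W X L) \<and> (\<forall>d\<in>S. wl W (\<pi> d) c = a d))))"
proof -
  \<comment> \<open>The index has only identities, and each fibre of the weight has the single
    object and arrow \<open>0\<close>, so a weighted cone is a family of 1-cells.\<close>
  let ?K = "loc_disc (disc_cat S)"
  let ?\<phi> = "\<lparr>Fib = \<lambda>_. disc_cat {0}, Tr = \<lambda>_. \<lparr>FO = \<lambda>x. x, FA = \<lambda>x. x\<rparr>, Tr2 = \<lambda>_ x. x\<rparr> ::
    (nat, nat, nat, nat, nat) catfun"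
  let ?G = "\<lparr>T0 = D, T1 = \<lambda>d. Idn (One W) (D d), T2 = \<lambda>d. Idn (Two W) (Idn (One W) (D d))\<rparr>"
  have dc: "category (disc_cat T)" for T :: "nat set"
    by (simp add: category_def hom_iff)
  have K: "twocategory ?K" using dc by (simp add: twocategory_def hom_iff)
  have \<phi>: "is_catfun ?K ?\<phi>" using dc by (simp add: is_catfun_def is_functor_def hom_iff)
  have G: "is_2functor ?K W ?G"
    using W D by (simp add: is_2functor_def is_functor_def hom_iff)
  obtain L \<zeta> where L: "is_weighted_limit W ?K ?\<phi> ?G L \<zeta>"
    using lim[unfolded has_finite_limits_def, rule_format, of ?K ?\<phi> ?G] K \<phi> G S by auto
  define \<pi> where "\<pi> d = FO (\<zeta> d) 0" for d
  have Lo: "L \<in> Ob (One W)" and \<zeta>: "twonat ?K ?\<phi> (hom_from W L ?G) \<zeta>"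
    and iso: "\<And>X. X \<in> Ob (One W) \<Longrightarrow> iso_to_transf (homcat W X L) ?K ?\<phi> (hom_from W X ?G)
          (\<lambda>u d. \<lparr>FO = (\<lambda>p. Cmp (One W) (FO (\<zeta> d) p) u), FA = (\<lambda>q. wr W (FA (\<zeta> d) q) u)\<rparr>)
          (\<lambda>a d p. wl W (FO (\<zeta> d) p) a)"
    using L unfolding is_weighted_limit_def by blast+
  have \<pi>: "\<pi> d \<in> hom (One W) L (D d)" "FA (\<zeta> d) 0 = Idn (Two W) (\<pi> d)" if "d \<in> S" for d
  proof -
    have "is_functor (disc_cat {0}) (homcat W L (D d)) (\<zeta> d)"
      using \<zeta> that unfolding twonat_def by simp
    from is_functorD(1,5)[OF this, of 0]
    show "\<pi> d \<in> hom (One W) L (D d)" "FA (\<zeta> d) 0 = Idn (Two W) (\<pi> d)"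
      by (simp_all add: \<pi>_def)
  qed
  have \<pi>': "\<pi> d \<in> Ar (One W)" "Src (One W) (\<pi> d) = L" "Tgt (One W) (\<pi> d) = D d" if "d \<in> S" for d
    using \<pi>(1)[OF that] by (simp_all add: hom_iff)
  have 1: "\<exists>!h. h \<in> hom (One W) X L \<and> (\<forall>d\<in>S. Cmp (One W) (\<pi> d) h = f d)"
    if X: "X \<in> Ob (One W)" and f: "\<forall>d\<in>S. f d \<in> hom (One W) X (D d)" for X f
  proof -
    \<comment> \<open>The family \<open>f\<close> regarded as a transformation out of the
      weight.\<close>
    let ?\<alpha> = "\<lambda>d. \<lparr>FO = \<lambda>_. f d, FA = \<lambda>_. Idn (Two W) (f d)\<rparr> :: (nat, nat, _, _) fctr"
    have f': "f d \<in> Ar (One W)" "Src (One W) (f d) = X" "Tgt (One W) (f d) = D d" if "d \<in> S" for d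
      using f that by (simp_all add: hom_iff)
    have "twonat ?K ?\<phi> (hom_from W X ?G) ?\<alpha>"
      unfolding twonat_def using W D f' X by (simp add: is_functor_def hom_iff src0_def tgt0_def)
    then have "\<exists>!u. u \<in> Ob (homcat W X L) \<and> (\<forall>d\<in>S. Cmp (One W) (FO (\<zeta> d) 0) u = f d \<and>
       wr W (FA (\<zeta> d) 0) u = Idn (Two W) (f d))"
      using iso[OF X] unfolding iso_to_transf_def by (elim conjE) (drule spec, drule (1) mp, simp)
    \<comment> \<open>The condition at the arrow of the weight follows from that at its object,
      since this arrow is an identity.\<close>
    moreover have "(\<forall>d\<in>S. Cmp (One W) (FO (\<zeta> d) 0) u = f d \<and> wr W (FA (\<zeta> d) 0) u = Idn (Two W) (f d)) \<longleftrightarrow>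
      (\<forall>d\<in>S. Cmp (One W) (\<pi> d) u = f d)" if u: "u \<in> hom (One W) X L" for u
      using u \<pi>(2) \<pi>' W by (auto simp: hom_iff simp flip: \<pi>_def)
    ultimately show ?thesis by (simp cong: conj_cong)
  qed
  have 2: "\<exists>!c. c \<in> Ar (homcat W X L) \<and> (\<forall>d\<in>S. wl W (\<pi> d) c = a d)"
    if X: "X \<in> Ob (One W)" and a: "\<forall>d\<in>S. a d \<in> Ar (homcat W X (D d))" for X a
  proof -
    have a': "a d \<in> Ar (Two W)" "Src (One W) (Src (Two W) (a d)) = X"
      "Tgt (One W) (Src (Two W) (a d)) = D d" if "d \<in> S" for d
      using a that by (simp_all add: src0_def tgt0_def)
    have s: "\<forall>d\<in>S. Src (Two W) (a d) \<in> hom (One W) X (D d)"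
      and t: "\<forall>d\<in>S. Tgt (Two W) (a d) \<in> hom (One W) X (D d)"
      using a' W by (simp_all add: hom_iff)
    \<comment> \<open>The weighted limit speaks of 2-cells between given 1-cells, so the boundaries
      \<open>u\<close> and \<open>v\<close> are produced first, from the sources and targets of the
      family.\<close>
    obtain u where u: "u \<in> hom (One W) X L" "\<And>d. d \<in> S \<Longrightarrow> Cmp (One W) (\<pi> d) u = Src (Two W) (a d)"
      using 1[OF X s] by blast
    obtain v where v: "v \<in> hom (One W) X L" "\<And>d. d \<in> S \<Longrightarrow> Cmp (One W) (\<pi> d) v = Tgt (Two W) (a d)"
      using 1[OF X t] by blast
    have uv: "u \<in> Ar (One W)" "Src (One W) u = X" "Tgt (One W) u = L"
      "v \<in> Ar (One W)" "Src (One W) v = X" "Tgt (One W) v = L"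
      using u v by (simp_all add: hom_iff)
    have "modification ?K ?\<phi> (hom_from W X ?G)
        (\<lambda>d. \<lparr>FO = (\<lambda>p. Cmp (One W) (FO (\<zeta> d) p) u), FA = (\<lambda>q. wr W (FA (\<zeta> d) q) u)\<rparr>)
        (\<lambda>d. \<lparr>FO = (\<lambda>p. Cmp (One W) (FO (\<zeta> d) p) v), FA = (\<lambda>q. wr W (FA (\<zeta> d) q) v)\<rparr>) (\<lambda>d _. a d)"
      unfolding modification_def using \<pi>' \<pi>(2) uv a' W u(2) v(2)
      by (simp add: hom_iff src0_def tgt0_def flip: \<pi>_def)
    then have ex: "\<exists>!c. c \<in> hom (homcat W X L) u v \<and> (\<forall>d\<in>S. wl W (FO (\<zeta> d) 0) c = a d)"
      using iso[OF X] u(1) v(1) unfolding iso_to_transf_def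
      by (elim conjE) (drule bspec[of _ _ u], simp, drule bspec[of _ _ v], simp, drule spec,
          drule (1) mp, simp)
    \<comment> \<open>A 2-cell with the prescribed projections has boundary \<open>u\<close>,
      \<open>v\<close> automatically, by uniqueness of mediating 1-cells.\<close>
    have "c \<in> hom (homcat W X L) u v \<longleftrightarrow> c \<in> Ar (homcat W X L)" if c: "\<forall>d\<in>S. wl W (\<pi> d) c = a d" for c
    proof
      assume "c \<in> Ar (homcat W X L)"
      then have c': "c \<in> Ar (Two W)" "Src (One W) (Src (Two W) c) = X" "Tgt (One W) (Src (Two W) c) = L"
        by (simp_all add: src0_def tgt0_def)
      have e: "Cmp (One W) (\<pi> d) (Src (Two W) c) = Src (Two W) (a d)"
          "Cmp (One W) (\<pi> d) (Tgt (Two W) c) = Tgt (Two W) (a d)" if "d \<in> S" for d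
        using c' \<pi>'[OF that] W by (simp_all flip: c[rule_format, OF that])
      have h: "Src (Two W) c \<in> hom (One W) X L" "Tgt (Two W) c \<in> hom (One W) X L"
        using c' W by (simp_all add: hom_iff)
      have "Src (Two W) c = u" using 1[OF X s] u e(1) h(1) by blast
      moreover have "Tgt (Two W) c = v" using 1[OF X t] v e(2) h(2) by blast
      ultimately show "c \<in> hom (homcat W X L) u v" using c' by (simp add: hom_iff src0_def tgt0_def)
    qed (simp add: hom_iff)
    then show ?thesis using ex by (metis (no_types, lifting) \<pi>_def)
  qed
  show ?thesis
    using Lo \<pi>(1) 1 2 by (intro exI[of _ L] exI[of _ \<pi>]) blast
qed

lemma terminal_object_exists:
  assumes "twocategory W" "has_finite_limits W"
  obtains T where "is_terminal_object W T"
proof -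
  obtain T where "T \<in> Ob (One W)"
    and "\<forall>X\<in>Ob (One W). (\<exists>!f. f \<in> hom (One W) X T) \<and> (\<exists>!c. c \<in> Ar (homcat W X T))"
    \<comment> \<open>The terminal object is the empty product; the family over the empty index is
      never evaluated.\<close>
    using finite_products_exist[OF assms, of "{}" "\<lambda>_. undefined"] by auto
  then show ?thesis
    using that[of T] unfolding is_terminal_object_def by simp
qed

lemma binary_product_exists:
  assumes W: "twocategory W" "has_finite_limits W" and AB: "A \<in> Ob (One W)" "B \<in> Ob (One W)"
  obtains P p q where "is_product W A B P p q"
proof -
  let ?D = "\<lambda>d :: nat. if d = 0 then A else B"
  have "finite {0, 1 :: nat}" "\<forall>d\<in>{0, 1 :: nat}. ?D d \<in> Ob (One W)"
    using AB by auto
  from finite_products_exist[where D = ?D, OF W this]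
  obtain P \<pi> where P: "P \<in> Ob (One W)" and \<pi>: "\<forall>d\<in>{0,1}. \<pi> d \<in> hom (One W) P (?D d)"
    and u: "\<forall>X\<in>Ob (One W).
      (\<forall>f. (\<forall>d\<in>{0,1}. f d \<in> hom (One W) X (?D d)) \<longrightarrow>
        (\<exists>!h. h \<in> hom (One W) X P \<and> (\<forall>d\<in>{0,1}. Cmp (One W) (\<pi> d) h = f d))) \<and>
      (\<forall>a. (\<forall>d\<in>{0,1}. a d \<in> Ar (homcat W X (?D d))) \<longrightarrow>
        (\<exists>!c. c \<in> Ar (homcat W X P) \<and> (\<forall>d\<in>{0,1}. wl W (\<pi> d) c = a d)))"
    by (elim exE conjE) (rule that)
  have "is_product W A B P (\<pi> 0) (\<pi> 1)"
    unfolding is_product_def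
  proof (intro conjI ballI)
    show "P \<in> Ob (One W)" "\<pi> 0 \<in> hom (One W) P A" "\<pi> 1 \<in> hom (One W) P B" using P \<pi> by auto
    fix X assume X: "X \<in> Ob (One W)"
    show "\<exists>!h. h \<in> hom (One W) X P \<and> Cmp (One W) (\<pi> 0) h = f \<and> Cmp (One W) (\<pi> 1) h = g"
      if "f \<in> hom (One W) X A" "g \<in> hom (One W) X B" for f g
      using u[rule_format, OF X, THEN conjunct1, rule_format, of "\<lambda>d. if d = 0 then f else g"] that
      by simp
    show "\<exists>!c. c \<in> Ar (homcat W X P) \<and> wl W (\<pi> 0) c = a \<and> wl W (\<pi> 1) c = b"
      if "a \<in> Ar (homcat W X A)" "b \<in> Ar (homcat W X B)" for a b
      using u[rule_format, OF X, THEN conjunct2, rule_format, of "\<lambda>d. if d = 0 then a else b"] that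
      by simp
  qed
  then show ?thesis by (rule that)
qed

section \<open>Transfer of connectives along a 2-functor\<close>

text \<open>The discrete part and its counit are free parameters \<open>D\<close> and
  \<open>e\<close>, so that they can be replaced by isomorphic ones.\<close>

definition has_closed_products :: "('o, 'm, 'c) twocat \<Rightarrow> 'o \<Rightarrow> 'o \<Rightarrow> 'm \<Rightarrow> bool" where
  "has_closed_products W A D e \<longleftrightarrow>
     (\<exists>P p q \<delta> t R r s k m n.
        is_product W A A P p q \<and> is_diagonal W A P p q \<delta> \<and> left_adjoint W \<delta> t \<and>
        is_product W A D R r s \<and>
        k \<in> hom (One W) R P \<and> Cmp (One W) p k = r \<and> Cmp (One W) q k = Cmp (One W) e s \<and>
        m \<in> hom (One W) R R \<and> Cmp (One W) r m = Cmp (One W) t k \<and> Cmp (One W) s m = s \<and>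
        left_adjoint W m n)"

lemma has_connective_closed:
  "has_connective W N Closed_Products A \<longleftrightarrow>
    has_closed_products W A (discrete_part N A) (Counit N A)"
  by (simp add: has_closed_products_def)

lemma left_adjoint_hom:
  assumes W: "twocategory W" and "left_adjoint W f g"
  shows "f \<in> hom (One W) A B \<Longrightarrow> g \<in> hom (One W) B A"
    "g \<in> hom (One W) B A \<Longrightarrow> f \<in> hom (One W) A B"
  using assms(2) unfolding left_adjoint_def by (auto simp: hom_iff)

lemma diagonal_exists:
  assumes W: "twocategory W" and P: "is_product W A A P p q"
  obtains \<delta> where "is_diagonal W A P p q \<delta>"
proof -
  note t = product_typing[OF W P]
  show ?thesis
    using product_obtain[OF W P, of "Idn (One W) A" "Idn (One W) A"] t W that
    by (auto simp: is_diagonal_def hom_iff)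
qed

section \<open>Preservation of connectives by a 2-functor respecting terminal objects and
  products\<close>

context
  fixes W :: "('o, 'm, 'c) twocat" and V :: "('p, 'n, 'd) twocat"
    and G :: "('o, 'm, 'c, 'p, 'n, 'd) twofun"
  assumes W: "twocategory W" and V: "twocategory V" and G: "is_2functor W V G"
    and terminal: "\<And>T. is_terminal_object W T \<Longrightarrow> is_terminal_object V (T0 G T)"
    and product: "\<And>A B P p q. is_product W A B P p q \<Longrightarrow>
      is_product V (T0 G A) (T0 G B) (T0 G P) (T1 G p) (T1 G q)"
begin

lemmas G_hom = twofunctor_hom[OF W V G]
lemmas G_comp = twofunctor_comp[OF W V G]
lemmas G_adj = left_adjoint_preserved[OF W V G]

lemma product_hom:
  assumes "is_product W A B P p q"
  shows "p \<in> hom (One W) P A" "q \<in> hom (One W) P B"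
  using assms unfolding is_product_def by blast+

lemma diagonal_preserved:
  assumes P: "is_product W A A P p q" and d: "is_diagonal W A P p q \<delta>"
  shows "is_diagonal V (T0 G A) (T0 G P) (T1 G p) (T1 G q) (T1 G \<delta>)"
proof -
  have A: "A \<in> Ob (One W)" using product_typing[OF W P] by blast
  have "\<delta> \<in> hom (One W) A P" using d unfolding is_diagonal_def by blast
  from G_comp[OF this product_hom(1)[OF P]] G_comp[OF this product_hom(2)[OF P]] G_hom[OF this] d
  show ?thesis
    unfolding is_diagonal_def twofunctor_simps(5)[OF W V G A, symmetric] by blast
qed

text \<open>Images of \<open>P\<close>, \<open>R\<close>, \<open>k\<close> and \<open>m\<close>
  serve unchanged. Only the second projection of the image of \<open>R\<close> is corrected by
  \<open>j\<close>, so that it ends in \<open>D'\<close>.\<close>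

lemma closed_products_preserved:
  assumes A: "has_closed_products W A D e" and e: "e \<in> hom (One W) D A"
    and j: "inverses V j j'" "j \<in> hom (One V) (T0 G D) D'"
    and e': "e' \<in> hom (One V) D' (T0 G A)" "Cmp (One V) e' j = T1 G e"
  shows "has_closed_products V (T0 G A) D' e'"
proof -
  obtain P p q \<delta> t R r s k m n where
    P: "is_product W A A P p q" "is_diagonal W A P p q \<delta>" "left_adjoint W \<delta> t"
    and R: "is_product W A D R r s"
    and k: "k \<in> hom (One W) R P" "Cmp (One W) p k = r" "Cmp (One W) q k = Cmp (One W) e s"
    and m: "m \<in> hom (One W) R R" "Cmp (One W) r m = Cmp (One W) t k" "Cmp (One W) s m = s"
    and n: "left_adjoint W m n"
    using A unfolding has_closed_products_def by (elim exE conjE) (rule that)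
  have \<delta>: "\<delta> \<in> hom (One W) A P" using P(2) unfolding is_diagonal_def by blast
  have t: "t \<in> hom (One W) P A" by (rule left_adjoint_hom(1)[OF W P(3) \<delta>])
  note p = product_hom[OF P(1)] and r = product_hom[OF R]
  have jh: "j \<in> Ar (One V)" "Src (One V) j = T0 G D" "Tgt (One V) j = D'"
    using j(2) by (simp_all add: hom_iff)
  have eh: "e' \<in> Ar (One V)" "Src (One V) e' = D'" using e'(1) by (simp_all add: hom_iff)
  have sh: "T1 G s \<in> Ar (One V)" "Src (One V) (T1 G s) = T0 G R" "Tgt (One V) (T1 G s) = T0 G D"
    using G_hom[OF r(2)] by (simp_all add: hom_iff)
  have mh: "T1 G m \<in> Ar (One V)" "Tgt (One V) (T1 G m) = T0 G R"
    using G_hom[OF m(1)] by (simp_all add: hom_iff)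
  have R': "is_product V (T0 G A) D' (T0 G R) (T1 G r) (Cmp (One V) j (T1 G s))"
    by (rule product_change_iso[OF V product[OF R] j(1) jh(2,3)])
  have "Cmp (One V) (T1 G q) (T1 G k) = Cmp (One V) (T1 G e) (T1 G s)"
    using G_comp[OF k(1) p(2) k(3)] G_comp[OF r(2) e refl] by simp
  also have "\<dots> = Cmp (One V) e' (Cmp (One V) j (T1 G s))"
    unfolding e'(2)[symmetric] using jh eh sh V by simp
  finally have qk: "Cmp (One V) (T1 G q) (T1 G k) = Cmp (One V) e' (Cmp (One V) j (T1 G s))" .
  have rm: "Cmp (One V) (T1 G r) (T1 G m) = Cmp (One V) (T1 G t) (T1 G k)"
    using G_comp[OF m(1) r(1) m(2)] G_comp[OF k(1) t refl] by simp
  have sm: "Cmp (One V) (Cmp (One V) j (T1 G s)) (T1 G m) = Cmp (One V) j (T1 G s)"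
    using G_comp[OF m(1) r(2) m(3)] jh sh mh V by simp
  show ?thesis
    unfolding has_closed_products_def
    using product[OF P(1)] diagonal_preserved[OF P(1,2)] G_adj[OF P(3)] R' G_hom[OF k(1)]
      G_comp[OF k(1) p(1) k(2)] qk G_hom[OF m(1)] rm sm G_adj[OF n]
    by (intro exI conjI)
qed

text \<open>The data \<open>j\<close> and \<open>e'\<close> match the counit of the target
  discreteness with the image of the counit of \<open>N\<close>; they feed the case of closed
  products.\<close>

lemma connective_preserved:
  assumes A: "has_connective W N \<kappa> A" and e: "Counit N A \<in> hom (One W) (discrete_part N A) A"
    and j: "inverses V j j'" "j \<in> hom (One V) (T0 G (discrete_part N A)) (discrete_part N' (T0 G A))"
    and e': "Counit N' (T0 G A) \<in> hom (One V) (discrete_part N' (T0 G A)) (T0 G A)"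
      "Cmp (One V) (Counit N' (T0 G A)) j = T1 G (Counit N A)"
  shows "has_connective V N' \<kappa> (T0 G A)"
proof (cases \<kappa>)
  case Terminal_Value
  then show ?thesis using A terminal G_hom G_adj by simp blast
next
  case Initial_Value
  then show ?thesis using A terminal G_hom G_adj by simp blast
next
  case Products
  then show ?thesis using A product diagonal_preserved G_adj by simp blast
next
  case Closed_Products
  then show ?thesis
    using A closed_products_preserved[OF _ e j e'] by (simp only: has_connective_closed)
next
  case Coproducts
  then show ?thesis using A product diagonal_preserved G_adj by simp blast
qed

section \<open>Reflection of connectives by a locally isomorphic 2-functor\<close>

context
  assumes ff: "locally_iso W V G" and lim: "has_finite_limits W"
begin

text \<open>A product of \<open>T0 G A\<close> with itself in \<open>V\<close> need not be an image.
  It is compared with the image of a product that finite limits provide in \<open>W\<close>.\<close>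

lemma diagonal_iso:
  assumes A: "A \<in> Ob (One W)"
    and P: "is_product V (T0 G A) (T0 G A) P p q" "is_diagonal V (T0 G A) P p q \<delta>"
  obtains P' p' q' \<delta>' i i' where "is_product W A A P' p' q'" "is_diagonal W A P' p' q' \<delta>'"
    "inverses V i i'" "i \<in> hom (One V) P (T0 G P')" "Cmp (One V) (T1 G p') i = p"
    "Cmp (One V) (T1 G q') i = q" "Cmp (One V) p i' = T1 G p'" "Cmp (One V) q i' = T1 G q'"
    "T1 G \<delta>' = Cmp (One V) i \<delta>" "\<delta>' \<in> hom (One W) A P'"
proof -
  obtain P' p' q' where P': "is_product W A A P' p' q'"
    by (rule binary_product_exists[OF W lim A A])
  obtain \<delta>' where d: "is_diagonal W A P' p' q' \<delta>'" by (rule diagonal_exists[OF W P'])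
  obtain i i' where i: "inverses V i i'" "i \<in> hom (One V) P (T0 G P')"
    "Cmp (One V) (T1 G p') i = p" "Cmp (One V) (T1 G q') i = q"
    "Cmp (One V) p i' = T1 G p'" "Cmp (One V) q i' = T1 G q'"
    by (rule product_iso'[OF V P(1) product[OF P']])
  have "T1 G \<delta>' = Cmp (One V) i \<delta>"
    by (rule diagonal_transport[OF V P product[OF P'] diagonal_preserved[OF P' d] i(1-4)])
  moreover have "\<delta>' \<in> hom (One W) A P'" using d unfolding is_diagonal_def by blast
  ultimately show ?thesis using that P' d i by blast
qed

lemma terminal_iso_image:
  assumes A: "A \<in> Ob (One W)" and T: "is_terminal_object V T" "e \<in> hom (One V) (T0 G A) T"
  obtains T' e' i i' where "is_terminal_object W T'" "e' \<in> hom (One W) A T'" "inverses V i i'"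
    "Src (One V) i = T" "T1 G e' = Cmp (One V) i e"
proof -
  obtain T' where T': "is_terminal_object W T'" by (rule terminal_object_exists[OF W lim])
  then obtain e' where e': "e' \<in> hom (One W) A T'"
    using A unfolding is_terminal_object_def by auto
  obtain i i' where i: "inverses V i i'" "i \<in> hom (One V) T (T0 G T')"
    by (rule terminal_iso[OF V T(1) terminal[OF T']])
  have "Cmp (One V) i e \<in> hom (One V) (T0 G A) (T0 G T')"
    using i(2) T(2) V by (simp add: hom_iff)
  \<comment> \<open>Both 1-cells end in a terminal object.\<close>
  then have "T1 G e' = Cmp (One V) i e"
    by (rule terminal_unique1[OF V terminal[OF T'] G_hom[OF e']])
  then show ?thesis using that[OF T' e' i(1)] i(2) by (simp add: hom_iff)
qed

text \<open>The data in \<open>W\<close> are built anew from products existing there. Their images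
  form a second choice in \<open>V\<close>, to which \<open>closed_transport\<close> moves the given
  right adjoint; local fullness then lifts it.\<close>

lemma closed_products_reflected:
  assumes AD: "A \<in> Ob (One W)" "D \<in> Ob (One W)"
    and A: "has_closed_products V (T0 G A) D' e'" and e: "e \<in> hom (One W) D A"
    and j: "inverses V j j'" "j \<in> hom (One V) (T0 G D) D'"
    and e': "e' \<in> hom (One V) D' (T0 G A)" "Cmp (One V) e' j = T1 G e"
  shows "has_closed_products W A D e"
proof -
  obtain P p q \<delta> t R r s k m n where
    P: "is_product V (T0 G A) (T0 G A) P p q" "is_diagonal V (T0 G A) P p q \<delta>" "left_adjoint V \<delta> t"
    and R: "is_product V (T0 G A) D' R r s"
    and k: "k \<in> hom (One V) R P" "Cmp (One V) p k = r" "Cmp (One V) q k = Cmp (One V) e' s"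
    and m: "m \<in> hom (One V) R R" "Cmp (One V) r m = Cmp (One V) t k" "Cmp (One V) s m = s"
    and n: "left_adjoint V m n"
    using A unfolding has_closed_products_def by (elim exE conjE) (rule that)
  obtain P' p' q' \<delta>' i i' where P': "is_product W A A P' p' q'" "is_diagonal W A P' p' q' \<delta>'"
    and i: "inverses V i i'" "i \<in> hom (One V) P (T0 G P')" "Cmp (One V) (T1 G p') i = p"
    "Cmp (One V) (T1 G q') i = q" "Cmp (One V) p i' = T1 G p'" "Cmp (One V) q i' = T1 G q'"
    and d: "T1 G \<delta>' = Cmp (One V) i \<delta>" "\<delta>' \<in> hom (One W) A P'"
    by (rule diagonal_iso[OF AD(1) P(1,2)])
  have \<delta>: "\<delta> \<in> hom (One V) (T0 G A) P" using P(2) unfolding is_diagonal_def by blast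
  have t: "t \<in> hom (One V) P (T0 G A)" by (rule left_adjoint_hom(1)[OF V P(3) \<delta>])
  have "left_adjoint V (T1 G \<delta>') (Cmp (One V) t i')"
    unfolding d(1) by (rule left_adjoint_iso_tgt[OF V P(3) i(1)]) (use i(2) \<delta> in \<open>simp add: hom_iff\<close>)
  \<comment> \<open>The product 1-cell of \<open>A\<close> is the lift of \<open>t\<close>
    conjugated to the image of \<open>P'\<close>.\<close>
  then obtain t' where t': "t' \<in> hom (One W) P' A" "T1 G t' = Cmp (One V) t i'" "left_adjoint W \<delta>' t'"
    by (rule right_adjoint_reflected[OF W V G ff d(2)])
  obtain R' r' s' where R': "is_product W A D R' r' s'"
    by (rule binary_product_exists[OF W lim AD])
  note p' = product_hom[OF P'(1)] and r' = product_hom[OF R']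
  note ty = product_typing[OF W P'(1)] product_typing[OF W R']
  have eh: "e \<in> Ar (One W)" "Src (One W) e = D" "Tgt (One W) e = A" using e by (simp_all add: hom_iff)
  obtain k' where k'': "k' \<in> Ar (One W)" "Src (One W) k' = Src (One W) r'" "Tgt (One W) k' = P'"
    and k': "Cmp (One W) p' k' = r'" "Cmp (One W) q' k' = Cmp (One W) e s'"
    by (rule product_obtain[OF W P'(1), of r' "Cmp (One W) e s'"]) (use ty eh W in simp_all)
  have kh: "k' \<in> hom (One W) R' P'" using k'' ty by (simp add: hom_iff)
  have th: "t' \<in> Ar (One W)" "Src (One W) t' = P'" "Tgt (One W) t' = A" using t'
    by (simp_all add: hom_iff)
  obtain m' where m'': "m' \<in> Ar (One W)" "Src (One W) m' = Src (One W) (Cmp (One W) t' k')"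
    "Tgt (One W) m' = R'"
    and m': "Cmp (One W) r' m' = Cmp (One W) t' k'" "Cmp (One W) s' m' = s'"
    by (rule product_obtain[OF W R', of "Cmp (One W) t' k'" s']) (use ty th k'' W in simp_all)
  have mh: "m' \<in> hom (One W) R' R'" using m'' k'' ty th W by (simp add: hom_iff)
  have qk: "Cmp (One V) (T1 G q') (T1 G k') = Cmp (One V) (T1 G e) (T1 G s')"
    using G_comp[OF kh p'(2) k'(2)] G_comp[OF r'(2) e refl] by simp
  have rm: "Cmp (One V) (T1 G r') (T1 G m') = Cmp (One V) (Cmp (One V) t i') (T1 G k')"
    using G_comp[OF mh r'(1) m'(1)] G_comp[OF kh t'(1) refl] t'(2) by simp
  \<comment> \<open>The given products are the unprimed side of the transport and the images of
    those in \<open>W\<close> the primed side; \<open>j\<close> runs in the required direction, from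
    \<open>T0 G D\<close> to \<open>D'\<close>.\<close>
  obtain n' where "left_adjoint V (T1 G m') n'"
    using closed_transport[OF V P(1) product[OF P'(1)] i t R product[OF R'] j e' k m
        G_hom[OF kh] G_comp[OF kh p'(1) k'(1)] qk G_hom[OF mh] rm G_comp[OF mh r'(2) m'(2)] n]
    by blast
  then obtain n0 where n0: "left_adjoint W m' n0"
    by (rule right_adjoint_reflected[OF W V G ff mh])
  show ?thesis
    unfolding has_closed_products_def using P' t'(3) R' kh k' mh m' n0 by blast
qed

text \<open>In each case the limit in \<open>V\<close> is replaced by the image of one from
  \<open>W\<close>, and the adjunction is conjugated accordingly: at the target of the left adjoint
  for terminal values and products, at its source for initial values and coproducts.\<close>

lemma connective_reflected:
  assumes AD: "A \<in> Ob (One W)" "discrete_part N A \<in> Ob (One W)"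
    and A: "has_connective V N' \<kappa> (T0 G A)" and e: "Counit N A \<in> hom (One W) (discrete_part N A) A"
    and j: "inverses V j j'" "j \<in> hom (One V) (T0 G (discrete_part N A)) (discrete_part N' (T0 G A))"
    and e': "Counit N' (T0 G A) \<in> hom (One V) (discrete_part N' (T0 G A)) (T0 G A)"
      "Cmp (One V) (Counit N' (T0 G A)) j = T1 G (Counit N A)"
  shows "has_connective W N \<kappa> A"
proof (cases \<kappa>)
  case Terminal_Value
  then obtain T e r where T: "is_terminal_object V T" "e \<in> hom (One V) (T0 G A) T"
    and r: "left_adjoint V e r"
    using A by auto
  obtain T' e' i i' where T': "is_terminal_object W T'" "e' \<in> hom (One W) A T'" "inverses V i i'"
    "Src (One V) i = T" "T1 G e' = Cmp (One V) i e"
    by (rule terminal_iso_image[OF AD(1) T])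
  have "left_adjoint V (T1 G e') (Cmp (One V) r i')"
    unfolding T'(5) by (rule left_adjoint_iso_tgt[OF V r T'(3)]) (use T(2) T'(4) in \<open>simp add: hom_iff\<close>)
  then obtain r' where "left_adjoint W e' r'"
    by (rule right_adjoint_reflected[OF W V G ff T'(2)])
  then show ?thesis using T'(1,2) Terminal_Value by auto
next
  case Initial_Value
  then obtain T e r where T: "is_terminal_object V T" "e \<in> hom (One V) (T0 G A) T"
    and r: "left_adjoint V r e"
    using A by auto
  obtain T' e' i i' where T': "is_terminal_object W T'" "e' \<in> hom (One W) A T'" "inverses V i i'"
    "Src (One V) i = T" "T1 G e' = Cmp (One V) i e"
    by (rule terminal_iso_image[OF AD(1) T])
  have "left_adjoint V (Cmp (One V) r i') (T1 G e')"
    unfolding T'(5) by (rule left_adjoint_iso_src[OF V r T'(3)])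
      (use left_adjoint_hom(2)[OF V r T(2)] T'(4) in \<open>simp add: hom_iff\<close>)
  then obtain r' where "left_adjoint W r' e'"
    by (rule left_adjoint_reflected'[OF W V G ff T'(2)])
  then show ?thesis using T'(1,2) Initial_Value by auto
next
  case Products
  then obtain P p q \<delta> t where P: "is_product V (T0 G A) (T0 G A) P p q"
    "is_diagonal V (T0 G A) P p q \<delta>" and t: "left_adjoint V \<delta> t"
    using A by auto
  obtain P' p' q' \<delta>' i i' where P': "is_product W A A P' p' q'" "is_diagonal W A P' p' q' \<delta>'"
    and i: "inverses V i i'" "i \<in> hom (One V) P (T0 G P')"
    and d: "T1 G \<delta>' = Cmp (One V) i \<delta>" "\<delta>' \<in> hom (One W) A P'"
    by (rule diagonal_iso[OF AD(1) P])
  have "left_adjoint V (T1 G \<delta>') (Cmp (One V) t i')"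
    unfolding d(1) by (rule left_adjoint_iso_tgt[OF V t i(1)])
      (use i(2) P(2) in \<open>simp add: is_diagonal_def hom_iff\<close>)
  then obtain t' where "left_adjoint W \<delta>' t'"
    by (rule right_adjoint_reflected[OF W V G ff d(2)])
  then show ?thesis unfolding Products has_connective.simps using P' by blast
next
  case Closed_Products
  then show ?thesis
    using A closed_products_reflected[OF AD _ e j e'] by (simp only: has_connective_closed)
next
  case Coproducts
  then obtain P p q \<delta> t where P: "is_product V (T0 G A) (T0 G A) P p q"
    "is_diagonal V (T0 G A) P p q \<delta>" and t: "left_adjoint V t \<delta>"
    using A by auto
  obtain P' p' q' \<delta>' i i' where P': "is_product W A A P' p' q'" "is_diagonal W A P' p' q' \<delta>'"
    and i: "inverses V i i'" "i \<in> hom (One V) P (T0 G P')"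
    and d: "T1 G \<delta>' = Cmp (One V) i \<delta>" "\<delta>' \<in> hom (One W) A P'"
    by (rule diagonal_iso[OF AD(1) P])
  have "\<delta> \<in> hom (One V) (T0 G A) P" using P(2) unfolding is_diagonal_def by blast
  from left_adjoint_hom(2)[OF V t this] have "left_adjoint V (Cmp (One V) t i') (T1 G \<delta>')"
    unfolding d(1) by (intro left_adjoint_iso_src[OF V t i(1)]) (use i(2) in \<open>simp add: hom_iff\<close>)
  then obtain t' where "left_adjoint W t' \<delta>'"
    by (rule left_adjoint_reflected'[OF W V G ff d(2)])
  then show ?thesis unfolding Coproducts has_connective.simps using P' by blast
qed

end
end

section \<open>The associated category\<close>

lemma op_cat_simps [simp]:
  "Ob (op_cat C) = Ob C" "Ar (op_cat C) = Ar C" "Src (op_cat C) = Tgt C" "Tgt (op_cat C) = Src C"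
  "Idn (op_cat C) = Idn C" "Cmp (op_cat C) g f = Cmp C f g"
  by (simp_all add: op_cat_def)

lemma fam_simps [simp]:
  "Fib (fam W N A) X = homcat W (FO (Incl N) X) A"
  "FO (Tr (fam W N A) f) u = Cmp (One W) u (FA (Incl N) f)"
  "FA (Tr (fam W N A) f) a = wr W a (FA (Incl N) f)"
  "Tr2 (fam W N A) f u = Idn (Two W) (Cmp (One W) u (FA (Incl N) f))"
  by (simp_all add: fam_def)

lemma ext_fib_simps [simp]:
  "Ob (ext_fib C A X) = hom C X (I0 A)" "Ar (ext_fib C A X) = hom C X (I1 A)"
  "Src (ext_fib C A X) f = Cmp C (idom A) f" "Tgt (ext_fib C A X) f = Cmp C (icod A) f"
  "Idn (ext_fib C A X) x = Cmp C (iidn A) x" "Cmp (ext_fib C A X) = gcmp C A"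
  by (simp_all add: ext_fib_def)

lemma ext_simps [simp]:
  "Fib (ext C A) = ext_fib C A"
  "FO (Tr (ext C A) h) x = Cmp C x h" "FA (Tr (ext C A) h) f = Cmp C f h"
  by (simp_all add: ext_def)

lemma ext_at_simps [simp]:
  "Fib (ext_at C E X) A = ext_fib C (T0 E A) X"
  "FO (Tr (ext_at C E X) u) x = Cmp C (i0 (T1 E u)) x"
  "FA (Tr (ext_at C E X) u) f = Cmp C (i1 (T1 E u)) f"
  "Tr2 (ext_at C E X) a x = Cmp C (tcmp (T2 E a)) x"
  by (simp_all add: ext_at_def)

lemma twonatD:
  assumes "twonat K P Q \<alpha>"
  shows "X \<in> Ob (One K) \<Longrightarrow> is_functor (Fib P X) (Fib Q X) (\<alpha> X)"
    "f \<in> Ar (One K) \<Longrightarrow> p \<in> Ob (Fib P (Src (One K) f)) \<Longrightarrow>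
      FO (\<alpha> (Tgt (One K) f)) (FO (Tr P f) p) = FO (Tr Q f) (FO (\<alpha> (Src (One K) f)) p)"
    "f \<in> Ar (One K) \<Longrightarrow> q \<in> Ar (Fib P (Src (One K) f)) \<Longrightarrow>
      FA (\<alpha> (Tgt (One K) f)) (FA (Tr P f) q) = FA (Tr Q f) (FA (\<alpha> (Src (One K) f)) q)"
    "c \<in> Ar (Two K) \<Longrightarrow> p \<in> Ob (Fib P (src0 K c)) \<Longrightarrow>
      FA (\<alpha> (tgt0 K c)) (Tr2 P c p) = Tr2 Q c (FO (\<alpha> (src0 K c)) p)"
  using assms unfolding twonat_def by blast+

lemma homcat_Ar_iff:
  "a \<in> Ar (homcat W A B) \<longleftrightarrow> a \<in> Ar (Two W) \<and> Src (One W) (Src (Two W) a) = A \<and>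
    Tgt (One W) (Src (Two W) a) = B"
  by (simp add: src0_def tgt0_def)

lemma ex1_eq: "\<exists>!x. P x \<Longrightarrow> P a \<Longrightarrow> P b \<Longrightarrow> a = b"
  by blast

lemma ex1_bij_betw:
  assumes "bij_betw f S T" "\<exists>!x. x \<in> S"
  shows "\<exists>!y. y \<in> T"
  using assms unfolding bij_betw_def by blast

text \<open>The Yoneda step at a fixed stage: bijections that intertwine \<open>\<pi>\<close>,
  \<open>\<rho>\<close> with \<open>\<pi>'\<close>, \<open>\<rho>'\<close> carry unique pairing from
  the \<open>S\<close> sides to the \<open>T\<close> sides.\<close>

lemma ex1_pair_transfer:
  assumes P: "bij_betw tP SP TP" and A: "bij_betw tA SA TA" and B: "bij_betw tB SB TB"
    and \<pi>: "\<And>z. z \<in> SP \<Longrightarrow> \<pi> z \<in> SA \<and> tA (\<pi> z) = \<pi>' (tP z)"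
    and \<rho>: "\<And>z. z \<in> SP \<Longrightarrow> \<rho> z \<in> SB \<and> tB (\<rho> z) = \<rho>' (tP z)"
    and ex: "\<And>a b. a \<in> SA \<Longrightarrow> b \<in> SB \<Longrightarrow> \<exists>!z. z \<in> SP \<and> \<pi> z = a \<and> \<rho> z = b"
    and ab: "a' \<in> TA" "b' \<in> TB"
  shows "\<exists>!z. z \<in> TP \<and> \<pi>' z = a' \<and> \<rho>' z = b'"
proof -
  obtain a b where a: "a \<in> SA" "tA a = a'" and b: "b \<in> SB" "tB b = b'"
    using A B ab unfolding bij_betw_def by blast
  obtain z where z: "z \<in> SP" "\<pi> z = a" "\<rho> z = b" and u: "\<And>y. y \<in> SP \<Longrightarrow> \<pi> y = a \<Longrightarrow> \<rho> y = b \<Longrightarrow> y = z"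
    using ex[OF a(1) b(1)] by blast
  show ?thesis
  proof (rule ex1I[of _ "tP z"])
    show "tP z \<in> TP \<and> \<pi>' (tP z) = a' \<and> \<rho>' (tP z) = b'"
      using z a b \<pi>[OF z(1)] \<rho>[OF z(1)] P unfolding bij_betw_def by auto
    fix y assume y: "y \<in> TP \<and> \<pi>' y = a' \<and> \<rho>' y = b'"
    then obtain w where w: "w \<in> SP" "tP w = y" using P unfolding bij_betw_def by blast
    have "tA (\<pi> w) = tA a" "tB (\<rho> w) = tB b"
      using \<pi>[OF w(1)] \<rho>[OF w(1)] w y a b by simp_all
    then have "\<pi> w = a" "\<rho> w = b"
      using \<pi>[OF w(1)] \<rho>[OF w(1)] a b A B unfolding bij_betw_def inj_on_def by blast+
    then show "y = tP z" using u w by blast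
  qed
qed

lemma iso_to_transfD:
  assumes "iso_to_transf H K P Q \<Phi>0 \<Phi>1"
  shows "u \<in> Ob H \<Longrightarrow> twonat K P Q (\<Phi>0 u)"
    "c \<in> Ar H \<Longrightarrow> modification K P Q (\<Phi>0 (Src H c)) (\<Phi>0 (Tgt H c)) (\<Phi>1 c)"
    "twonat K P Q \<alpha> \<Longrightarrow> \<exists>!u. u \<in> Ob H \<and>
       (\<forall>X\<in>Ob (One K). (\<forall>p\<in>Ob (Fib P X). FO (\<Phi>0 u X) p = FO (\<alpha> X) p) \<and>
         (\<forall>q\<in>Ar (Fib P X). FA (\<Phi>0 u X) q = FA (\<alpha> X) q))"
    "u \<in> Ob H \<Longrightarrow> v \<in> Ob H \<Longrightarrow> modification K P Q (\<Phi>0 u) (\<Phi>0 v) \<mu> \<Longrightarrow>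
       \<exists>!a. a \<in> hom H u v \<and> (\<forall>X\<in>Ob (One K). \<forall>p\<in>Ob (Fib P X). \<Phi>1 a X p = \<mu> X p)"
proof -
  note * = assms[unfolded iso_to_transf_def]
  show "u \<in> Ob H \<Longrightarrow> twonat K P Q (\<Phi>0 u)"
    using *[THEN conjunct1] by (rule bspec)
  show "c \<in> Ar H \<Longrightarrow> modification K P Q (\<Phi>0 (Src H c)) (\<Phi>0 (Tgt H c)) (\<Phi>1 c)"
    using *[THEN conjunct2, THEN conjunct1] by (rule bspec)
  show "\<exists>!u. u \<in> Ob H \<and>
       (\<forall>X\<in>Ob (One K). (\<forall>p\<in>Ob (Fib P X). FO (\<Phi>0 u X) p = FO (\<alpha> X) p) \<and>
         (\<forall>q\<in>Ar (Fib P X). FA (\<Phi>0 u X) q = FA (\<alpha> X) q))" if "twonat K P Q \<alpha>"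
    using *[THEN conjunct2, THEN conjunct2, THEN conjunct2, THEN conjunct2, THEN conjunct1,
        THEN spec, THEN mp, OF that] .
  show "\<exists>!a. a \<in> hom H u v \<and> (\<forall>X\<in>Ob (One K). \<forall>p\<in>Ob (Fib P X). \<Phi>1 a X p = \<mu> X p)"
    if "u \<in> Ob H" "v \<in> Ob H" "modification K P Q (\<Phi>0 u) (\<Phi>0 v) \<mu>"
    using *[THEN conjunct2, THEN conjunct2, THEN conjunct2, THEN conjunct2, THEN conjunct2,
        THEN bspec, OF that(1), THEN bspec, OF that(2), THEN spec, THEN mp, OF that(3)] .
qed

section \<open>The comparison of families with externalisations, elementwise\<close>

locale associated =
  fixes W :: "('o, 'm, 'c) twocat"
    and N :: "('o, 'm, 'x, 'f) discreteness"
    and E :: "('o, 'm, 'c, ('x, 'f) icat, ('x, 'f) ifun, ('x, 'f) itrans) twofun"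
    and \<theta> :: "'o \<Rightarrow> 'x \<Rightarrow> ('m, 'c, 'f, 'f) fctr"
  assumes W: "twocategory W"
    and N: "notion_of_discreteness W N"
    and E: "associated_category W N E \<theta>"
begin

abbreviation "C \<equiv> Base N"
abbreviation "V \<equiv> intcat C"
abbreviation "K \<equiv> loc_disc (op_cat C)"
abbreviation "F0 \<equiv> FO (Incl N)"
abbreviation "F1 \<equiv> FA (Incl N)"
abbreviation compW (infixr "\<cdot>" 70) where "compW \<equiv> Cmp (One W)"
abbreviation compC (infixr "\<odot>" 70) where "compC \<equiv> Cmp C"

lemma C: "category C"
  using N unfolding notion_of_discreteness_def by blast

lemma V: "twocategory V"
  by (rule twocategory_intcat[OF C])

lemma E2: "is_2functor W V E"
  using E unfolding associated_category_def by blast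

lemmas E_simps = twofunctor_simps[OF W V E2, simplified]
lemmas W_simps [simp] = category_One[OF W] category_Two[OF W] Ob_Two[OF W] src_tgt2[OF W]
  HC_Idn[OF W] HC_unit[OF W] wl_simps[OF W] wr_simps[OF W] C

lemma Incl_functor: "is_functor C (One W) (Incl N)"
  using N unfolding notion_of_discreteness_def adjunction_def by blast

lemma F_simps [simp]:
  "X \<in> Ob C \<Longrightarrow> F0 X \<in> Ob (One W)"
  "f \<in> Ar C \<Longrightarrow> F1 f \<in> Ar (One W)"
  "f \<in> Ar C \<Longrightarrow> Src (One W) (F1 f) = F0 (Src C f)"
  "f \<in> Ar C \<Longrightarrow> Tgt (One W) (F1 f) = F0 (Tgt C f)"
  using is_functorD[OF Incl_functor] by simp_all

lemma E_internal [simp]: "A \<in> Ob (One W) \<Longrightarrow> internal_category C (T0 E A)"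
  using E_simps(1) by simp

lemma theta_iso:
  assumes "A \<in> Ob (One W)" "X \<in> Ob C"
  shows "is_functor (homcat W (F0 X) A) (ext_fib C (T0 E A) X) (\<theta> A X)"
    "bij_betw (FO (\<theta> A X)) (hom (One W) (F0 X) A) (hom C X (I0 (T0 E A)))"
    "bij_betw (FA (\<theta> A X)) (Ar (homcat W (F0 X) A)) (hom C X (I1 (T0 E A)))"
  using E assms unfolding associated_category_def iso_functor_def by simp_all

lemma theta_Ob:
  assumes "X \<in> Ob C" "p \<in> Ar (One W)" "Src (One W) p = F0 X" "Tgt (One W) p = A"
  shows "FO (\<theta> A X) p \<in> Ar C" "Src C (FO (\<theta> A X) p) = X" "Tgt C (FO (\<theta> A X) p) = I0 (T0 E A)"
proof -
  have A: "A \<in> Ob (One W)" using assms by auto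
  show "FO (\<theta> A X) p \<in> Ar C" "Src C (FO (\<theta> A X) p) = X" "Tgt C (FO (\<theta> A X) p) = I0 (T0 E A)"
    using is_functorD(1)[OF theta_iso(1)[OF A assms(1)], of p] assms by (simp_all add: hom_iff)
qed

lemma theta_Ar:
  assumes X: "X \<in> Ob C" and a: "a \<in> Ar (Two W)" "Src (One W) (Src (Two W) a) = F0 X"
    "Tgt (One W) (Src (Two W) a) = A"
  shows "FA (\<theta> A X) a \<in> Ar C" "Src C (FA (\<theta> A X) a) = X" "Tgt C (FA (\<theta> A X) a) = I1 (T0 E A)"
    "idom (T0 E A) \<odot> FA (\<theta> A X) a = FO (\<theta> A X) (Src (Two W) a)"
    "icod (T0 E A) \<odot> FA (\<theta> A X) a = FO (\<theta> A X) (Tgt (Two W) a)"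
proof -
  have A: "A \<in> Ob (One W)" using assms by auto
  have "a \<in> Ar (homcat W (F0 X) A)" using a by (simp add: homcat_Ar_iff del: homcat_simps)
  then show "FA (\<theta> A X) a \<in> Ar C" "Src C (FA (\<theta> A X) a) = X" "Tgt C (FA (\<theta> A X) a) = I1 (T0 E A)"
    "idom (T0 E A) \<odot> FA (\<theta> A X) a = FO (\<theta> A X) (Src (Two W) a)"
    "icod (T0 E A) \<odot> FA (\<theta> A X) a = FO (\<theta> A X) (Tgt (Two W) a)"
    using bij_betwE[OF theta_iso(3)[OF A X]] is_functorD(3,4)[OF theta_iso(1)[OF A X], of a]
    by (simp_all add: hom_iff)
qed

lemma theta_Idn:
  assumes "X \<in> Ob C" "p \<in> Ar (One W)" "Src (One W) p = F0 X" "Tgt (One W) p = A"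
  shows "FA (\<theta> A X) (Idn (Two W) p) = iidn (T0 E A) \<odot> FO (\<theta> A X) p"
proof -
  have A: "A \<in> Ob (One W)" using assms by auto
  show ?thesis
    using is_functorD(5)[OF theta_iso(1)[OF A assms(1)], of p] assms by (simp add: hom_iff)
qed

lemma theta_Cmp:
  assumes X: "X \<in> Ob C" and a: "a \<in> Ar (Two W)" "Src (One W) (Src (Two W) a) = F0 X"
    "Tgt (One W) (Src (Two W) a) = A" and b: "b \<in> Ar (Two W)" "Tgt (Two W) a = Src (Two W) b"
  shows "FA (\<theta> A X) (Cmp (Two W) b a) = gcmp C (T0 E A) (FA (\<theta> A X) b) (FA (\<theta> A X) a)"
proof -
  have A: "A \<in> Ob (One W)" using assms by auto
  have "Src (One W) (Src (Two W) b) = F0 X" "Tgt (One W) (Src (Two W) b) = A"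
    using src_tgt2[OF W a(1)] a b by simp_all
  then show ?thesis
    using is_functorD(6)[OF theta_iso(1)[OF A X], of a b] a b by (simp add: src0_def tgt0_def)
qed

text \<open>Equations between 1-cells out of \<open>F0 X\<close> are proved by passing to
  generalised elements of the associated category; injectivity of \<open>\<theta>\<close> leads
  back.\<close>

lemma theta_Ob_eq:
  assumes "X \<in> Ob C" "p \<in> Ar (One W)" "Src (One W) p = F0 X" "Tgt (One W) p = A"
    "p' \<in> Ar (One W)" "Src (One W) p' = F0 X" "Tgt (One W) p' = A"
    and eq: "FO (\<theta> A X) p = FO (\<theta> A X) p'"
  shows "p = p'"
proof -
  have A: "A \<in> Ob (One W)" using assms by auto
  have "inj_on (FO (\<theta> A X)) (hom (One W) (F0 X) A)"
    using theta_iso(2)[OF A assms(1)] by (simp add: bij_betw_def)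
  then show ?thesis using assms by (auto simp: inj_on_def hom_iff)
qed

lemma theta_Ar_eq:
  assumes X: "X \<in> Ob C" and a: "a \<in> Ar (Two W)" "Src (One W) (Src (Two W) a) = F0 X"
    "Tgt (One W) (Src (Two W) a) = A"
    and b: "b \<in> Ar (Two W)" "Src (One W) (Src (Two W) b) = F0 X" "Tgt (One W) (Src (Two W) b) = A"
    and eq: "FA (\<theta> A X) a = FA (\<theta> A X) b"
  shows "a = b"
proof -
  have A: "A \<in> Ob (One W)" using assms by auto
  have "inj_on (FA (\<theta> A X)) (Ar (homcat W (F0 X) A))"
    using theta_iso(3)[OF A X] by (simp only: bij_betw_def)
  from inj_onD[OF this eq] show ?thesis
    using a b unfolding homcat_Ar_iff by simp
qed

text \<open>Reindexing along \<open>f\<close> is precomposition with \<open>F1 f\<close> on the side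
  of families and with \<open>f\<close> on the side of the externalisation.\<close>

lemma theta_natural_base:
  assumes f: "f \<in> Ar C" "Src C f = Y"
  shows "p \<in> Ar (One W) \<Longrightarrow> Src (One W) p = F0 (Tgt C f) \<Longrightarrow> Tgt (One W) p = A \<Longrightarrow>
      FO (\<theta> A Y) (p \<cdot> F1 f) = FO (\<theta> A (Tgt C f)) p \<odot> f"
    "a \<in> Ar (Two W) \<Longrightarrow> Src (One W) (Src (Two W) a) = F0 (Tgt C f) \<Longrightarrow>
      Tgt (One W) (Src (Two W) a) = A \<Longrightarrow>
      FA (\<theta> A Y) (wr W a (F1 f)) = FA (\<theta> A (Tgt C f)) a \<odot> f"
proof -
  have nat: "\<And>A. A \<in> Ob (One W) \<Longrightarrow> twonat K (fam W N A) (ext C (T0 E A)) (\<theta> A)"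
    using E unfolding associated_category_def by blast
  show "FO (\<theta> A Y) (p \<cdot> F1 f) = FO (\<theta> A (Tgt C f)) p \<odot> f"
    if "p \<in> Ar (One W)" "Src (One W) p = F0 (Tgt C f)" "Tgt (One W) p = A"
  proof -
    have "A \<in> Ob (One W)" using that by auto
    from twonatD(2)[OF nat[OF this], of f p] show ?thesis using that f by (simp add: hom_iff)
  qed
  show "FA (\<theta> A Y) (wr W a (F1 f)) = FA (\<theta> A (Tgt C f)) a \<odot> f"
    if "a \<in> Ar (Two W)" "Src (One W) (Src (Two W) a) = F0 (Tgt C f)" "Tgt (One W) (Src (Two W) a) = A"
  proof -
    have "A \<in> Ob (One W)" using that by auto
    from twonatD(3)[OF nat[OF this], of f a] show ?thesis using that f by (simp add: src0_def tgt0_def)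
  qed
qed

text \<open>These are the only links between \<open>E\<close> on cells and composition in
  \<open>W\<close>: through \<open>\<theta>\<close>, the maps \<open>i0\<close>, \<open>i1\<close>
  and \<open>tcmp\<close> of an image under \<open>E\<close> are the actions of the cell on 1-cells
  and 2-cells out of \<open>F0 X\<close>.\<close>

lemma theta_natural:
  assumes X: "X \<in> Ob C"
  shows "g \<in> Ar (One W) \<Longrightarrow> p \<in> Ar (One W) \<Longrightarrow> Src (One W) p = F0 X \<Longrightarrow> Tgt (One W) p = Src (One W) g \<Longrightarrow>
      Tgt (One W) g = B \<Longrightarrow> FO (\<theta> B X) (g \<cdot> p) = i0 (T1 E g) \<odot> FO (\<theta> (Src (One W) g) X) p"
    "g \<in> Ar (One W) \<Longrightarrow> a \<in> Ar (Two W) \<Longrightarrow> Src (One W) (Src (Two W) a) = F0 X \<Longrightarrow>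
      Tgt (One W) (Src (Two W) a) = Src (One W) g \<Longrightarrow>
      Tgt (One W) g = B \<Longrightarrow> FA (\<theta> B X) (wl W g a) = i1 (T1 E g) \<odot> FA (\<theta> (Src (One W) g) X) a"
    "c \<in> Ar (Two W) \<Longrightarrow> p \<in> Ar (One W) \<Longrightarrow> Src (One W) p = F0 X \<Longrightarrow>
      Tgt (One W) p = Src (One W) (Src (Two W) c) \<Longrightarrow> Tgt (One W) (Src (Two W) c) = B \<Longrightarrow>
      FA (\<theta> B X) (wr W c p) = tcmp (T2 E c) \<odot> FO (\<theta> (Src (One W) (Src (Two W) c)) X) p"
proof -
  have nat: "twonat W (hom_from W (F0 X) id_2functor) (ext_at C E X) (\<lambda>A. \<theta> A X)"
    using E X unfolding associated_category_def by blast
  show "FO (\<theta> B X) (g \<cdot> p) = i0 (T1 E g) \<odot> FO (\<theta> (Src (One W) g) X) p"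
    if "g \<in> Ar (One W)" "p \<in> Ar (One W)" "Src (One W) p = F0 X" "Tgt (One W) p = Src (One W) g"
      "Tgt (One W) g = B"
    using twonatD(2)[OF nat, of g p] that by (simp add: hom_iff id_2functor_def)
  show "FA (\<theta> B X) (wl W g a) = i1 (T1 E g) \<odot> FA (\<theta> (Src (One W) g) X) a"
    if "g \<in> Ar (One W)" "a \<in> Ar (Two W)" "Src (One W) (Src (Two W) a) = F0 X"
      "Tgt (One W) (Src (Two W) a) = Src (One W) g" "Tgt (One W) g = B"
    using twonatD(3)[OF nat, of g a] that by (simp add: src0_def tgt0_def id_2functor_def)
  show "FA (\<theta> B X) (wr W c p) = tcmp (T2 E c) \<odot> FO (\<theta> (Src (One W) (Src (Two W) c)) X) p"
    if "c \<in> Ar (Two W)" "p \<in> Ar (One W)" "Src (One W) p = F0 X"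
      "Tgt (One W) p = Src (One W) (Src (Two W) c)" "Tgt (One W) (Src (Two W) c) = B"
    using twonatD(4)[OF nat, of c p] that by (simp add: hom_iff src0_def tgt0_def id_2functor_def)
qed

text \<open>Inverses of \<open>\<theta> A X\<close> on objects and on arrows; their values outside the fibre are arbitrary.\<close>

definition name0 :: "'o \<Rightarrow> 'x \<Rightarrow> 'f \<Rightarrow> 'm" where
  "name0 A X = inv_into (hom (One W) (F0 X) A) (FO (\<theta> A X))"

definition name1 :: "'o \<Rightarrow> 'x \<Rightarrow> 'f \<Rightarrow> 'c" where
  "name1 A X = inv_into (Ar (homcat W (F0 X) A)) (FA (\<theta> A X))"

lemma name0:
  assumes A: "A \<in> Ob (One W)" and x: "x \<in> Ar C" "Src C x = X" "Tgt C x = I0 (T0 E A)"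
  shows "name0 A X x \<in> Ar (One W)" "Src (One W) (name0 A X x) = F0 X" "Tgt (One W) (name0 A X x) = A"
    "FO (\<theta> A X) (name0 A X x) = x"
proof -
  have X: "X \<in> Ob C" using x by auto
  have "x \<in> FO (\<theta> A X) ` hom (One W) (F0 X) A"
    using theta_iso(2)[OF A X] x by (simp add: bij_betw_def hom_iff)
  from inv_into_into[OF this] f_inv_into_f[OF this]
  show "name0 A X x \<in> Ar (One W)" "Src (One W) (name0 A X x) = F0 X" "Tgt (One W) (name0 A X x) = A"
    "FO (\<theta> A X) (name0 A X x) = x"
    unfolding name0_def by (simp_all add: hom_iff)
qed

lemma name1:
  assumes A: "A \<in> Ob (One W)" and x: "x \<in> Ar C" "Src C x = X" "Tgt C x = I1 (T0 E A)"
  shows "name1 A X x \<in> Ar (Two W)" "Src (One W) (Src (Two W) (name1 A X x)) = F0 X"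
    "Tgt (One W) (Src (Two W) (name1 A X x)) = A" "FA (\<theta> A X) (name1 A X x) = x"
proof -
  have X: "X \<in> Ob C" using x by auto
  have "x \<in> FA (\<theta> A X) ` Ar (homcat W (F0 X) A)"
    using theta_iso(3)[OF A X] x by (simp add: bij_betw_def hom_iff)
  from inv_into_into[OF this] f_inv_into_f[OF this]
  show "name1 A X x \<in> Ar (Two W)" "Src (One W) (Src (Two W) (name1 A X x)) = F0 X"
    "Tgt (One W) (Src (Two W) (name1 A X x)) = A" "FA (\<theta> A X) (name1 A X x) = x"
    unfolding name1_def homcat_Ar_iff by blast+
qed

section \<open>The image under \<open>E\<close> of terminal objects, products and counits\<close>

lemma E_terminal:
  assumes T: "is_terminal_object W T"
  shows "is_terminal_object V (T0 E T)"
proof (rule terminal_intcat[OF C])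
  have To: "T \<in> Ob (One W)" using T unfolding is_terminal_object_def by blast
  then show "internal_category C (T0 E T)" by simp
  fix X assume X: "X \<in> Ob C"
  have "\<exists>!f. f \<in> hom (One W) (F0 X) T" "\<exists>!a. a \<in> Ar (homcat W (F0 X) T)"
    using T X unfolding is_terminal_object_def by simp_all
  then show "\<exists>!f. f \<in> hom C X (I0 (T0 E T))" "\<exists>!f. f \<in> hom C X (I1 (T0 E T))"
    using ex1_bij_betw[OF theta_iso(2)[OF To X]] ex1_bij_betw[OF theta_iso(3)[OF To X]] by blast+
qed

text \<open>By \<open>\<theta>\<close>, maps from \<open>X\<close> into \<open>I0 (T0 E P)\<close>
  and \<open>I1 (T0 E P)\<close> are 1-cells and 2-cells from \<open>F0 X\<close> to
  \<open>P\<close>. The two halves of the universal property of \<open>P\<close> thus make these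
  objects products in the base.\<close>

lemma E_product:
  assumes P: "is_product W A B P p q"
  shows "is_product V (T0 E A) (T0 E B) (T0 E P) (T1 E p) (T1 E q)"
proof -
  note t = product_typing[OF W P]
  have univ: "\<And>X. X \<in> Ob (One W) \<Longrightarrow>
      (\<forall>f\<in>hom (One W) X A. \<forall>g\<in>hom (One W) X B.
        \<exists>!h. h \<in> hom (One W) X P \<and> p \<cdot> h = f \<and> q \<cdot> h = g) \<and>
      (\<forall>a\<in>Ar (homcat W X A). \<forall>b\<in>Ar (homcat W X B).
        \<exists>!c. c \<in> Ar (homcat W X P) \<and> wl W p c = a \<and> wl W q c = b)"
    using P unfolding is_product_def by blast
  show ?thesis
  proof (rule product_intcat[OF C])
    show "internal_functor C (T1 E p)" "isrc (T1 E p) = T0 E P" "itgt (T1 E p) = T0 E A"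
      "internal_functor C (T1 E q)" "isrc (T1 E q) = T0 E P" "itgt (T1 E q) = T0 E B"
      using t E_simps by simp_all
    then have h: "i0 (T1 E p) \<in> hom C (I0 (T0 E P)) (I0 (T0 E A))"
      "i0 (T1 E q) \<in> hom C (I0 (T0 E P)) (I0 (T0 E B))"
      "i1 (T1 E p) \<in> hom C (I1 (T0 E P)) (I1 (T0 E A))" "i1 (T1 E q) \<in> hom C (I1 (T0 E P)) (I1 (T0 E B))"
      by (simp_all add: hom_iff)
    have "\<exists>!h. h \<in> hom C X (I0 (T0 E P)) \<and> i0 (T1 E p) \<odot> h = f \<and> i0 (T1 E q) \<odot> h = g"
      if X: "X \<in> Ob C" and fg: "f \<in> hom C X (I0 (T0 E A))" "g \<in> hom C X (I0 (T0 E B))" for X f g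
      by (rule ex1_pair_transfer[OF theta_iso(2)[OF t(7) X] theta_iso(2)[OF t(8) X]
          theta_iso(2)[OF t(9) X] _ _ _ fg, where \<pi> = "\<lambda>z. p \<cdot> z" and \<rho> = "\<lambda>z. q \<cdot> z"])
        (use univ[of "F0 X"] X t theta_natural(1)[OF X] in \<open>auto simp: hom_iff\<close>)
    then show "is_product1 C (I0 (T0 E A)) (I0 (T0 E B)) (I0 (T0 E P)) (i0 (T1 E p)) (i0 (T1 E q))"
      using h unfolding is_product1_def by blast
    have "\<exists>!h. h \<in> hom C X (I1 (T0 E P)) \<and> i1 (T1 E p) \<odot> h = f \<and> i1 (T1 E q) \<odot> h = g"
      if X: "X \<in> Ob C" and fg: "f \<in> hom C X (I1 (T0 E A))" "g \<in> hom C X (I1 (T0 E B))" for X f g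
    proof (rule ex1_pair_transfer[OF theta_iso(3)[OF t(7) X] theta_iso(3)[OF t(8) X]
          theta_iso(3)[OF t(9) X] _ _ _ fg, where \<pi> = "\<lambda>z. wl W p z" and \<rho> = "\<lambda>z. wl W q z"])
      show "\<exists>!c. c \<in> Ar (homcat W (F0 X) P) \<and> wl W p c = a \<and> wl W q c = b"
        if "a \<in> Ar (homcat W (F0 X) A)" "b \<in> Ar (homcat W (F0 X) B)" for a b
        using univ[OF F_simps(1)[OF X]] that by blast
    qed (use X t theta_natural(2)[OF X] in \<open>simp_all add: src0_def tgt0_def\<close>)
    then show "is_product1 C (I1 (T0 E A)) (I1 (T0 E B)) (I1 (T0 E P)) (i1 (T1 E p)) (i1 (T1 E q))"
      using h unfolding is_product1_def by blast
  qed
qed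

lemma counit_simps:
  assumes "A \<in> Ob (One W)"
  shows "FO (Refl N) A \<in> Ob C" "Counit N A \<in> Ar (One W)" "Src (One W) (Counit N A) = discrete_part N A"
    "Tgt (One W) (Counit N A) = A" "discrete_part N A \<in> Ob (One W)"
proof -
  have adj: "adjunction C (One W) (Incl N) (Refl N) (Unit N) (Counit N)"
    using N unfolding notion_of_discreteness_def by blast
  then have "is_functor (One W) C (Refl N)" unfolding adjunction_def by blast
  from is_functorD(1)[OF this assms] show "FO (Refl N) A \<in> Ob C" .
  then show "discrete_part N A \<in> Ob (One W)" by (simp add: discrete_part_def)
  show "Counit N A \<in> Ar (One W)" "Src (One W) (Counit N A) = discrete_part N A"
    "Tgt (One W) (Counit N A) = A"
    using adj assms unfolding adjunction_def discrete_part_def by (auto simp: hom_iff)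
qed

text \<open>The adjunction identifies 1-cells \<open>F0 X \<rightarrow> A\<close> with maps
  \<open>X \<rightarrow> U A\<close>, and full faithfulness of the inclusion identifies those with
  1-cells into \<open>F (U A)\<close>.\<close>

lemma counit_bij:
  assumes A: "A \<in> Ob (One W)" and X: "X \<in> Ob C"
  shows "bij_betw (\<lambda>p. Counit N A \<cdot> p) (hom (One W) (F0 X) (discrete_part N A)) (hom (One W) (F0 X) A)"
proof -
  let ?U1 = "FA (Refl N)" and ?D = "FO (Refl N) A" and ?e = "Counit N A"
  have adj: "adjunction C (One W) (Incl N) (Refl N) (Unit N) (Counit N)"
    and ff: "iso_functor (disc_cat (hom C X ?D)) (homcat W (F0 X) (F0 ?D))
          \<lparr>FO = F1, FA = (\<lambda>f. Idn (Two W) (F1 f))\<rparr>"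
    using N X counit_simps(1)[OF A] unfolding notion_of_discreteness_def by blast+
  have F: "is_functor C (One W) (Incl N)" and U: "is_functor (One W) C (Refl N)"
    and \<eta>: "\<And>X. X \<in> Ob C \<Longrightarrow> Unit N X \<in> hom C X (FO (Refl N) (F0 X))"
    and \<eta>n: "\<And>f. f \<in> Ar C \<Longrightarrow> ?U1 (F1 f) \<odot> Unit N (Src C f) = Unit N (Tgt C f) \<odot> f"
    and \<epsilon>n: "\<And>u. u \<in> Ar (One W) \<Longrightarrow> u \<cdot> Counit N (Src (One W) u) = Counit N (Tgt (One W) u) \<cdot> F1 (?U1 u)"
    and t1: "\<And>X. X \<in> Ob C \<Longrightarrow> Counit N (F0 X) \<cdot> F1 (Unit N X) = Idn (One W) (F0 X)"
    and t2: "\<And>A. A \<in> Ob (One W) \<Longrightarrow> ?U1 (Counit N A) \<odot> Unit N (FO (Refl N) A) = Idn C (FO (Refl N) A)"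
    using adj unfolding adjunction_def by blast+
  note Fs = is_functorD[OF F] and Us = is_functorD[OF U]
  note e = counit_simps[OF A]
  have \<eta>': "Unit N Y \<in> Ar C" "Src C (Unit N Y) = Y" "Tgt C (Unit N Y) = FO (Refl N) (F0 Y)" if
    "Y \<in> Ob C" for Y
    using \<eta>[OF that] by (simp_all add: hom_iff)
  have bij: "bij_betw F1 (hom C X ?D) (hom (One W) (F0 X) (F0 ?D))"
    using ff unfolding iso_functor_def by simp
  \<comment> \<open>Naturality of the unit and the triangle identity at \<open>A\<close>; the
    converse \<open>sect\<close> uses naturality of the counit and the triangle identity at
    \<open>X\<close>.\<close>
  have retr: "?U1 (?e \<cdot> F1 f) \<odot> Unit N X = f" if f: "f \<in> hom C X ?D" for f
  proof -
    have f': "f \<in> Ar C" "Src C f = X" "Tgt C f = ?D" using f by (simp_all add: hom_iff)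
    have "?U1 (?e \<cdot> F1 f) \<odot> Unit N X = (?U1 ?e \<odot> ?U1 (F1 f)) \<odot> Unit N X"
      using f' e by (simp add: Us(6) discrete_part_def)
    also have "\<dots> = ?U1 ?e \<odot> (?U1 (F1 f) \<odot> Unit N X)"
      using f' e X \<eta>'[OF X] by (simp add: Us discrete_part_def)
    also have "?U1 (F1 f) \<odot> Unit N X = Unit N ?D \<odot> f"
      using \<eta>n[OF f'(1)] f' by simp
    also have "?U1 ?e \<odot> (Unit N ?D \<odot> f) = (?U1 ?e \<odot> Unit N ?D) \<odot> f"
      using f' e \<eta>'[OF e(1)] by (simp add: Us discrete_part_def)
    also have "\<dots> = f" using t2[OF A] f' by simp
    finally show ?thesis .
  qed
  have sect: "?U1 u \<odot> Unit N X \<in> hom C X ?D \<and> ?e \<cdot> F1 (?U1 u \<odot> Unit N X) = u" if u: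
    "u \<in> hom (One W) (F0 X) A" for u
  proof
    have u': "u \<in> Ar (One W)" "Src (One W) u = F0 X" "Tgt (One W) u = A" using u
      by (simp_all add: hom_iff)
    note x = counit_simps[of "F0 X"]
    show "?U1 u \<odot> Unit N X \<in> hom C X ?D" using u' X \<eta>' by (simp add: hom_iff Us)
    have "?e \<cdot> F1 (?U1 u \<odot> Unit N X) = ?e \<cdot> (F1 (?U1 u) \<cdot> F1 (Unit N X))"
      using u' X \<eta>'[OF X] by (simp add: Us Fs(6))
    also have "\<dots> = (?e \<cdot> F1 (?U1 u)) \<cdot> F1 (Unit N X)"
      using u' X \<eta>'[OF X] e by (simp add: Us discrete_part_def)
    also have "?e \<cdot> F1 (?U1 u) = u \<cdot> Counit N (F0 X)" using \<epsilon>n[OF u'(1)] u' by simp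
    also have "\<dots> \<cdot> F1 (Unit N X) = u \<cdot> (Counit N (F0 X) \<cdot> F1 (Unit N X))"
      using u' X \<eta>'[OF X] x by (simp add: discrete_part_def)
    also have "\<dots> = u" using t1[OF X] u' by simp
    finally show "?e \<cdot> F1 (?U1 u \<odot> Unit N X) = u" .
  qed
  have "bij_betw (\<lambda>f. ?e \<cdot> F1 f) (hom C X ?D) (hom (One W) (F0 X) A)"
  proof (rule bij_betw_byWitness[where f' = "\<lambda>u. ?U1 u \<odot> Unit N X"])
    show "(\<lambda>f. ?e \<cdot> F1 f) ` hom C X ?D \<subseteq> hom (One W) (F0 X) A"
      using e by (auto simp: hom_iff discrete_part_def)
  qed (use retr sect in auto)
  \<comment> \<open>The adjunction bijection is composition with the counit after the bijection
    \<open>F1\<close>, so \<open>F1\<close> can be cancelled.\<close>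
  then have b: "bij_betw ((\<lambda>p. ?e \<cdot> p) \<circ> F1) (hom C X ?D) (hom (One W) (F0 X) A)"
    by (simp add: comp_def)
  show ?thesis
    using bij_betw_comp_iff[OF bij, of "\<lambda>p. ?e \<cdot> p"] b by (simp add: discrete_part_def)
qed

text \<open>Full faithfulness on hom-categories makes every 2-cell between discrete objects an
  identity. Through \<open>\<theta>\<close> this says that the universal arrow of \<open>B\<close>,
  hence every arrow, is an identity.\<close>

lemma E_discrete:
  assumes X: "X \<in> Ob C"
  defines "B \<equiv> T0 E (F0 X)"
  shows "iidn B \<odot> idom B = Idn C (I1 B)"
proof -
  have FX: "F0 X \<in> Ob (One W)" using X by simp
  have B: "internal_category C B" unfolding B_def using FX by simp
  let ?Y = "I1 B"
  have Y: "?Y \<in> Ob C" using B by simp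
  \<comment> \<open>The 2-cell that corresponds to the universal arrow of \<open>B\<close>.\<close>
  let ?a = "name1 (F0 X) ?Y (Idn C ?Y)"
  have a: "?a \<in> Ar (Two W)" "Src (One W) (Src (Two W) ?a) = F0 ?Y" "Tgt (One W) (Src (Two W) ?a) = F0 X"
    "FA (\<theta> (F0 X) ?Y) ?a = Idn C ?Y"
    using name1[OF FX, of "Idn C ?Y" ?Y] Y by (simp_all add: B_def)
  have "iso_functor (disc_cat (hom C ?Y X)) (homcat W (F0 ?Y) (F0 X))
          \<lparr>FO = F1, FA = (\<lambda>f. Idn (Two W) (F1 f))\<rparr>"
    using N X Y unfolding notion_of_discreteness_def by blast
  then have "?a \<in> (\<lambda>f. Idn (Two W) (F1 f)) ` hom C ?Y X"
    using a unfolding iso_functor_def bij_betw_def by (simp add: src0_def tgt0_def)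
  then obtain f where f: "f \<in> Ar C" "Src C f = ?Y" "Tgt C f = X" "?a = Idn (Two W) (F1 f)"
    by (auto simp: hom_iff)
  let ?x = "FO (\<theta> (F0 X) ?Y) (F1 f)"
  have x: "?x \<in> Ar C" "Src C ?x = ?Y" "Tgt C ?x = I0 B"
    using theta_Ob[OF Y, of "F1 f" "F0 X"] f unfolding B_def by simp_all
  have i: "Idn C ?Y = iidn B \<odot> ?x"
  proof -
    have "Idn C ?Y = FA (\<theta> (F0 X) ?Y) (Idn (Two W) (F1 f))"
      using a(4) unfolding f(4) by (rule sym)
    also have "\<dots> = iidn (T0 E (F0 X)) \<odot> ?x"
      using f(1-3) by (intro theta_Idn[OF Y]) simp_all
    finally show ?thesis by (simp only: B_def)
  qed
  \<comment> \<open>The universal arrow is the identity at \<open>?x\<close>; taking domains shows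
    that \<open>?x\<close> is \<open>idom B\<close>.\<close>
  have "idom B \<odot> (iidn B \<odot> ?x) = ?x"
    using B x by simp
  then have "idom B = ?x"
    using B by (simp flip: i)
  then show ?thesis by (simp only: i)
qed

text \<open>By \<open>counit_bij\<close> and \<open>\<theta>\<close>, composition with
  \<open>?ee\<close> is bijective on maps from every \<open>X\<close>, so \<open>?ee\<close> is
  invertible by Yoneda.\<close>

lemma E_counit_inverse:
  assumes A: "A \<in> Ob (One W)"
  obtains v where "v \<in> hom C (I0 (T0 E A)) (I0 (T0 E (discrete_part N A)))"
    "i0 (T1 E (Counit N A)) \<odot> v = Idn C (I0 (T0 E A))"
    "v \<odot> i0 (T1 E (Counit N A)) = Idn C (I0 (T0 E (discrete_part N A)))"
proof -
  let ?e = "Counit N A" and ?D = "discrete_part N A"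
  let ?ee = "i0 (T1 E ?e)"
  note e = counit_simps[OF A]
  have e0: "?ee \<in> Ar C" "Src C ?ee = I0 (T0 E ?D)" "Tgt C ?ee = I0 (T0 E A)"
    using e E_simps by simp_all
  have I: "internal_category C (T0 E A)" "internal_category C (T0 E ?D)" using A e by simp_all
  have surj: "\<exists>x. x \<in> Ar C \<and> Src C x = X \<and> Tgt C x = I0 (T0 E ?D) \<and> ?ee \<odot> x = y"
    if y: "y \<in> Ar C" "Src C y = X" "Tgt C y = I0 (T0 E A)" for X y
  proof -
    have X: "X \<in> Ob C" using y by auto
    note n = name0[OF A y]
    have "name0 A X y \<in> (\<lambda>p. ?e \<cdot> p) ` hom (One W) (F0 X) ?D"
      using counit_bij[OF A X] n by (simp add: bij_betw_def hom_iff)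
    then obtain p where p: "p \<in> Ar (One W)" "Src (One W) p = F0 X" "Tgt (One W) p = ?D" "?e \<cdot> p =
        name0 A X y"
      by (auto simp: hom_iff)
    have "?ee \<odot> FO (\<theta> ?D X) p = y"
      using theta_natural(1)[OF X e(2) p(1,2) _ e(4)] p e n by simp
    then show ?thesis using theta_Ob[OF X p(1-3)] by blast
  qed
  have inj: "x = x'"
    if x: "x \<in> Ar C" "Src C x = X" "Tgt C x = I0 (T0 E ?D)"
      and x': "x' \<in> Ar C" "Src C x' = X" "Tgt C x' = I0 (T0 E ?D)"
      and eq: "?ee \<odot> x = ?ee \<odot> x'" for X x x'
  proof -
    have X: "X \<in> Ob C" using x by auto
    note n = name0[OF e(5) x] and n' = name0[OF e(5) x']
    have "FO (\<theta> A X) (?e \<cdot> name0 ?D X x) = FO (\<theta> A X) (?e \<cdot> name0 ?D X x')"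
      using theta_natural(1)[OF X e(2) n(1,2) _ e(4)] theta_natural(1)[OF X e(2) n'(1,2) _
          e(4)] n n' e eq
      by simp
    then have "?e \<cdot> name0 ?D X x = ?e \<cdot> name0 ?D X x'"
      by (rule theta_Ob_eq[OF X, rotated -1]) (use n n' e in simp_all)
    moreover have "inj_on (\<lambda>p. ?e \<cdot> p) (hom (One W) (F0 X) ?D)"
      using counit_bij[OF A X] by (simp add: bij_betw_def)
    ultimately have "name0 ?D X x = name0 ?D X x'"
      using n n' by (auto simp: inj_on_def hom_iff)
    then show ?thesis using n(4) n'(4) by metis
  qed
  \<comment> \<open>The inverse is the preimage of the identity. It is two-sided by injectivity,
    because \<open>?ee \<odot> (v \<odot> ?ee) = ?ee\<close>.\<close>
  obtain v where v: "v \<in> Ar C" "Src C v = I0 (T0 E A)" "Tgt C v = I0 (T0 E ?D)" "?ee \<odot> v =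
      Idn C (I0 (T0 E A))"
    using surj[of "Idn C (I0 (T0 E A))" "I0 (T0 E A)"] I by auto
  have "v \<odot> ?ee = Idn C (I0 (T0 E ?D))"
    by (rule inj[of _ "I0 (T0 E ?D)"]) (use v e0 I Cmp_extend[OF C v(4)] in simp_all)
  then show ?thesis using that[of v] v by (simp add: hom_iff)
qed

text \<open>The discrete part of \<open>T0 E A\<close> is the image of that of \<open>A\<close> only up to the isomorphism \<open>j\<close>.\<close>

lemma E_discrete_part:
  assumes A: "A \<in> Ob (One W)"
  defines "N' \<equiv> standard_discreteness C"
  obtains j j' where "inverses V j j'" "j \<in> hom (One V) (T0 E (discrete_part N A)) (discrete_part
      N' (T0 E A))"
    "Cmp (One V) (Counit N' (T0 E A)) j = T1 E (Counit N A)"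
    "Counit N' (T0 E A) \<in> hom (One V) (discrete_part N' (T0 E A)) (T0 E A)"
proof -
  note e = counit_simps[OF A]
  let ?B = "T0 E (discrete_part N A)" and ?D = "idisc C (I0 (T0 E A))"
  have e': "internal_functor C (T1 E (Counit N A))" "isrc (T1 E (Counit N A)) = ?B"
    "itgt (T1 E (Counit N A)) = T0 E A"
    using e E_simps by simp_all
  have B: "iidn ?B \<odot> idom ?B = Idn C (I1 ?B)"
    unfolding discrete_part_def by (rule E_discrete[OF e(1)])
  have D: "discrete_part N' (T0 E A) = ?D" "Counit N' (T0 E A) = \<lparr>isrc = ?D, itgt = T0 E A,
      i0 = Idn C (I0 (T0 E A)), i1 = iidn (T0 E A)\<rparr>"
    by (simp_all add: N'_def discrete_part_def standard_discreteness_def)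
  obtain v where v: "v \<in> hom C (I0 (T0 E A)) (I0 ?B)"
    "i0 (T1 E (Counit N A)) \<odot> v = Idn C (I0 (T0 E A))"
    "v \<odot> i0 (T1 E (Counit N A)) = Idn C (I0 ?B)"
    by (rule E_counit_inverse[OF A])
  obtain j j' where j: "j \<in> hom (One V) ?B ?D" "j' \<in> hom (One V) ?D ?B"
    "Cmp (One V) j' j = Idn (One V) ?B" "Cmp (One V) j j' = Idn (One V) ?D"
    "Cmp (One V) (Counit N' (T0 E A)) j = T1 E (Counit N A)"
    using discrete_internal_iso[OF C e' B v] unfolding D by blast
  have "inverses V j j'"
    using j(1-4) unfolding inverses_def by (simp add: hom_iff)
  moreover have "internal_functor C (Counit N' (T0 E A))"
    unfolding D by (rule internal_functor_counit[OF C]) (use A in simp)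
  ultimately show ?thesis
    using j that[of j j'] by (simp add: D hom_iff)
qed

text \<open>An internal functor acts on externalisations by composition with
  \<open>i0 \<phi>\<close> and \<open>i1 \<phi>\<close>. Conjugation by \<open>\<theta>\<close>
  moves this action to families, where density applies. Every equation is checked after the
  injective \<open>\<theta> B X\<close>.\<close>

lemma ext_conjugate_twonat:
  assumes A: "A \<in> Ob (One W)" "B \<in> Ob (One W)"
    and \<phi>: "internal_functor C \<phi>" "isrc \<phi> = T0 E A" "itgt \<phi> = T0 E B"
  shows "twonat K (fam W N A) (fam W N B)
    (\<lambda>X. \<lparr>FO = \<lambda>p. name0 B X (i0 \<phi> \<odot> FO (\<theta> A X) p), FA = \<lambda>a. name1 B X (i1 \<phi> \<odot> FA (\<theta> A X) a)\<rparr>)"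
    (is "twonat _ _ _ (\<lambda>X. \<lparr>FO = ?\<beta> X, FA = ?\<gamma> X\<rparr>)")
proof -
  have I: "internal_category C (T0 E A)" "internal_category C (T0 E B)" using A by simp_all
  have \<beta>: "?\<beta> X p \<in> Ar (One W)" "Src (One W) (?\<beta> X p) = F0 X" "Tgt (One W) (?\<beta> X p) = B"
      "FO (\<theta> B X) (?\<beta> X p) = i0 \<phi> \<odot> FO (\<theta> A X) p"
    if p: "X \<in> Ob C" "p \<in> Ar (One W)" "Src (One W) p = F0 X" "Tgt (One W) p = A" for X p
    using name0[OF A(2), of "i0 \<phi> \<odot> FO (\<theta> A X) p" X] theta_Ob[OF p] \<phi> by simp_all
  have \<gamma>: "?\<gamma> X a \<in> Ar (Two W)" "Src (One W) (Src (Two W) (?\<gamma> X a)) = F0 X"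
      "Tgt (One W) (Src (Two W) (?\<gamma> X a)) = B" "FA (\<theta> B X) (?\<gamma> X a) = i1 \<phi> \<odot> FA (\<theta> A X) a"
    if a: "X \<in> Ob C" "a \<in> Ar (Two W)" "Src (One W) (Src (Two W) a) = F0 X"
      "Tgt (One W) (Src (Two W) a) = A" for X a
    using name1[OF A(2), of "i1 \<phi> \<odot> FA (\<theta> A X) a" X] theta_Ar(1-3)[OF a] \<phi> by simp_all
  \<comment> \<open>Boundaries are respected because \<open>\<phi>\<close> commutes with domain and
    codomain, and \<open>\<theta>\<close> takes the source and target of a 2-cell to these.\<close>
  have s: "Src (Two W) (?\<gamma> X a) = ?\<beta> X (Src (Two W) a)" "Tgt (Two W) (?\<gamma> X a) = ?\<beta> X (Tgt (Two W) a)"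
    if a: "X \<in> Ob C" "a \<in> Ar (Two W)" "Src (One W) (Src (Two W) a) = F0 X"
      "Tgt (One W) (Src (Two W) a) = A" for X a
  proof -
    note g = \<gamma>[OF a] and t = theta_Ar[OF a]
    have s: "Src (Two W) a \<in> Ar (One W)" "Tgt (Two W) a \<in> Ar (One W)"
      "Src (One W) (Tgt (Two W) a) = F0 X" "Tgt (One W) (Tgt (Two W) a) = A"
      using a by simp_all
    note bs = \<beta>[OF a(1) s(1) a(3,4)] and bt = \<beta>[OF a(1) s(2-4)]
    have g': "Src (Two W) (?\<gamma> X a) \<in> Ar (One W)" "Tgt (Two W) (?\<gamma> X a) \<in> Ar (One W)"
      "Src (One W) (Tgt (Two W) (?\<gamma> X a)) = F0 X" "Tgt (One W) (Tgt (Two W) (?\<gamma> X a)) = B"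
      using src_tgt2[OF W g(1)] g(2,3) by simp_all
    have e: "FO (\<theta> B X) (Src (Two W) (?\<gamma> X a)) = FO (\<theta> B X) (?\<beta> X (Src (Two W) a))"
      "FO (\<theta> B X) (Tgt (Two W) (?\<gamma> X a)) = FO (\<theta> B X) (?\<beta> X (Tgt (Two W) a))"
      unfolding bs(4) bt(4) theta_Ar(4,5)[OF a(1) g(1-3), symmetric] g(4)
      using functor_dom(2)[OF C \<phi>(1,3), of "FA (\<theta> A X) a"] functor_cod(2)[OF C \<phi>(1,3), of
        "FA (\<theta> A X) a"] t \<phi>(2)
      by simp_all
    show "Src (Two W) (?\<gamma> X a) = ?\<beta> X (Src (Two W) a)"
      by (rule theta_Ob_eq[OF a(1) g'(1) g(2,3) bs(1-3) e(1)])
    show "Tgt (Two W) (?\<gamma> X a) = ?\<beta> X (Tgt (Two W) a)"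
      by (rule theta_Ob_eq[OF a(1) g'(2-4) bt(1-3) e(2)])
  qed
  have i: "?\<gamma> X (Idn (Two W) p) = Idn (Two W) (?\<beta> X p)"
    if p: "X \<in> Ob C" "p \<in> Ar (One W)" "Src (One W) p = F0 X" "Tgt (One W) p = A" for X p
  proof -
    note b = \<beta>[OF p]
    have a: "Idn (Two W) p \<in> Ar (Two W)" "Src (One W) (Src (Two W) (Idn (Two W) p)) = F0 X"
      "Tgt (One W) (Src (Two W) (Idn (Two W) p)) = A" using p by simp_all
    note g = \<gamma>[OF p(1) a]
    have "FA (\<theta> B X) (?\<gamma> X (Idn (Two W) p)) = FA (\<theta> B X) (Idn (Two W) (?\<beta> X p))"
      using g(4) functor_iidn(2)[OF C \<phi>(1,2)] theta_Ob[OF p] \<phi>(3)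
      by (simp add: theta_Idn[OF p] theta_Idn[OF p(1) b(1-3)] b(4))
    then show ?thesis
      by (rule theta_Ar_eq[OF p(1) g(1-3), rotated -1]) (use b in simp_all)
  qed
  have c: "?\<gamma> X (Cmp (Two W) b a) = Cmp (Two W) (?\<gamma> X b) (?\<gamma> X a)"
    if a: "X \<in> Ob C" "a \<in> Ar (Two W)" "Src (One W) (Src (Two W) a) = F0 X"
      "Tgt (One W) (Src (Two W) a) = A"
      and b: "b \<in> Ar (Two W)" "Tgt (Two W) a = Src (Two W) b" for X a b
  proof -
    have b': "Src (One W) (Src (Two W) b) = F0 X" "Tgt (One W) (Src (Two W) b) = A"
      using src_tgt2[OF W a(2)] a(3,4) b by simp_all
    have ba: "Cmp (Two W) b a \<in> Ar (Two W)" "Src (One W) (Src (Two W) (Cmp (Two W) b a)) = F0 X"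
      "Tgt (One W) (Src (Two W) (Cmp (Two W) b a)) = A" using a b by simp_all
    note ga = \<gamma>[OF a] and gb = \<gamma>[OF a(1) b(1) b'] and gba = \<gamma>[OF a(1) ba]
    have st: "Tgt (Two W) (?\<gamma> X a) = Src (Two W) (?\<gamma> X b)"
      unfolding s[OF a] s[OF a(1) b(1) b'] b(2) ..
    have "FA (\<theta> B X) (?\<gamma> X (Cmp (Two W) b a)) = FA (\<theta> B X) (Cmp (Two W) (?\<gamma> X b) (?\<gamma> X a))"
      using gba(4) functor_gcmp[OF C \<phi>(1,2)] theta_Ar[OF a] theta_Ar[OF a(1) b(1) b'] \<phi>(3) b(2)
      by (simp add: theta_Cmp[OF a b] theta_Cmp[OF a(1) ga(1-3) gb(1) st] ga(4) gb(4))
    then show ?thesis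
      by (rule theta_Ar_eq[OF a(1) gba(1-3), rotated -1]) (use ga gb st in simp_all)
  qed
  have n0: "?\<beta> (Src C f) (p \<cdot> F1 f) = ?\<beta> (Tgt C f) p \<cdot> F1 f"
    if f: "f \<in> Ar C" and p: "p \<in> Ar (One W)" "Src (One W) p = F0 (Tgt C f)" "Tgt (One W) p = A" for f p
  proof -
    have X: "Tgt C f \<in> Ob C" "Src C f \<in> Ob C" using f C by simp_all
    have pf: "p \<cdot> F1 f \<in> Ar (One W)" "Src (One W) (p \<cdot> F1 f) = F0 (Src C f)" "Tgt (One W) (p \<cdot> F1 f) = A"
      using p f by simp_all
    note b = \<beta>[OF X(1) p] and bf = \<beta>[OF X(2) pf]
    have "FO (\<theta> B (Src C f)) (?\<beta> (Src C f) (p \<cdot> F1 f)) = FO (\<theta> B (Src C f)) (?\<beta> (Tgt C f) p \<cdot> F1 f)"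
      using bf(4) theta_Ob[OF X(1) p] \<phi> f
      by (simp add: theta_natural_base(1)[OF f refl p] theta_natural_base(1)[OF f refl b(1-3)] b(4))
    then show ?thesis
      by (rule theta_Ob_eq[OF X(2) bf(1-3), rotated -1]) (use b f in simp_all)
  qed
  have n1: "?\<gamma> (Src C f) (wr W a (F1 f)) = wr W (?\<gamma> (Tgt C f) a) (F1 f)"
    if f: "f \<in> Ar C" and a: "a \<in> Ar (Two W)" "Src (One W) (Src (Two W) a) = F0 (Tgt C f)"
      "Tgt (One W) (Src (Two W) a) = A" for f a
  proof -
    have X: "Tgt C f \<in> Ob C" "Src C f \<in> Ob C" using f C by simp_all
    have af: "wr W a (F1 f) \<in> Ar (Two W)" "Src (One W) (Src (Two W) (wr W a (F1 f))) = F0 (Src C f)"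
      "Tgt (One W) (Src (Two W) (wr W a (F1 f))) = A"
      using a f by simp_all
    note g = \<gamma>[OF X(1) a] and gf = \<gamma>[OF X(2) af]
    have "FA (\<theta> B (Src C f)) (?\<gamma> (Src C f) (wr W a (F1 f))) =
        FA (\<theta> B (Src C f)) (wr W (?\<gamma> (Tgt C f) a) (F1 f))"
      using gf(4) theta_Ar[OF X(1) a] \<phi> f
      by (simp add: theta_natural_base(2)[OF f refl a] theta_natural_base(2)[OF f refl g(1-3)] g(4))
    then show ?thesis
      by (rule theta_Ar_eq[OF X(2) gf(1-3), rotated -1]) (use g f in simp_all)
  qed
  have fn: "is_functor (homcat W (F0 X) A) (homcat W (F0 X) B) \<lparr>FO = ?\<beta> X, FA = ?\<gamma> X\<rparr>" if X:
    "X \<in> Ob C" for X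
    unfolding is_functor_def
  proof (intro conjI ballI impI)
    fix p assume "p \<in> Ob (homcat W (F0 X) A)"
    then have p: "p \<in> Ar (One W)" "Src (One W) p = F0 X" "Tgt (One W) p = A" by (simp_all add: hom_iff)
    show "FO \<lparr>FO = ?\<beta> X, FA = ?\<gamma> X\<rparr> p \<in> Ob (homcat W (F0 X) B)"
      using \<beta>[OF X p] by (simp add: hom_iff)
    show "FA \<lparr>FO = ?\<beta> X, FA = ?\<gamma> X\<rparr> (Idn (homcat W (F0 X) A) p) =
        Idn (homcat W (F0 X) B) (FO \<lparr>FO = ?\<beta> X, FA = ?\<gamma> X\<rparr> p)"
      using i[OF X p] by simp
  next
    fix a assume "a \<in> Ar (homcat W (F0 X) A)"
    then have a: "a \<in> Ar (Two W)" "Src (One W) (Src (Two W) a) = F0 X" "Tgt (One W) (Src (Two W) a) = A"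
      unfolding homcat_Ar_iff by blast+
    show "FA \<lparr>FO = ?\<beta> X, FA = ?\<gamma> X\<rparr> a \<in> hom (homcat W (F0 X) B)
        (FO \<lparr>FO = ?\<beta> X, FA = ?\<gamma> X\<rparr> (Src (homcat W (F0 X) A) a)) (FO \<lparr>FO = ?\<beta> X, FA =
            ?\<gamma> X\<rparr> (Tgt (homcat W (F0 X) A) a))"
      using \<gamma>[OF X a] s[OF X a] by (simp add: hom_iff src0_def tgt0_def)
    fix b assume "b \<in> Ar (homcat W (F0 X) A)" "Tgt (homcat W (F0 X) A) a = Src (homcat W (F0 X) A) b"
    then show "FA \<lparr>FO = ?\<beta> X, FA = ?\<gamma> X\<rparr> (Cmp (homcat W (F0 X) A) b a) =
        Cmp (homcat W (F0 X) B) (FA \<lparr>FO = ?\<beta> X, FA = ?\<gamma> X\<rparr> b) (FA \<lparr>FO = ?\<beta> X, FA = ?\<gamma> X\<rparr> a)"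
      using c[OF X a, of b] by simp
  qed
  show ?thesis
    unfolding twonat_def
  proof (intro conjI ballI)
    fix X assume "X \<in> Ob (One K)"
    then show "is_functor (Fib (fam W N A) X) (Fib (fam W N B) X) \<lparr>FO = ?\<beta> X, FA = ?\<gamma> X\<rparr>"
      using fn by simp
  next
    fix f p assume "f \<in> Ar (One K)" "p \<in> Ob (Fib (fam W N A) (Src (One K) f))"
    then show "FO \<lparr>FO = ?\<beta> (Tgt (One K) f), FA = ?\<gamma> (Tgt (One K) f)\<rparr> (FO (Tr (fam W N A) f) p) =
       FO (Tr (fam W N B) f) (FO \<lparr>FO = ?\<beta> (Src (One K) f), FA = ?\<gamma> (Src (One K) f)\<rparr> p)"
      using n0[of f p] by (simp add: hom_iff)
  next
    fix f a assume "f \<in> Ar (One K)" "a \<in> Ar (Fib (fam W N A) (Src (One K) f))"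
    then show "FA \<lparr>FO = ?\<beta> (Tgt (One K) f), FA = ?\<gamma> (Tgt (One K) f)\<rparr> (FA (Tr (fam W N A) f) a) =
       FA (Tr (fam W N B) f) (FA \<lparr>FO = ?\<beta> (Src (One K) f), FA = ?\<gamma> (Src (One K) f)\<rparr> a)"
      using n1[of f a] by (simp add: src0_def tgt0_def)
  next
    fix f p assume "f \<in> Ar (Two K)" "p \<in> Ob (Fib (fam W N A) (src0 K f))"
    then have fp: "f \<in> Ar C" "p \<in> Ar (One W)" "Src (One W) p = F0 (Tgt C f)" "Tgt (One W) p = A"
      by (simp_all add: hom_iff)
    then show "FA \<lparr>FO = ?\<beta> (tgt0 K f), FA = ?\<gamma> (tgt0 K f)\<rparr> (Tr2 (fam W N A) f p) =
       Tr2 (fam W N B) f (FO \<lparr>FO = ?\<beta> (src0 K f), FA = ?\<gamma> (src0 K f)\<rparr> p)"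
      \<comment> \<open>The indexing 2-category has only identity 2-cells, so this clause follows
        from naturality on objects and preservation of identities.\<close>
      using n0[OF fp] i[of "Src C f" "p \<cdot> F1 f"] by simp
  qed
qed

section \<open>Dense discrete objects make \<open>E\<close> an isomorphism on hom-categories\<close>

context
  assumes dense: "discrete_objects_dense W N"
begin

lemma dense_iso:
  assumes "A \<in> Ob (One W)" "B \<in> Ob (One W)"
  shows "iso_to_transf (homcat W A B) K (fam W N A) (fam W N B)
    (\<lambda>u X. \<lparr>FO = (\<lambda>p. u \<cdot> p), FA = (\<lambda>a. wl W u a)\<rparr>) (\<lambda>c X p. wr W c p)"
  using dense assms unfolding discrete_objects_dense_def by blast

text \<open>An internal functor \<open>T0 E A \<rightarrow> T0 E B\<close> is determined by its effect on the universal objects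
  and arrows, i.e. on the identities of \<open>I0 (T0 E A)\<close> and \<open>I1 (T0 E A)\<close>.\<close>

lemma E_full1:
  assumes A: "A \<in> Ob (One W)" "B \<in> Ob (One W)"
    and \<phi>: "\<phi> \<in> hom (One V) (T0 E A) (T0 E B)"
  shows "\<phi> \<in> T1 E ` hom (One W) A B"
proof -
  have \<phi>': "internal_functor C \<phi>" "isrc \<phi> = T0 E A" "itgt \<phi> = T0 E B" using \<phi> by (simp_all add: hom_iff)
  have I: "internal_category C (T0 E A)" "internal_category C (T0 E B)" using A by simp_all
  \<comment> \<open>Density realises the conjugated action of \<open>\<phi>\<close> as composition
    with a 1-cell \<open>u\<close>.\<close>
  from ex1_implies_ex[OF iso_to_transfD(3)[OF dense_iso[OF A] ext_conjugate_twonat[OF A \<phi>']]]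
  obtain u where u: "u \<in> hom (One W) A B"
    and u0: "\<And>X p. X \<in> Ob C \<Longrightarrow> p \<in> hom (One W) (F0 X) A \<Longrightarrow> u \<cdot> p = name0 B X (i0 \<phi> \<odot> FO (\<theta> A X) p)"
    and u1: "\<And>X a. X \<in> Ob C \<Longrightarrow> a \<in> Ar (homcat W (F0 X) A) \<Longrightarrow> wl W u a = name1 B X (i1 \<phi> \<odot> FA (\<theta> A X) a)"
    by (elim exE conjE) (rule that; simp del: homcat_simps(2); blast)
  have u': "u \<in> Ar (One W)" "Src (One W) u = A" "Tgt (One W) u = B" using u by (simp_all add: hom_iff)
  have Eu: "internal_functor C (T1 E u)" "isrc (T1 E u) = T0 E A" "itgt (T1 E u) = T0 E B"
    using u' E_simps by simp_all
  have "i0 (T1 E u) = i0 \<phi>"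
  proof -
    let ?X = "I0 (T0 E A)"
    have X: "?X \<in> Ob C" using I by simp
    let ?p = "name0 A ?X (Idn C ?X)"
    have p: "?p \<in> Ar (One W)" "Src (One W) ?p = F0 ?X" "Tgt (One W) ?p = A" "FO (\<theta> A ?X) ?p = Idn C ?X"
      using name0[OF A(1), of "Idn C ?X" ?X] X by simp_all
    have "i0 (T1 E u) = FO (\<theta> B ?X) (u \<cdot> ?p)"
      using theta_natural(1)[OF X u'(1) p(1,2) _ u'(3)] p u' Eu by simp
    also have "u \<cdot> ?p = name0 B ?X (i0 \<phi>)"
      using u0[OF X, of ?p] p \<phi>' by (simp add: hom_iff)
    also have "FO (\<theta> B ?X) \<dots> = i0 \<phi>"
      using name0(4)[OF A(2), of "i0 \<phi>" ?X] \<phi>' by simp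
    finally show ?thesis .
  qed
  moreover have "i1 (T1 E u) = i1 \<phi>"
  proof -
    let ?X = "I1 (T0 E A)"
    have X: "?X \<in> Ob C" using I by simp
    let ?p = "name1 A ?X (Idn C ?X)"
    have p: "?p \<in> Ar (Two W)" "Src (One W) (Src (Two W) ?p) = F0 ?X" "Tgt (One W) (Src (Two W) ?p) = A"
      "FA (\<theta> A ?X) ?p = Idn C ?X"
      using name1[OF A(1), of "Idn C ?X" ?X] X by simp_all
    have "i1 (T1 E u) = FA (\<theta> B ?X) (wl W u ?p)"
      using theta_natural(2)[OF X u'(1) p(1,2) _ u'(3)] p u' Eu by simp
    also have "wl W u ?p = name1 B ?X (i1 \<phi>)"
      using u1[OF X, of ?p] p \<phi>' by (simp add: src0_def tgt0_def)
    also have "FA (\<theta> B ?X) \<dots> = i1 \<phi>"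
      using name1(4)[OF A(2), of "i1 \<phi>" ?X] \<phi>' by simp
    finally show ?thesis .
  qed
  ultimately have "\<phi> = T1 E u" using Eu \<phi>' by (simp add: ifun_eq_iff)
  then show ?thesis using u by blast
qed

text \<open>By naturality of \<open>\<theta>\<close>, equal images under \<open>E\<close> force
  \<open>u\<close> and \<open>v\<close> to act equally on all 1-cells and 2-cells from discrete
  objects, and density determines a 1-cell from this action.\<close>

lemma E_faithful1:
  assumes u: "u \<in> hom (One W) A B" and v: "v \<in> hom (One W) A B" and eq: "T1 E u = T1 E v"
  shows "u = v"
proof -
  have u': "u \<in> Ar (One W)" "Src (One W) u = A" "Tgt (One W) u = B"
    and v': "v \<in> Ar (One W)" "Src (One W) v = A" "Tgt (One W) v = B" using u v by (simp_all add: hom_iff)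
  have A: "A \<in> Ob (One W)" "B \<in> Ob (One W)" using u' by auto
  have 0: "u \<cdot> p = v \<cdot> p" if p: "X \<in> Ob C" "p \<in> hom (One W) (F0 X) A" for X p
  proof -
    have p': "p \<in> Ar (One W)" "Src (One W) p = F0 X" "Tgt (One W) p = A" using p
      by (simp_all add: hom_iff)
    show ?thesis
      by (rule theta_Ob_eq[OF p(1), of _ B])
        (use p' u' v' eq theta_natural(1)[OF p(1) u'(1) p'(1,2) _ u'(3)]
          theta_natural(1)[OF p(1) v'(1) p'(1,2) _ v'(3)] in simp_all)
  qed
  have 1: "wl W u a = wl W v a" if a: "X \<in> Ob C" "a \<in> Ar (homcat W (F0 X) A)" for X a
  proof -
    have a': "a \<in> Ar (Two W)" "Src (One W) (Src (Two W) a) = F0 X" "Tgt (One W) (Src (Two W) a) = A"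
      using a unfolding homcat_Ar_iff by blast+
    show ?thesis
      by (rule theta_Ar_eq[OF a(1), of _ B])
        (use a' u' v' eq theta_natural(2)[OF a(1) u'(1) a'(1,2) _ u'(3)]
          theta_natural(2)[OF a(1) v'(1) a'(1,2) _ v'(3)] in simp_all)
  qed
  have uO: "u \<in> Ob (homcat W A B)" "v \<in> Ob (homcat W A B)" using u v by simp_all
  \<comment> \<open>Unique existence is applied to the transformation induced by \<open>v\<close>;
    both \<open>u\<close> and \<open>v\<close> are solutions.\<close>
  note ex = iso_to_transfD(3)[OF dense_iso[OF A] iso_to_transfD(1)[OF dense_iso[OF A] uO(2)]]
  show ?thesis
    by (rule ex1_eq[OF ex]) (use uO 0 1 in \<open>simp_all del: homcat_simps add: homcat_simps(1)\<close>)
qed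

text \<open>The boundaries of \<open>c\<close> and \<open>d\<close> agree by injectivity on 1-cells.
  Both then induce the same modification, which density attaches to only one 2-cell.\<close>

lemma E_faithful2:
  assumes c: "c \<in> Ar (homcat W A B)" and d: "d \<in> Ar (homcat W A B)" and eq: "T2 E c = T2 E d"
  shows "c = d"
proof -
  have c': "c \<in> Ar (Two W)" "Src (One W) (Src (Two W) c) = A" "Tgt (One W) (Src (Two W) c) = B"
    and d': "d \<in> Ar (Two W)" "Src (One W) (Src (Two W) d) = A" "Tgt (One W) (Src (Two W) d) = B"
    using c d unfolding homcat_Ar_iff by blast+
  have A: "A \<in> Ob (One W)" "B \<in> Ob (One W)" using c' by auto
  define u v where "u = Src (Two W) d" and "v = Tgt (Two W) d"
  have uv: "u \<in> hom (One W) A B" "v \<in> hom (One W) A B"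
    using d' unfolding u_def v_def by (simp_all add: hom_iff)
  have "Src (Two W) c = u"
    unfolding u_def by (rule E_faithful1[of _ A B])
      (use c' d' E_simps(8)[of c] E_simps(8)[of d] eq in \<open>simp_all add: hom_iff\<close>)
  moreover have "Tgt (Two W) c = v"
    unfolding v_def by (rule E_faithful1[of _ A B])
      (use c' d' E_simps(9)[of c] E_simps(9)[of d] eq in \<open>simp_all add: hom_iff\<close>)
  ultimately have h: "c \<in> hom (homcat W A B) u v" "d \<in> hom (homcat W A B) u v"
    using c d by (simp_all add: hom_iff u_def v_def)
  have e: "wr W c p = wr W d p" if p: "X \<in> Ob C" "p \<in> hom (One W) (F0 X) A" for X p
  proof -
    have p': "p \<in> Ar (One W)" "Src (One W) p = F0 X" "Tgt (One W) p = A" using p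
      by (simp_all add: hom_iff)
    show ?thesis
      by (rule theta_Ar_eq[OF p(1), of _ B])
        (use p' c' d' eq theta_natural(3)[OF p(1) c'(1) p'(1,2) _ c'(3)]
          theta_natural(3)[OF p(1) d'(1) p'(1,2) _ d'(3)] in simp_all)
  qed
  have st: "Src (homcat W A B) d = u" "Tgt (homcat W A B) d = v" by (simp_all add: u_def v_def)
  have uvO: "u \<in> Ob (homcat W A B)" "v \<in> Ob (homcat W A B)" using uv by simp_all
  have ex: "\<exists>!a. a \<in> hom (homcat W A B) u v \<and>
      (\<forall>X\<in>Ob (One K). \<forall>p\<in>Ob (Fib (fam W N A) X). wr W a p = wr W d p)"
    using iso_to_transfD(4)[OF dense_iso[OF A] uvO iso_to_transfD(2)[OF dense_iso[OF A] d,
        unfolded st]] .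
  have "\<forall>X\<in>Ob (One K). \<forall>p\<in>Ob (Fib (fam W N A) X). wr W c p = wr W d p"
    using e by simp
  note h = h this
  show ?thesis
    by (rule ex1_eq[OF ex]) (use h in \<open>simp_all del: homcat_simps\<close>)
qed

text \<open>After lifting source and target to \<open>u\<close> and \<open>v\<close>, the component
  \<open>t\<close> acts on generalised objects by composition. Conjugated by \<open>\<theta>\<close>
  this action is a modification, and density realises it by whiskering with a 2-cell.\<close>

lemma E_full2:
  assumes A: "A \<in> Ob (One W)" "B \<in> Ob (One W)"
    and \<tau>: "\<tau> \<in> Ar (homcat V (T0 E A) (T0 E B))"
  shows "\<tau> \<in> T2 E ` Ar (homcat W A B)"
proof -
  let ?A = "T0 E A" and ?B = "T0 E B"
  obtain \<phi> \<psi> t where \<tau>_eq: "\<tau> = \<lparr>tsrc = \<phi>, ttgt = \<psi>, tcmp = t\<rparr>" by (cases \<tau>) auto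
  have tr: "internal_transformation C \<lparr>tsrc = \<phi>, ttgt = \<psi>, tcmp = t\<rparr>" "isrc \<phi> = ?A" "itgt \<phi> = ?B"
    using \<tau> by (simp_all add: \<tau>_eq)
  note t = transformationD[OF C tr]
  obtain u where u: "u \<in> hom (One W) A B" "T1 E u = \<phi>"
    using E_full1[OF A, of \<phi>] t by (auto simp: hom_iff)
  obtain v where v: "v \<in> hom (One W) A B" "T1 E v = \<psi>"
    using E_full1[OF A, of \<psi>] t by (auto simp: hom_iff)
  have u': "u \<in> Ar (One W)" "Src (One W) u = A" "Tgt (One W) u = B"
    and v': "v \<in> Ar (One W)" "Src (One W) v = A" "Tgt (One W) v = B" using u v by (simp_all add: hom_iff)
  define \<mu> where "\<mu> X p = name1 B X (t \<odot> FO (\<theta> A X) p)" for X p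
  have \<mu>0: "\<mu> X p \<in> Ar (Two W)" "Src (One W) (Src (Two W) (\<mu> X p)) = F0 X"
      "Tgt (One W) (Src (Two W) (\<mu> X p)) = B" "FA (\<theta> B X) (\<mu> X p) = t \<odot> FO (\<theta> A X) p"
    if p: "X \<in> Ob C" "p \<in> Ar (One W)" "Src (One W) p = F0 X" "Tgt (One W) p = A" for X p
    using name1[OF A(2), of "t \<odot> FO (\<theta> A X) p" X] theta_Ob[OF p] t(9-11) C unfolding \<mu>_def by simp_all
  have \<mu>s: "Src (Two W) (\<mu> X p) = u \<cdot> p" "Tgt (Two W) (\<mu> X p) = v \<cdot> p"
    if p: "X \<in> Ob C" "p \<in> Ar (One W)" "Src (One W) p = F0 X" "Tgt (One W) p = A" for X p
  proof -
    note m = \<mu>0[OF p]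
    have m': "Src (Two W) (\<mu> X p) \<in> Ar (One W)" "Tgt (Two W) (\<mu> X p) \<in> Ar (One W)"
      "Src (One W) (Tgt (Two W) (\<mu> X p)) = F0 X" "Tgt (One W) (Tgt (Two W) (\<mu> X p)) = B"
      using src_tgt2[OF W m(1)] m(2,3) by simp_all
    have "FO (\<theta> B X) (Src (Two W) (\<mu> X p)) = FO (\<theta> B X) (u \<cdot> p)"
      "FO (\<theta> B X) (Tgt (Two W) (\<mu> X p)) = FO (\<theta> B X) (v \<cdot> p)"
      unfolding theta_Ar(4,5)[OF p(1) m(1-3), symmetric] m(4)
      using t(14,15) theta_Ob[OF p] theta_natural(1)[OF p(1) u'(1) p(2,3) _ u'(3)]
        theta_natural(1)[OF p(1) v'(1) p(2,3) _ v'(3)] u(2) v(2) u' v' p by simp_all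
    then show "Src (Two W) (\<mu> X p) = u \<cdot> p" "Tgt (Two W) (\<mu> X p) = v \<cdot> p"
      using theta_Ob_eq[OF p(1) m'(1) m(2,3)] theta_Ob_eq[OF p(1) m'(2-4)] u' v' p by simp_all
  qed
  \<comment> \<open>Through \<open>\<theta>\<close>, this is internal naturality of \<open>t\<close>
    at the generalised arrow \<open>FA (\<theta> A X) a\<close>.\<close>
  have \<mu>n: "Cmp (Two W) (\<mu> X (Tgt (Two W) a)) (wl W u a) = Cmp (Two W) (wl W v a) (\<mu> X (Src (Two W) a))"
    if a: "X \<in> Ob C" "a \<in> Ar (Two W)" "Src (One W) (Src (Two W) a) = F0 X"
      "Tgt (One W) (Src (Two W) a) = A" for X a
  proof -
    have s: "Src (Two W) a \<in> Ar (One W)" "Tgt (Two W) a \<in> Ar (One W)"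
      "Src (One W) (Tgt (Two W) a) = F0 X" "Tgt (One W) (Tgt (Two W) a) = A"
      using a by simp_all
    note ms = \<mu>0[OF a(1) s(1) a(3,4)] \<mu>s[OF a(1) s(1) a(3,4)]
      and mt = \<mu>0[OF a(1) s(2-4)] \<mu>s[OF a(1) s(2-4)]
    note ta = theta_Ar[OF a]
    have ul: "wl W u a \<in> Ar (Two W)" "Src (One W) (Src (Two W) (wl W u a)) = F0 X"
        "Tgt (One W) (Src (Two W) (wl W u a)) = B" "Tgt (Two W) (wl W u a) = u \<cdot> Tgt (Two W) a"
      and vl: "wl W v a \<in> Ar (Two W)" "Src (One W) (Src (Two W) (wl W v a)) = F0 X"
        "Tgt (One W) (Src (Two W) (wl W v a)) = B" "Src (Two W) (wl W v a) = v \<cdot> Src (Two W) a"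
      using a u' v' by simp_all
    have c1: "Tgt (Two W) (wl W u a) = Src (Two W) (\<mu> X (Tgt (Two W) a))" unfolding ul mt ..
    have c2: "Tgt (Two W) (\<mu> X (Src (Two W) a)) = Src (Two W) (wl W v a)" unfolding vl ms ..
    have "FA (\<theta> B X) (Cmp (Two W) (\<mu> X (Tgt (Two W) a)) (wl W u a)) =
        gcmp C ?B (t \<odot> (icod ?A \<odot> FA (\<theta> A X) a)) (i1 \<phi> \<odot> FA (\<theta> A X) a)"
      unfolding theta_Cmp[OF a(1) ul(1-3) mt(1) c1] mt(4) ta(5)
      using theta_natural(2)[OF a(1) u'(1) a(2,3) _ u'(3)] u(2) u' a by simp
    also have "\<dots> = gcmp C ?B (i1 \<psi> \<odot> FA (\<theta> A X) a) (t \<odot> (idom ?A \<odot> FA (\<theta> A X) a))"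
      by (rule transformation_naturalD(2)[OF C tr ta(1,3) refl refl, symmetric])
    also have "\<dots> = FA (\<theta> B X) (Cmp (Two W) (wl W v a) (\<mu> X (Src (Two W) a)))"
      unfolding theta_Cmp[OF a(1) ms(1-3) vl(1) c2] ms(4) ta(4)
      using theta_natural(2)[OF a(1) v'(1) a(2,3) _ v'(3)] v(2) v' a by simp
    finally show ?thesis
      by (rule theta_Ar_eq[OF a(1), rotated -1]) (use ms mt ul vl c1 c2 in simp_all)
  qed
  have \<mu>b: "wr W (\<mu> (Tgt C f) p) (F1 f) = \<mu> (Src C f) (p \<cdot> F1 f)"
    if f: "f \<in> Ar C" and p: "p \<in> Ar (One W)" "Src (One W) p = F0 (Tgt C f)" "Tgt (One W) p = A" for f p
  proof -
    have X: "Tgt C f \<in> Ob C" "Src C f \<in> Ob C" using f C by simp_all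
    have pf: "p \<cdot> F1 f \<in> Ar (One W)" "Src (One W) (p \<cdot> F1 f) = F0 (Src C f)" "Tgt (One W) (p \<cdot> F1 f) = A"
      using p f by simp_all
    note m = \<mu>0[OF X(1) p] and mf = \<mu>0[OF X(2) pf]
    have "FA (\<theta> B (Src C f)) (wr W (\<mu> (Tgt C f) p) (F1 f)) = FA (\<theta> B (Src C f)) (\<mu> (Src C f) (p \<cdot> F1 f))"
      unfolding theta_natural_base(2)[OF f refl m(1-3)] mf(4) m(4) theta_natural_base(1)[OF f refl p]
      using theta_Ob[OF X(1) p] t(9-11) f C by simp
    then show ?thesis
      by (rule theta_Ar_eq[OF X(2), rotated -1]) (use m mf f in simp_all)
  qed
  have mod: "modification K (fam W N A) (fam W N B)
      (\<lambda>X. \<lparr>FO = (\<lambda>p. u \<cdot> p), FA = (\<lambda>a. wl W u a)\<rparr>) (\<lambda>X. \<lparr>FO = (\<lambda>p. v \<cdot> p), FA = (\<lambda>a. wl W v a)\<rparr>) \<mu>"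
    unfolding modification_def
  proof (intro conjI ballI)
    fix X p assume "X \<in> Ob (One K)" "p \<in> Ob (Fib (fam W N A) X)"
    then have p: "X \<in> Ob C" "p \<in> Ar (One W)" "Src (One W) p = F0 X" "Tgt (One W) p = A"
      by (simp_all add: hom_iff)
    show "\<mu> X p \<in> hom (Fib (fam W N B) X) (FO \<lparr>FO = (\<lambda>p. u \<cdot> p), FA = (\<lambda>a. wl W u a)\<rparr> p)
        (FO \<lparr>FO = (\<lambda>p. v \<cdot> p), FA = (\<lambda>a. wl W v a)\<rparr> p)"
      using \<mu>0[OF p] \<mu>s[OF p] by (simp add: hom_iff src0_def tgt0_def)
  next
    fix X a assume "X \<in> Ob (One K)" "a \<in> Ar (Fib (fam W N A) X)"
    then show "Cmp (Fib (fam W N B) X) (\<mu> X (Tgt (Fib (fam W N A) X) a)) (FA \<lparr>FO = (\<lambda>p. u \<cdot> p),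
        FA = (\<lambda>a. wl W u a)\<rparr> a) =
        Cmp (Fib (fam W N B) X) (FA \<lparr>FO = (\<lambda>p. v \<cdot> p), FA =
            (\<lambda>a. wl W v a)\<rparr> a) (\<mu> X (Src (Fib (fam W N A) X) a))"
      using \<mu>n[of X a] by (simp add: src0_def tgt0_def)
  next
    fix f p assume "f \<in> Ar (One K)" "p \<in> Ob (Fib (fam W N A) (Src (One K) f))"
    then show "FA (Tr (fam W N B) f) (\<mu> (Src (One K) f) p) =
        \<mu> (Tgt (One K) f) (FO (Tr (fam W N A) f) p)"
      using \<mu>b[of f p] by (simp add: hom_iff)
  qed
  have uvO: "u \<in> Ob (homcat W A B)" "v \<in> Ob (homcat W A B)" using u v by simp_all
  obtain c where c: "c \<in> hom (homcat W A B) u v"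
    and cp: "\<And>X p. X \<in> Ob C \<Longrightarrow> p \<in> hom (One W) (F0 X) A \<Longrightarrow> wr W c p = \<mu> X p"
    using ex1_implies_ex[OF iso_to_transfD(4)[OF dense_iso[OF A] uvO mod]]
    by (elim exE conjE) (rule that; simp del: homcat_simps(2); blast)
  have cA: "c \<in> Ar (homcat W A B)" using c by (simp add: hom_iff)
  have c': "c \<in> Ar (Two W)" "Src (Two W) c = u" "Tgt (Two W) c = v" using c by (simp_all add: hom_iff)
  have Ec: "internal_transformation C (T2 E c)" "tsrc (T2 E c) = \<phi>" "ttgt (T2 E c) = \<psi>"
    using E_simps(7-9)[of c] c' u v by simp_all
  \<comment> \<open>The component of \<open>T2 E c\<close> is read off at the universal object, the
    identity of \<open>I0 (T0 E A)\<close>.\<close>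
  have "tcmp (T2 E c) = t"
  proof -
    let ?X = "I0 ?A"
    have X: "?X \<in> Ob C" using A C by simp
    let ?p = "name0 A ?X (Idn C ?X)"
    have p: "?p \<in> Ar (One W)" "Src (One W) ?p = F0 ?X" "Tgt (One W) ?p = A" "FO (\<theta> A ?X) ?p = Idn C ?X"
      using name0[OF A(1), of "Idn C ?X" ?X] X C by simp_all
    have "tcmp (T2 E c) = FA (\<theta> B ?X) (wr W c ?p)"
      using theta_natural(3)[OF X c'(1) p(1,2)] p u' c' internal_transformation_simps[OF C Ec(1)]
          Ec t(5) C by simp
    also have "wr W c ?p = \<mu> ?X ?p"
      using cp[OF X, of ?p] p by (simp add: hom_iff)
    also have "FA (\<theta> B ?X) \<dots> = t"
      using \<mu>0(4)[OF X p(1-3)] p(4) t(9,10) C by simp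
    finally show ?thesis .
  qed
  then have "\<tau> = T2 E c" using Ec by (simp add: \<tau>_eq)
  then show ?thesis using cA by blast
qed

lemma E_locally_iso: "locally_iso W V E"
  unfolding locally_iso_def iso_functor_def
proof (intro ballI conjI)
  fix A B assume A: "A \<in> Ob (One W)" "B \<in> Ob (One W)"
  show "is_functor (homcat W A B) (homcat V (T0 E A) (T0 E B)) \<lparr>FO = T1 E, FA = T2 E\<rparr>"
    using twofunctor_simps[OF W V E2] unfolding is_functor_def by (simp add: hom_iff src0_def tgt0_def)
  show "bij_betw (FO \<lparr>FO = T1 E, FA = T2 E\<rparr>) (Ob (homcat W A B)) (Ob (homcat V (T0 E A) (T0 E B)))"
    unfolding bij_betw_def
  proof
    show "inj_on (FO \<lparr>FO = T1 E, FA = T2 E\<rparr>) (Ob (homcat W A B))"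
      using E_faithful1[of _ A B] by (auto intro!: inj_onI)
    show "FO \<lparr>FO = T1 E, FA = T2 E\<rparr> ` Ob (homcat W A B) = Ob (homcat V (T0 E A) (T0 E B))"
      using E_full1[OF A] twofunctor_hom[OF W V E2, of _ A B] by auto
  qed
  show "bij_betw (FA \<lparr>FO = T1 E, FA = T2 E\<rparr>) (Ar (homcat W A B)) (Ar (homcat V (T0 E A) (T0 E B)))"
    unfolding bij_betw_def
  proof
    show "inj_on (FA \<lparr>FO = T1 E, FA = T2 E\<rparr>) (Ar (homcat W A B))"
      using E_faithful2[of _ A B] by (intro inj_onI) (simp del: homcat_simps)
    have "T2 E c \<in> Ar (homcat V (T0 E A) (T0 E B))" if "c \<in> Ar (homcat W A B)" for c
      using that E_simps(2-4)[of "Src (Two W) c"] E_simps(7-8)[of c] unfolding homcat_Ar_iff by simp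
    then show "FA \<lparr>FO = T1 E, FA = T2 E\<rparr> ` Ar (homcat W A B) = Ar (homcat V (T0 E A) (T0 E B))"
      using E_full2[OF A] by (auto simp del: homcat_simps)
  qed
qed

end
end

theorem theorem6:
  fixes W :: "('o, 'm, 'c) twocat"
    and N :: "('o, 'm, 'x, 'f) discreteness"
    and E :: "('o, 'm, 'c, ('x, 'f) icat, ('x, 'f) ifun, ('x, 'f) itrans) twofun"
    and \<theta> :: "'o \<Rightarrow> 'x \<Rightarrow> ('m, 'c, 'f, 'f) fctr"
    and A :: 'o
  assumes "twocategory W" and "has_finite_limits W"
    and "notion_of_discreteness W N"
    and "associated_category W N E \<theta>"
    and "A \<in> Ob (One W)"
  shows "(\<forall>\<kappa>. has_connective W N \<kappa> A \<longrightarrow>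
            has_connective (intcat (Base N)) (standard_discreteness (Base N)) \<kappa> (T0 E A)) \<and>
         (discrete_objects_dense W N \<longrightarrow>
            (\<forall>\<kappa>. has_connective (intcat (Base N)) (standard_discreteness (Base N)) \<kappa> (T0 E A) \<longrightarrow>
              has_connective W N \<kappa> A))"
proof -
  interpret associated W N E \<theta>
    using assms(1,3,4) by unfold_locales
  note e = counit_simps[OF assms(5)]
  have counit: "Counit N A \<in> hom (One W) (discrete_part N A) A"
    using e by (simp add: hom_iff)
  \<comment> \<open>This isomorphism matches the literal \<open>idisc\<close> of the standard
    discreteness with the image of the discrete part of \<open>A\<close>.\<close>
  obtain j j' where j: "inverses V j j'"
    "j \<in> hom (One V) (T0 E (discrete_part N A)) (discrete_part (standard_discreteness C) (T0 E A))"
    "Cmp (One V) (Counit (standard_discreteness C) (T0 E A)) j = T1 E (Counit N A)"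
    "Counit (standard_discreteness C) (T0 E A) \<in>
      hom (One V) (discrete_part (standard_discreteness C) (T0 E A)) (T0 E A)"
    by (rule E_discrete_part[OF assms(5)])
  show ?thesis
  proof (intro conjI allI impI)
    fix \<kappa> assume A: "has_connective W N \<kappa> A"
    show "has_connective V (standard_discreteness C) \<kappa> (T0 E A)"
      by (rule connective_preserved[OF W V E2 _ _ A counit j(1,2,4,3)])
        (rule E_terminal E_product, assumption)+
  next
    fix \<kappa> assume dense: "discrete_objects_dense W N"
      and A: "has_connective V (standard_discreteness C) \<kappa> (T0 E A)"
    show "has_connective W N \<kappa> A"
      by (rule connective_reflected[OF W V E2 _ _ E_locally_iso[OF dense] assms(2,5) e(5) A
            counit j(1,2,4,3)])
        (rule E_terminal E_product, assumption)+
  qed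
qed

end
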